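(* Fix constants $0<\alpha<\frac12$, $0\le\gamma<\frac12$, $2\gamma<\gamma_q\le1$, $c_q>0$, $\sigma_0>0$, $\bar c\ge 1$. There exist positive constants $c,c_1,C_1$, depending only on these fixed constants, such that for all sufficiently large $n,p$, every integer $k\ge1$ with $k\le c\min\{p^{\gamma},\frac{n}{\log p}\}$, and every $\xi\in\Xi(q,\bar c)$ with $q=c_q\,p^{\gamma_q}$ (the dense loading regime), the minimax expected length of $(1-\alpha)$-level confidence intervals for $\xi^{\intercal}\beta$ over $\Theta(k,\mathrm{I},\sigma_0)$ satisfies $$c_1\,\|\xi\|_\infty\, k\sqrt{\frac{\log p}{n}}\;\le\; L^*_\alpha\big(\Theta(k,\mathrm{I},\sigma_0),\xi^{\intercal}\beta\big)\;\le\; C_1\,\|\xi\|_\infty\, k\sqrt{\frac{\log p}{n}} .$$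
   Context: Model: one observes $Z=(Z_1,\dots,Z_n)$ with $Z_i=(y_i,X_{i\cdot})\in\mathbb{R}^{p+1}$, $y=X\beta+\epsilon$, where $X\in\mathbb{R}^{n\times p}$ has i.i.d. rows $X_{i\cdot}\sim N_p(0,\Sigma)$, independent of $\epsilon\sim N_n(0,\sigma^2 \mathrm{I})$. Let $\Omega=\Sigma^{-1}$ and $\theta=(\beta,\Omega,\sigma)$; $\mathbb{P}_\theta,\mathbb{E}_\theta$ are the corresponding probability and expectation. $\|x\|_0$ is the number of nonzero entries of $x$, $\mathrm{supp}(x)$ the set of their indices. Parameter space (known design covariance and noise level): $\Theta(k,\mathrm{I},\sigma_0)=\{(\beta,\mathrm{I},\sigma_0):\|\beta\|_0\le k\}$. Loadings: $\Xi(q,\bar c)=\{\xi\in\mathbb{R}^p:\ \|\xi\|_0=q,\ \xi\ne 0,\ \max_{j\in\mathrm{supp}(\xi)}|\xi_j|\le\bar c\min_{j\in\mathrm{supp}(\xi)}|\xi_j|\}$. Confidence intervals: for a parameter space $\Theta$ and functional $\mathrm{T}$ of $\beta$, $\mathcal{I}_\alpha(\Theta,\mathrm{T})$ is the set of all intervals $\mathrm{CI}=[l(Z),u(Z)]$ with $\inf_{\theta\in\Theta}\mathbb{P}_\theta(l(Z)\le \mathrm{T}(\beta)\le u(Z))\ge 1-\alpha$; the length is $L(\mathrm{CI})=u(Z)-l(Z)$. The minimax expected length is $L^*_\alpha(\Theta,\mathrm{T})=\inf_{\mathrm{CI}\in\mathcal{I}_\alpha(\Theta,\mathrm{T})}\sup_{\theta\in\Theta}\mathbb{E}_\theta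 L(\mathrm{CI})$. *)

theory Defs
  imports "HOL-Probability.Probability" "Jordan_Normal_Form.Determinant"
begin

no_notation inner (infix "\<bullet>" 70)
no_notation vec_nth (infixl "$" 90)
hide_const (open) Determinants.det Finite_Cartesian_Product.vec
hide_type (open) Finite_Cartesian_Product.vec

text \<open>
  Parameters are vectors and matrices of dynamic size (the dimensions \<open>n\<close>, \<open>p\<close> vary inside the
  theorem). Random vectors live in product measure spaces, i.e. they are functions
  \<open>nat \<Rightarrow> real\<close> on \<open>{..<p}\<close>, extensional outside; \<open>vec p x\<close> turns such an \<open>x\<close> into a vector.
\<close>

definition supp_vec :: "real vec \<Rightarrow> nat set" where
  "supp_vec x = {j. j < dim_vec x \<and> x $ j \<noteq> 0}"

definition l0_norm :: "real vec \<Rightarrow> nat" where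
  "l0_norm x = card (supp_vec x)"

definition linf_norm :: "real vec \<Rightarrow> real" where
  "linf_norm x = Max ((\<lambda>j. \<bar>x $ j\<bar>) ` {..<dim_vec x})"

text \<open>
  The centred Gaussian law on \<open>\<real>\<^sup>p\<close>, parametrised by its precision matrix
  \<open>\<Omega> = \<Sigma>\<inverse>\<close>; it is the law \<open>N\<^sub>p(0, \<Sigma>)\<close> when \<open>\<Omega>\<close> is symmetric positive definite.
\<close>

definition mvn_precision :: "nat \<Rightarrow> real mat \<Rightarrow> (nat \<Rightarrow> real) measure" where
  "mvn_precision p \<Omega> = density (\<Pi>\<^sub>M j\<in>{..<p}. lborel)
     (\<lambda>x. ennreal (sqrt (det \<Omega> / (2 * pi) ^ p) *
        exp (- (vec p x \<bullet> (\<Omega> *\<^sub>v vec p x)) / 2)))"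

type_synonym param = "real vec \<times> real mat \<times> real"

type_synonym obs = "nat \<Rightarrow> real \<times> (nat \<Rightarrow> real)"

definition obs_space :: "nat \<Rightarrow> nat \<Rightarrow> obs measure" where
  "obs_space n p = (\<Pi>\<^sub>M i\<in>{..<n}. borel \<Otimes>\<^sub>M (\<Pi>\<^sub>M j\<in>{..<p}. borel))"

text \<open>
  The law of \<open>Z = (y\<^sub>i, X\<^sub>i)\<^sub>i\<close> with \<open>y = X \<beta> + \<epsilon>\<close>: the rows \<open>X\<^sub>i\<close> are i.i.d.\ and
  independent of the noise \<open>\<epsilon>\<close>, whose coordinates are i.i.d.\ \<open>N(0, \<sigma>\<^sup>2)\<close>
  (the second argument of \<^const>\<open>normal_density\<close> is the standard deviation).
\<close>

definition obs_law :: "nat \<Rightarrow> nat \<Rightarrow> param \<Rightarrow> obs measure" where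
  "obs_law n p = (\<lambda>(\<beta>, \<Omega>, \<sigma>).
     distr ((\<Pi>\<^sub>M i\<in>{..<n}. mvn_precision p \<Omega>) \<Otimes>\<^sub>M
            (\<Pi>\<^sub>M i\<in>{..<n}. density lborel (\<lambda>t. ennreal (normal_density 0 \<sigma> t))))
       (obs_space n p)
       (\<lambda>(X, \<epsilon>). \<lambda>i\<in>{..<n}. (vec p (X i) \<bullet> \<beta> + \<epsilon> i, X i)))"

definition param_space :: "nat \<Rightarrow> nat \<Rightarrow> real mat \<Rightarrow> real \<Rightarrow> param set" where
  "param_space p k \<Omega> \<sigma> = {(\<beta>, \<Omega>, \<sigma>) |\<beta>. \<beta> \<in> carrier_vec p \<and> l0_norm \<beta> \<le> k}"

definition loadings :: "nat \<Rightarrow> nat \<Rightarrow> real \<Rightarrow> real vec set" where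
  "loadings p q cbar = {\<xi> \<in> carrier_vec p. l0_norm \<xi> = q \<and> \<xi> \<noteq> 0\<^sub>v p \<and>
     Max ((\<lambda>j. \<bar>\<xi> $ j\<bar>) ` supp_vec \<xi>) \<le> cbar * Min ((\<lambda>j. \<bar>\<xi> $ j\<bar>) ` supp_vec \<xi>)}"

definition conf_intervals ::
  "nat \<Rightarrow> nat \<Rightarrow> real \<Rightarrow> param set \<Rightarrow> (real vec \<Rightarrow> real) \<Rightarrow> ((obs \<Rightarrow> real) \<times> (obs \<Rightarrow> real)) set" where
  "conf_intervals n p \<alpha> \<Theta> T = {(l, u).
     l \<in> borel_measurable (obs_space n p) \<and> u \<in> borel_measurable (obs_space n p) \<and>
     (\<forall>z \<in> space (obs_space n p). l z \<le> u z) \<and>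
     (INF \<theta>\<in>\<Theta>. emeasure (obs_law n p \<theta>)
        {z \<in> space (obs_space n p). l z \<le> T (fst \<theta>) \<and> T (fst \<theta>) \<le> u z}) \<ge> ennreal (1 - \<alpha>)}"

text \<open>Expected lengths are taken in \<open>[0, \<infinity>]\<close>; lengths are nonnegative for the intervals above.\<close>

definition minimax_length ::
  "nat \<Rightarrow> nat \<Rightarrow> real \<Rightarrow> param set \<Rightarrow> (real vec \<Rightarrow> real) \<Rightarrow> ennreal" where
  "minimax_length n p \<alpha> \<Theta> T =
     (INF (l, u)\<in>conf_intervals n p \<alpha> \<Theta> T. SUP \<theta>\<in>\<Theta>. \<integral>\<^sup>+ z. ennreal (u z - l z) \<partial>obs_law n p \<theta>)"

end

theory Submission
  imports Defs "HOL-Real_Asymp.Real_Asymp"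
begin

text \<open>
  \<^bold>\<open>Upper bound.\<close> As \<open>k\<close> and \<open>\<sigma>\<close> are known, an interval of fixed length around \<open>\<xi> \<bullet> b\<close> will do, for
  an estimator \<open>b\<close> whose \<open>\<ell>\<^sub>1\<close> error is of order \<open>k \<surd>(ln p / n)\<close> with high probability, uniformly over
  all \<open>k\<close>-sparse \<open>\<beta>\<close>; duality of \<open>\<ell>\<^sub>1\<close> and \<open>\<ell>\<^sub>\<infinity>\<close> then gives the length. Take for \<open>b\<close> any \<open>k\<close>-sparse
  vector whose residual has inner product less than \<open>\<eta> \<asymp> \<surd>(n ln p)\<close> with every column of \<open>X\<close>. With
  high probability \<open>\<beta>\<close> has this property too, and then \<open>\<delta> = b - \<beta>\<close> is \<open>2k\<close>-sparse with
  \<open>\<parallel>X\<delta>\<parallel>\<^sup>2 \<le> \<parallel>\<delta>\<parallel>\<^sub>1 \<parallel>X\<^sup>TX\<delta>\<parallel>\<^sub>\<infinity> \<le> 2\<eta> \<parallel>\<delta>\<parallel>\<^sub>1\<close>. If \<open>X\<close> does not contract sparse vectors, the left-hand side is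
  at least of order \<open>n \<parallel>\<delta>\<parallel>\<^sub>2\<^sup>2 \<ge> n \<parallel>\<delta>\<parallel>\<^sub>1\<^sup>2 / (2k)\<close>, which bounds \<open>\<parallel>\<delta>\<parallel>\<^sub>1\<close> by a multiple of \<open>k \<eta> / n\<close>. That
  \<open>X\<close> does not contract is needed only on sparse integer vectors with entries at most \<open>p\<^sup>2\<close>, for
  every direction is close to one of them (\<open>l1_error_bound\<close>). There are \<open>exp (O(k ln p))\<close> of these,
  each fails with probability at most \<open>exp (- n / 6)\<close> (\<open>direction_tail\<close>), and \<open>k ln p\<close> is at most a
  small multiple of \<open>n\<close>.

  \<^bold>\<open>Lower bound.\<close> Let \<open>\<beta>\<close> have \<open>k\<close> entries \<open>\<rho> sgn (\<xi>\<^sub>j)\<close> with \<open>\<rho> \<asymp> \<surd>(ln p / n)\<close> at random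
  places in the support of \<open>\<xi>\<close>. Then \<open>\<xi> \<bullet> \<beta>\<close> is at least of order \<open>k \<rho> \<parallel>\<xi>\<parallel>\<^sub>\<infinity>\<close>, and at most minus
  that for \<open>-\<beta>\<close>. If the two mixtures of laws are close in total variation, an interval valid for
  both has to reach both thresholds with a probability that is bounded below
  (\<open>long_interval_of_close_mixtures\<close>). Both are compared with the law under which \<open>y\<close> is independent
  of \<open>X\<close> and has the \<^emph>\<open>same\<close> marginal variance \<open>s\<^sup>2 = \<sigma>\<^sup>2 + \<parallel>\<beta>\<parallel>\<^sub>2\<^sup>2\<close>. Comparison with \<open>\<beta> = 0\<close> would not
  work: for \<open>k\<close> much larger than \<open>\<surd>n / ln p\<close> the empirical variance of \<open>y\<close> tells the mixtures
  from \<open>\<beta> = 0\<close>. With matched variances the likelihood ratios of \<open>\<beta>\<close> and \<open>\<beta>'\<close> have mixed second moment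
  \<open>(1 - \<beta> \<bullet> \<beta>' / s\<^sup>2)\<^sup>-\<^sup>n\<close> (\<open>row_affinity\<close>), at most \<open>p powr (d * j)\<close> for \<open>j\<close> common places, where
  \<open>d = 2 n \<rho>\<^sup>2 / (\<sigma>\<^sup>2 ln p)\<close> is a small constant. Two random supports rarely meet, because \<open>k\<^sup>2 \<le> p powr (2 * \<gamma>)\<close> is much
  smaller than \<open>q \<asymp> p powr \<gamma>\<^sub>q\<close>; so the averaged second moment tends to \<open>1\<close>.
\<close>

section \<open>Gaussian integrals\<close>

lemma PiM_density:
  assumes I: "finite I" and M: "sigma_finite_measure M"
    and f [measurable]: "f \<in> borel_measurable M" and fM: "sigma_finite_measure (density M f)"
  shows "(\<Pi>\<^sub>M i\<in>I. density M f) = density (\<Pi>\<^sub>M i\<in>I. M) (\<lambda>x. \<Prod>i\<in>I. f (x i))"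
proof -
  interpret L: product_sigma_finite "\<lambda>_. M" using M by (simp add: product_sigma_finite_def)
  interpret product_sigma_finite "\<lambda>_. density M f" using fM by (simp add: product_sigma_finite_def)
  have meas: "(\<lambda>x. \<Prod>i\<in>I. f (x i)) \<in> borel_measurable (\<Pi>\<^sub>M i\<in>I. M)" by measurable
  show ?thesis
  proof (rule PiM_eqI[symmetric, OF I])
    fix A assume "\<And>i. i \<in> I \<Longrightarrow> A i \<in> sets (density M f)"
    then have A [measurable]: "\<And>i. i \<in> I \<Longrightarrow> A i \<in> sets M" by simp
    have "emeasure (density (\<Pi>\<^sub>M i\<in>I. M) (\<lambda>x. \<Prod>i\<in>I. f (x i))) (Pi\<^sub>E I A)
        = (\<integral>\<^sup>+x. (\<Prod>i\<in>I. f (x i)) * indicator (Pi\<^sub>E I A) x \<partial>(\<Pi>\<^sub>M i\<in>I. M))"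
      using A I by (intro emeasure_density[OF meas] sets_PiM_I_finite) auto
    also have "\<dots> = (\<integral>\<^sup>+x. (\<Prod>i\<in>I. f (x i) * indicator (A i) (x i)) \<partial>(\<Pi>\<^sub>M i\<in>I. M))"
      using I by (intro nn_integral_cong)
        (auto simp: prod.distrib indicator_def PiE_iff space_PiM prod_zero_iff)
    also have "\<dots> = (\<Prod>i\<in>I. \<integral>\<^sup>+x. f x * indicator (A i) x \<partial>M)"
      by (rule L.product_nn_integral_prod[OF I]) measurable
    also have "\<dots> = (\<Prod>i\<in>I. emeasure (density M f) (A i))"
      using A by (intro prod.cong) (auto simp: emeasure_density)
    finally show "emeasure (density (\<Pi>\<^sub>M i\<in>I. M) (\<lambda>x. \<Prod>i\<in>I. f (x i))) (Pi\<^sub>E I A)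
        = (\<Prod>i\<in>I. emeasure (density M f) (A i))" .
  qed (auto intro!: sets_PiM_cong)
qed

definition gauss :: "real \<Rightarrow> real measure" where
  "gauss \<sigma> = density lborel (\<lambda>t. ennreal (normal_density 0 \<sigma> t))"

definition gauss_row :: "nat set \<Rightarrow> (nat \<Rightarrow> real) measure" where
  "gauss_row I = (\<Pi>\<^sub>M j\<in>I. gauss 1)"

lemma sets_gauss [simp, measurable_cong]: "sets (gauss \<sigma>) = sets borel"
  by (simp add: gauss_def)

lemma space_gauss [simp]: "space (gauss \<sigma>) = UNIV"
  by (simp add: gauss_def)

lemma prob_space_gauss: "0 < \<sigma> \<Longrightarrow> prob_space (gauss \<sigma>)"
  unfolding gauss_def by (rule prob_space_normal_density)

lemma nn_integral_gauss:
  "f \<in> borel_measurable borel \<Longrightarrow>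
    (\<integral>\<^sup>+x. f x \<partial>gauss \<sigma>) = (\<integral>\<^sup>+x. ennreal (normal_density 0 \<sigma> x) * f x \<partial>lborel)"
  unfolding gauss_def by (subst nn_integral_density) auto

lemma nn_integral_normal_density: "0 < \<sigma> \<Longrightarrow> (\<integral>\<^sup>+x. ennreal (normal_density \<mu> \<sigma> x) \<partial>lborel) = 1"
  using prob_space.emeasure_space_1[OF prob_space_normal_density[of \<sigma> \<mu>]]
  by (simp add: emeasure_density)

lemma normal_density_mult_self:
  assumes "0 < \<tau>"
  shows "normal_density 0 \<tau> x * normal_density 0 \<tau> x
    = 1 / (2 * sqrt pi * \<tau>) * normal_density 0 (\<tau> / sqrt 2) x"
  using assms by (simp add: normal_density_def exp_add[symmetric] power_divide real_sqrt_mult field_simps)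

lemma normal_density_ratio:
  assumes "0 < \<tau>" "\<tau> < s" 
  defines "\<kappa> \<equiv> \<tau> * s / sqrt (s\<^sup>2 - \<tau>\<^sup>2)"
  shows "normal_density 0 \<tau> x / normal_density 0 s x = s * \<kappa> * sqrt (2 * pi) / \<tau> * normal_density 0 \<kappa> x"
proof -
  have pos: "0 < s\<^sup>2 - \<tau>\<^sup>2" using assms by (simp add: power_strict_mono)
  have k2: "\<kappa>\<^sup>2 = \<tau>\<^sup>2 * s\<^sup>2 / (s\<^sup>2 - \<tau>\<^sup>2)" using pos by (simp add: \<kappa>_def power_divide power_mult_distrib)
  have kp: "0 < \<kappa>" using assms pos by (simp add: \<kappa>_def)
  have e: "- x\<^sup>2 / (2 * \<tau>\<^sup>2) - (- x\<^sup>2 / (2 * s\<^sup>2)) = - x\<^sup>2 / (2 * \<kappa>\<^sup>2)"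
    unfolding k2 using assms pos by (simp add: divide_simps) (simp add: algebra_simps)
  have "normal_density 0 \<tau> x / normal_density 0 s x
      = s / \<tau> * exp (- x\<^sup>2 / (2 * \<tau>\<^sup>2) - (- x\<^sup>2 / (2 * s\<^sup>2)))"
    using assms unfolding exp_diff by (simp add: normal_density_def real_sqrt_mult field_simps)
  also have "\<dots> = s * \<kappa> * sqrt (2 * pi) / \<tau> * normal_density 0 \<kappa> x"
    unfolding e using assms kp by (simp add: normal_density_def real_sqrt_mult)
  finally show ?thesis .
qed

lemma gauss_scaled_convolution:
  assumes \<tau>: "0 < \<tau>"
  shows "(\<integral>\<^sup>+x. ennreal (normal_density 0 \<tau> (y - x * w)) \<partial>gauss 1)
    = ennreal (normal_density 0 (sqrt (\<tau>\<^sup>2 + w\<^sup>2)) y)"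
proof (cases "w = 0")
  case True
  then show ?thesis using \<tau> prob_space.emeasure_space_1[OF prob_space_gauss[of 1]] by simp
next
  case False
  have "(\<integral>\<^sup>+x. ennreal (normal_density 0 \<tau> (y - x * w)) \<partial>gauss 1)
      = (\<integral>\<^sup>+x. ennreal \<bar>w\<bar> * ennreal (normal_density 0 \<tau> (y - (0 + w * x)) * normal_density 0 \<bar>w\<bar> (0 + w * x)) \<partial>lborel)"
  proof (subst nn_integral_gauss, simp, rule nn_integral_cong)
    fix x
    have "normal_density 0 1 x = \<bar>w\<bar> * normal_density 0 \<bar>w\<bar> (w * x)"
      using False by (simp add: normal_density_def real_sqrt_mult power_mult_distrib)
    then show "ennreal (normal_density 0 1 x) * ennreal (normal_density 0 \<tau> (y - x * w))
      = ennreal \<bar>w\<bar> * ennreal (normal_density 0 \<tau> (y - (0 + w * x)) * normal_density 0 \<bar>w\<bar> (0 + w * x))"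
      by (simp add: ennreal_mult'[symmetric] ac_simps)
  qed
  also have "\<dots> = ennreal \<bar>w\<bar> * (\<integral>\<^sup>+x. ennreal (normal_density 0 \<tau> (y - (0 + w * x)) * normal_density 0 \<bar>w\<bar> (0 + w * x)) \<partial>lborel)"
    by (subst nn_integral_cmult) auto
  also have "\<dots> = (\<integral>\<^sup>+x. ennreal (normal_density 0 \<tau> (y - x) * normal_density 0 \<bar>w\<bar> x) \<partial>lborel)"
    using False by (subst (2) nn_integral_real_affine[of _ w 0]) auto
  also have "\<dots> = ennreal (normal_density 0 (sqrt (\<tau>\<^sup>2 + w\<^sup>2)) y)"
    using fun_cong[OF conv_normal_density_zero_mean[of \<tau> "\<bar>w\<bar>"], of y] \<tau> False by simp
  finally show ?thesis .
qed

lemma product_sigma_finite_gauss: "product_sigma_finite (\<lambda>_. gauss 1)"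
  unfolding product_sigma_finite_def
  by (auto intro!: prob_space_imp_sigma_finite prob_space_gauss)

lemma sets_gauss_row [measurable_cong]: "sets (gauss_row I) = sets (\<Pi>\<^sub>M j\<in>I. borel)"
  unfolding gauss_row_def by (intro sets_PiM_cong) auto

lemma prob_space_gauss_row: "prob_space (gauss_row I)"
  unfolding gauss_row_def by (intro prob_space_PiM prob_space_gauss) auto

text \<open>The law of a linear form \<open>\<Sum>j. x j * w j\<close> enters all later arguments through this integral alone.
  As \<open>\<tau>\<close> is positive, it needs no separate treatment of \<open>w = 0\<close>, where the form has no density; one
  coordinate is integrated out at a time.\<close>

lemma gauss_row_convolution:
  assumes "finite I" "0 < \<tau>"
  shows "(\<integral>\<^sup>+x. ennreal (normal_density 0 \<tau> (y - (\<Sum>j\<in>I. x j * w j))) \<partial>gauss_row I)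
    = ennreal (normal_density 0 (sqrt (\<tau>\<^sup>2 + (\<Sum>j\<in>I. (w j)\<^sup>2))) y)"
  using assms
proof (induction I arbitrary: y \<tau> rule: finite_induct)
  case empty
  then show ?case using prob_space.emeasure_space_1[OF prob_space_gauss_row[of "{}"]] by simp
next
  case (insert i I)
  interpret product_sigma_finite "\<lambda>_. gauss 1" by (rule product_sigma_finite_gauss)
  have pos: "0 < sqrt (\<tau>\<^sup>2 + (w i)\<^sup>2)" using insert.prems by (simp add: add_pos_nonneg)
  have sq: "(sqrt (\<tau>\<^sup>2 + (w i)\<^sup>2))\<^sup>2 = \<tau>\<^sup>2 + (w i)\<^sup>2" by simp
  have "(\<Sum>j\<in>I. (x(i := t)) j * w j) = (\<Sum>j\<in>I. x j * w j)" for x t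
    using insert by (intro sum.cong) auto
  then have upd: "y - (\<Sum>j\<in>insert i I. (x(i := t)) j * w j) = (y - (\<Sum>j\<in>I. x j * w j)) - t * w i" for x t
    using insert.hyps by simp
  have [measurable]: "(\<lambda>x. x j) \<in> borel_measurable (Pi\<^sub>M (insert i I) (\<lambda>_. gauss 1))"
    if "j \<in> insert i I" for j
    using measurable_component_singleton[OF that, of "\<lambda>_. gauss 1"] by (simp cong: measurable_cong_sets)
  have meas: "(\<lambda>x. ennreal (normal_density 0 \<tau> (y - (\<Sum>j\<in>insert i I. x j * w j))))
      \<in> borel_measurable (Pi\<^sub>M (insert i I) (\<lambda>_. gauss 1))" by measurable
  have "(\<integral>\<^sup>+x. ennreal (normal_density 0 \<tau> (y - (\<Sum>j\<in>insert i I. x j * w j))) \<partial>gauss_row (insert i I))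
     = (\<integral>\<^sup>+x. (\<integral>\<^sup>+t. ennreal (normal_density 0 \<tau> ((y - (\<Sum>j\<in>I. x j * w j)) - t * w i)) \<partial>gauss 1) \<partial>gauss_row I)"
    unfolding gauss_row_def product_nn_integral_insert[OF insert.hyps(1,2) meas] upd ..
  also have "\<dots> = (\<integral>\<^sup>+x. ennreal (normal_density 0 (sqrt (\<tau>\<^sup>2 + (w i)\<^sup>2)) (y - (\<Sum>j\<in>I. x j * w j))) \<partial>gauss_row I)"
    by (simp only: gauss_scaled_convolution[OF insert.prems])
  also have "\<dots> = ennreal (normal_density 0 (sqrt ((\<tau>\<^sup>2 + (w i)\<^sup>2) + (\<Sum>j\<in>I. (w j)\<^sup>2))) y)"
    using insert.IH[OF pos] unfolding sq .
  finally show ?case using insert.hyps by (simp add: add.assoc)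
qed

lemma gauss_exp_linear:
  assumes "0 < \<sigma>"
  shows "(\<integral>\<^sup>+x. ennreal (exp (s * x)) \<partial>gauss \<sigma>) = ennreal (exp (s\<^sup>2 * \<sigma>\<^sup>2 / 2))"
proof -
  have "(\<integral>\<^sup>+x. ennreal (exp (s * x)) \<partial>gauss \<sigma>)
      = (\<integral>\<^sup>+x. ennreal (exp (s\<^sup>2 * \<sigma>\<^sup>2 / 2)) * ennreal (normal_density (s * \<sigma>\<^sup>2) \<sigma> x) \<partial>lborel)"
  proof (subst nn_integral_gauss, simp, rule nn_integral_cong)
    fix x
    have e: "- x\<^sup>2 / (2 * \<sigma>\<^sup>2) + s * x = s\<^sup>2 * \<sigma>\<^sup>2 / 2 + - (x - s * \<sigma>\<^sup>2)\<^sup>2 / (2 * \<sigma>\<^sup>2)"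
      using assms by (simp add: field_simps power2_eq_square)
    have "normal_density 0 \<sigma> x * exp (s * x) = exp (s\<^sup>2 * \<sigma>\<^sup>2 / 2) * normal_density (s * \<sigma>\<^sup>2) \<sigma> x"
      using arg_cong[OF e, of exp] unfolding exp_add by (simp add: normal_density_def field_simps)
    then show "ennreal (normal_density 0 \<sigma> x) * ennreal (exp (s * x))
      = ennreal (exp (s\<^sup>2 * \<sigma>\<^sup>2 / 2)) * ennreal (normal_density (s * \<sigma>\<^sup>2) \<sigma> x)"
      by (simp add: ennreal_mult'[symmetric])
  qed
  also have "\<dots> = ennreal (exp (s\<^sup>2 * \<sigma>\<^sup>2 / 2))"
    using assms by (subst nn_integral_cmult) (auto simp: nn_integral_normal_density)
  finally show ?thesis .
qed

lemma gauss_exp_square: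
  assumes "a < 1"
  shows "(\<integral>\<^sup>+x. ennreal (exp (a * x\<^sup>2 / 2)) \<partial>gauss 1) = ennreal (1 / sqrt (1 - a))"
proof -
  have "(\<integral>\<^sup>+x. ennreal (exp (a * x\<^sup>2 / 2)) \<partial>gauss 1)
      = (\<integral>\<^sup>+x. ennreal (1 / sqrt (1 - a)) * ennreal (normal_density 0 (1 / sqrt (1 - a)) x) \<partial>lborel)"
  proof (subst nn_integral_gauss, simp, rule nn_integral_cong)
    fix x
    have "normal_density 0 1 x * exp (a * x\<^sup>2 / 2) = 1 / sqrt (1 - a) * normal_density 0 (1 / sqrt (1 - a)) x"
      using assms
      by (simp add: normal_density_def exp_add[symmetric] real_sqrt_mult real_sqrt_divide power_divide field_simps)
    then show "ennreal (normal_density 0 1 x) * ennreal (exp (a * x\<^sup>2 / 2))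
      = ennreal (1 / sqrt (1 - a)) * ennreal (normal_density 0 (1 / sqrt (1 - a)) x)"
      using assms by (simp add: ennreal_mult'[symmetric])
  qed
  also have "\<dots> = ennreal (1 / sqrt (1 - a))"
    using assms by (subst nn_integral_cmult) (auto simp: nn_integral_normal_density)
  finally show ?thesis .
qed

section \<open>Observations as an i.i.d. sample\<close>

definition lin :: "nat \<Rightarrow> (nat \<Rightarrow> real) \<Rightarrow> (nat \<Rightarrow> real) \<Rightarrow> real" where
  "lin p w x = (\<Sum>j<p. x j * w j)"

lemma lin_measurable [measurable]: "lin p w \<in> borel_measurable (gauss_row {..<p})"
  unfolding lin_def by measurable

lemma lin_measurable_borel [measurable]: "lin p w \<in> borel_measurable (\<Pi>\<^sub>M j\<in>{..<p}. borel)"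
  unfolding lin_def by measurable

lemma scalar_prod_vec_eq_lin: "\<beta> \<in> carrier_vec p \<Longrightarrow> vec p x \<bullet> \<beta> = lin p (($) \<beta>) x"
  by (auto simp: scalar_prod_def lin_def atLeast0LessThan intro!: sum.cong)

text \<open>The reference measure contains the Gaussian design, so the density is only that of \<open>y\<close> given \<open>x\<close>.\<close>

definition row_law :: "nat \<Rightarrow> (nat \<Rightarrow> real) \<Rightarrow> real \<Rightarrow> (real \<times> (nat \<Rightarrow> real)) measure" where
  "row_law p w \<sigma> = density (lborel \<Otimes>\<^sub>M gauss_row {..<p})
     (\<lambda>(y, x). ennreal (normal_density 0 \<sigma> (y - lin p w x)))"

lemma sets_row_law [measurable_cong]: "sets (row_law p w \<sigma>) = sets (borel \<Otimes>\<^sub>M (\<Pi>\<^sub>M j\<in>{..<p}. borel))"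
  unfolding row_law_def by (simp cong: sets_pair_measure_cong add: sets_gauss_row)

lemma mvn_precision_one: "mvn_precision p (1\<^sub>m p) = gauss_row {..<p}"
proof -
  have dens: "ennreal (sqrt (det (1\<^sub>m p) / (2 * pi) ^ p) * exp (- (vec p x \<bullet> (1\<^sub>m p *\<^sub>v vec p x)) / 2))
    = (\<Prod>j<p. ennreal (normal_density 0 1 (x j)))" for x :: "nat \<Rightarrow> real"
  proof -
    have "vec p x \<bullet> (1\<^sub>m p *\<^sub>v vec p x) = (\<Sum>j<p. (x j)\<^sup>2)"
      by (simp add: scalar_prod_def atLeast0LessThan power2_eq_square)
    moreover have "sqrt (1 / (2 * pi) ^ p) = (\<Prod>j<p. 1 / sqrt (2 * pi))"
      by (simp only: real_sqrt_divide real_sqrt_one real_sqrt_power prod_constant card_lessThan power_one_over)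
    moreover have "exp (- (\<Sum>j<p. (x j)\<^sup>2) / 2) = (\<Prod>j<p. exp (- (x j)\<^sup>2 / 2))"
      by (simp add: exp_sum[symmetric] sum_negf[symmetric] sum_divide_distrib)
    ultimately have "sqrt (det (1\<^sub>m p) / (2 * pi) ^ p) * exp (- (vec p x \<bullet> (1\<^sub>m p *\<^sub>v vec p x)) / 2)
        = (\<Prod>j<p. 1 / sqrt (2 * pi) * exp (- (x j)\<^sup>2 / 2))"
      by (simp only: det_one prod.distrib)
    then show ?thesis by (simp add: prod_ennreal normal_density_def)
  qed
  show ?thesis
    unfolding gauss_row_def mvn_precision_def dens gauss_def
    by (rule PiM_density[symmetric])
       (auto intro!: prob_space_imp_sigma_finite prob_space_normal_density sigma_finite_lborel)
qed

lemma nn_integral_row_law: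
  assumes [measurable]: "f \<in> borel_measurable (borel \<Otimes>\<^sub>M (\<Pi>\<^sub>M j\<in>{..<p}. borel))"
  shows "(\<integral>\<^sup>+z. f z \<partial>row_law p w \<sigma>) = (\<integral>\<^sup>+x. \<integral>\<^sup>+e. f (lin p w x + e, x) \<partial>gauss \<sigma> \<partial>gauss_row {..<p})"
proof -
  interpret G: prob_space "gauss_row {..<p}" by (rule prob_space_gauss_row)
  interpret P: pair_sigma_finite lborel "gauss_row {..<p}" by standard
  have [measurable]: "f \<in> borel_measurable (lborel \<Otimes>\<^sub>M gauss_row {..<p})"
    using assms by (simp cong: measurable_cong_sets sets_pair_measure_cong add: sets_gauss_row)
  have "(\<integral>\<^sup>+z. f z \<partial>row_law p w \<sigma>)
      = (\<integral>\<^sup>+z. ennreal (normal_density 0 \<sigma> (fst z - lin p w (snd z))) * f z \<partial>(lborel \<Otimes>\<^sub>M gauss_row {..<p}))"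
    unfolding row_law_def by (subst nn_integral_density) (auto simp: case_prod_beta)
  also have "\<dots> = (\<integral>\<^sup>+x. \<integral>\<^sup>+y. ennreal (normal_density 0 \<sigma> (y - lin p w x)) * f (y, x) \<partial>lborel \<partial>gauss_row {..<p})"
    by (subst P.nn_integral_snd[symmetric]) auto
  also have "\<dots> = (\<integral>\<^sup>+x. \<integral>\<^sup>+e. f (lin p w x + e, x) \<partial>gauss \<sigma> \<partial>gauss_row {..<p})"
  proof (rule nn_integral_cong)
    fix x assume x: "x \<in> space (gauss_row {..<p})"
    then have [measurable]: "(\<lambda>y. f (y, x)) \<in> borel_measurable borel"
      using assms by (auto simp: gauss_row_def space_PiM intro!: measurable_Pair2')
    show "(\<integral>\<^sup>+y. ennreal (normal_density 0 \<sigma> (y - lin p w x)) * f (y, x) \<partial>lborel)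
       = (\<integral>\<^sup>+e. f (lin p w x + e, x) \<partial>gauss \<sigma>)"
      by (subst nn_integral_gauss, measurable, subst nn_integral_real_affine[of _ 1 "lin p w x"]) auto
  qed
  finally show ?thesis .
qed

lemma prob_space_row_law:
  assumes "0 < \<sigma>" shows "prob_space (row_law p w \<sigma>)"
proof
  have "emeasure (row_law p w \<sigma>) (space (row_law p w \<sigma>)) = (\<integral>\<^sup>+z. 1 \<partial>row_law p w \<sigma>)" by simp
  also have "\<dots> = 1"
    by (subst nn_integral_row_law)
       (simp_all add: prob_space.emeasure_space_1[OF prob_space_gauss[OF assms], simplified]
         prob_space.emeasure_space_1[OF prob_space_gauss_row])
  finally show "emeasure (row_law p w \<sigma>) (space (row_law p w \<sigma>)) = 1" .
qed

text \<open>The product of the design laws and the noise laws regroups into a product over the rows: on a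
  box the probability factorises, first in the noise for a fixed design, then in the design.\<close>

lemma obs_law_one:
  assumes \<beta>: "\<beta> \<in> carrier_vec p" and \<sigma>: "0 < \<sigma>"
  shows "obs_law n p (\<beta>, 1\<^sub>m p, \<sigma>) = (\<Pi>\<^sub>M i\<in>{..<n}. row_law p (($) \<beta>) \<sigma>)"
proof -
  let ?w = "($) \<beta>"
  interpret R: product_sigma_finite "\<lambda>_::nat. row_law p ?w \<sigma>"
    unfolding product_sigma_finite_def by (auto intro!: prob_space_imp_sigma_finite prob_space_row_law \<sigma>)
  interpret G: product_sigma_finite "\<lambda>_::nat. gauss \<sigma>"
    unfolding product_sigma_finite_def by (auto intro!: prob_space_imp_sigma_finite prob_space_gauss \<sigma>)
  interpret D: product_sigma_finite "\<lambda>_::nat. gauss_row {..<p}"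
    unfolding product_sigma_finite_def by (auto intro!: prob_space_imp_sigma_finite prob_space_gauss_row)
  let ?X = "\<Pi>\<^sub>M i\<in>{..<n}. gauss_row {..<p}" and ?E = "\<Pi>\<^sub>M i\<in>{..<n}. gauss \<sigma>"
  interpret E: prob_space ?E by (intro prob_space_PiM prob_space_gauss \<sigma>)
  let ?F = "\<lambda>(X, \<epsilon>). \<lambda>i\<in>{..<n}. (lin p ?w (X i) + \<epsilon> i, X i)"
  have law: "obs_law n p (\<beta>, 1\<^sub>m p, \<sigma>) = distr (?X \<Otimes>\<^sub>M ?E) (obs_space n p) ?F"
    unfolding obs_law_def by (simp add: mvn_precision_one scalar_prod_vec_eq_lin[OF \<beta>] gauss_def)
  have Xi: "(\<lambda>z. fst z i) \<in> measurable (?X \<Otimes>\<^sub>M ?E) (gauss_row {..<p})" if "i < n" for i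
    using that by (auto intro!: measurable_compose[OF measurable_fst measurable_component_singleton])
  have Ei: "(\<lambda>z. snd z i) \<in> borel_measurable (?X \<Otimes>\<^sub>M ?E)" if "i < n" for i
    using measurable_compose[OF measurable_snd measurable_component_singleton, of i "{..<n}" ?X "\<lambda>_. gauss \<sigma>"] that
    by (simp cong: measurable_cong_sets)
  have Fi: "(\<lambda>z. (lin p ?w (fst z i) + snd z i, fst z i)) \<in> measurable (?X \<Otimes>\<^sub>M ?E) (borel \<Otimes>\<^sub>M (\<Pi>\<^sub>M j\<in>{..<p}. borel))"
    if "i < n" for i
  proof -
    note [measurable] = Xi[OF that] Ei[OF that]
    have [measurable]: "(\<lambda>z. fst z i) \<in> measurable (?X \<Otimes>\<^sub>M ?E) (\<Pi>\<^sub>M j\<in>{..<p}. borel)"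
      using Xi[OF that] by (simp cong: measurable_cong_sets add: sets_gauss_row)
    show ?thesis by measurable
  qed
  have F: "?F \<in> measurable (?X \<Otimes>\<^sub>M ?E) (obs_space n p)"
    unfolding obs_space_def case_prod_beta by (intro measurable_restrict Fi) auto
  show ?thesis
    unfolding law
  proof (rule R.PiM_eqI)
    fix A :: "nat \<Rightarrow> (real \<times> (nat \<Rightarrow> real)) set"
    assume A0: "\<And>i. i \<in> {..<n} \<Longrightarrow> A i \<in> sets (row_law p ?w \<sigma>)"
    then have A: "\<And>i. i \<in> {..<n} \<Longrightarrow> A i \<in> sets (borel \<Otimes>\<^sub>M (\<Pi>\<^sub>M j\<in>{..<p}. borel))"
      by (simp add: sets_row_law)
    have box: "Pi\<^sub>E {..<n} A \<in> sets (obs_space n p)"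
      unfolding obs_space_def using A by (intro sets_PiM_I_finite) auto
    have "emeasure (distr (?X \<Otimes>\<^sub>M ?E) (obs_space n p) ?F) (Pi\<^sub>E {..<n} A)
        = (\<integral>\<^sup>+z. indicator (Pi\<^sub>E {..<n} A) z \<partial>distr (?X \<Otimes>\<^sub>M ?E) (obs_space n p) ?F)"
      using box by simp
    also have "\<dots> = (\<integral>\<^sup>+z. indicator (Pi\<^sub>E {..<n} A) (?F z) \<partial>(?X \<Otimes>\<^sub>M ?E))"
      by (rule nn_integral_distr[OF F]) (use box in simp)
    also have "\<dots> = (\<integral>\<^sup>+z. (\<Prod>i<n. indicator (A i) (lin p ?w (fst z i) + snd z i, fst z i)) \<partial>(?X \<Otimes>\<^sub>M ?E))"
      by (intro nn_integral_cong)
        (auto simp: indicator_def prod_zero_iff Pi_iff split: prod.splits intro!: prod.neutral)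
    also have "\<dots> = (\<integral>\<^sup>+X. \<integral>\<^sup>+\<epsilon>. (\<Prod>i<n. indicator (A i) (lin p ?w (X i) + \<epsilon> i, X i)) \<partial>?E \<partial>?X)"
    proof (subst E.nn_integral_fst[symmetric])
      show "(\<lambda>z. \<Prod>i<n. indicator (A i) (lin p ?w (fst z i) + snd z i, fst z i) :: ennreal) \<in> borel_measurable (?X \<Otimes>\<^sub>M ?E)"
      proof (intro borel_measurable_prod_ennreal)
        fix i assume "i \<in> {..<n}"
        then show "(\<lambda>z. indicator (A i) (lin p ?w (fst z i) + snd z i, fst z i) :: ennreal) \<in> borel_measurable (?X \<Otimes>\<^sub>M ?E)"
          using measurable_compose[OF Fi borel_measurable_indicator[OF A]] by simp
      qed
    qed simp
    also have "\<dots> = (\<integral>\<^sup>+X. (\<Prod>i<n. \<integral>\<^sup>+e. indicator (A i) (lin p ?w (X i) + e, X i) \<partial>gauss \<sigma>) \<partial>?X)"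
    proof (rule nn_integral_cong, rule G.product_nn_integral_prod)
      fix X i assume X: "X \<in> space ?X" and i: "i \<in> {..<n}"
      have [measurable]: "A i \<in> sets (borel \<Otimes>\<^sub>M (\<Pi>\<^sub>M j\<in>{..<p}. borel))" by (rule A[OF i])
      have [measurable]: "X i \<in> space (\<Pi>\<^sub>M j\<in>{..<p}. borel)"
        using X i by (auto simp: space_PiM gauss_row_def)
      show "(\<lambda>e. indicator (A i) (lin p ?w (X i) + e, X i) :: ennreal) \<in> borel_measurable (gauss \<sigma>)"
        by measurable
    qed simp
    also have "\<dots> = (\<Prod>i<n. \<integral>\<^sup>+x. \<integral>\<^sup>+e. indicator (A i) (lin p ?w x + e, x) \<partial>gauss \<sigma> \<partial>gauss_row {..<p})"
    proof (rule D.product_nn_integral_prod)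
      fix i assume i: "i \<in> {..<n}"
      have [measurable]: "A i \<in> sets (borel \<Otimes>\<^sub>M (\<Pi>\<^sub>M j\<in>{..<p}. borel))" by (rule A[OF i])
      have [measurable]: "(\<lambda>z. fst z) \<in> measurable (gauss_row {..<p} \<Otimes>\<^sub>M gauss \<sigma>) (\<Pi>\<^sub>M j\<in>{..<p}. borel)"
        using measurable_fst[of "gauss_row {..<p}" "gauss \<sigma>"] by (simp cong: measurable_cong_sets add: sets_gauss_row)
      show "(\<lambda>x. \<integral>\<^sup>+e. indicator (A i) (lin p ?w x + e, x) \<partial>gauss \<sigma>) \<in> borel_measurable (gauss_row {..<p})"
        by (rule sigma_finite_measure.borel_measurable_nn_integral[OF prob_space_imp_sigma_finite[OF prob_space_gauss[OF \<sigma>]], of "\<lambda>x e. indicator (A i) (lin p ?w x + e, x)"]) (simp add: case_prod_beta)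
    qed simp
    also have "\<dots> = (\<Prod>i\<in>{..<n}. emeasure (row_law p ?w \<sigma>) (A i))"
    proof (rule prod.cong[OF refl])
      fix i assume i: "i \<in> {..<n}"
      have "(\<integral>\<^sup>+x. \<integral>\<^sup>+e. indicator (A i) (lin p ?w x + e, x) \<partial>gauss \<sigma> \<partial>gauss_row {..<p})
         = (\<integral>\<^sup>+z. indicator (A i) z \<partial>row_law p ?w \<sigma>)"
        by (rule nn_integral_row_law[symmetric]) (use A[OF i] in simp)
      then show "(\<integral>\<^sup>+x. \<integral>\<^sup>+e. indicator (A i) (lin p ?w x + e, x) \<partial>gauss \<sigma> \<partial>gauss_row {..<p}) = emeasure (row_law p ?w \<sigma>) (A i)"
        using A0[OF i] by simp
    qed
    finally show "emeasure (distr (?X \<Otimes>\<^sub>M ?E) (obs_space n p) ?F) (Pi\<^sub>E {..<n} A)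
        = (\<Prod>i\<in>{..<n}. emeasure (row_law p ?w \<sigma>) (A i))" .
  qed (auto simp: obs_space_def sets_row_law intro!: sets_PiM_cong)
qed

lemma sets_obs_law [simp, measurable_cong]: "sets (obs_law n p \<theta>) = sets (obs_space n p)"
  by (cases \<theta>) (simp add: obs_law_def)

lemma space_obs_law [simp]: "space (obs_law n p \<theta>) = space (obs_space n p)"
  by (rule sets_eq_imp_space_eq) simp

lemma prob_space_obs_law:
  assumes "\<beta> \<in> carrier_vec p" "0 < \<sigma>"
  shows "prob_space (obs_law n p (\<beta>, 1\<^sub>m p, \<sigma>))"
  unfolding obs_law_one[OF assms] by (intro prob_space_PiM prob_space_row_law assms)

lemma nn_integral_obs_law_prod:
  assumes "\<beta> \<in> carrier_vec p" "0 < \<sigma>"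
    and f: "f \<in> borel_measurable (borel \<Otimes>\<^sub>M (\<Pi>\<^sub>M j\<in>{..<p}. borel))"
  shows "(\<integral>\<^sup>+z. (\<Prod>i<n. f (z i)) \<partial>obs_law n p (\<beta>, 1\<^sub>m p, \<sigma>))
    = (\<integral>\<^sup>+x. \<integral>\<^sup>+e. f (lin p (($) \<beta>) x + e, x) \<partial>gauss \<sigma> \<partial>gauss_row {..<p}) ^ n"
proof -
  interpret R: product_sigma_finite "\<lambda>_::nat. row_law p (($) \<beta>) \<sigma>"
    unfolding product_sigma_finite_def by (auto intro!: prob_space_imp_sigma_finite prob_space_row_law assms)
  have "(\<integral>\<^sup>+z. (\<Prod>i<n. f (z i)) \<partial>obs_law n p (\<beta>, 1\<^sub>m p, \<sigma>)) = (\<Prod>i<n. \<integral>\<^sup>+z. f z \<partial>row_law p (($) \<beta>) \<sigma>)"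
    unfolding obs_law_one[OF assms(1,2)]
    by (rule R.product_nn_integral_prod) (use f in \<open>simp_all cong: measurable_cong_sets add: sets_row_law\<close>)
  then show ?thesis by (simp add: nn_integral_row_law[OF f])
qed

section \<open>Likelihoods and their mixed second moments\<close>

lemma nn_integral_gauss_row_merge:
  assumes "I \<inter> J = {}" "finite I" "finite J"
    and f: "f \<in> borel_measurable (\<Pi>\<^sub>M j\<in>I \<union> J. borel)"
  shows "(\<integral>\<^sup>+x. f x \<partial>gauss_row (I \<union> J)) = (\<integral>\<^sup>+x. \<integral>\<^sup>+y. f (merge I J (x, y)) \<partial>gauss_row J \<partial>gauss_row I)"
proof -
  interpret product_sigma_finite "\<lambda>_. gauss 1" by (rule product_sigma_finite_gauss)
  have "f \<in> borel_measurable (gauss_row (I \<union> J))"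
    using f by (simp cong: measurable_cong_sets add: sets_gauss_row)
  then show ?thesis
    unfolding gauss_row_def by (rule product_nn_integral_fold[OF assms(1-3)])
qed

lemma sum_merge_left: "(\<Sum>j\<in>I. merge I J (x, y) j * w j) = (\<Sum>j\<in>I. x j * w j)"
  by (intro sum.cong) (auto simp: merge_def)

lemma sum_merge_right: "I \<inter> J = {} \<Longrightarrow> (\<Sum>j\<in>J. merge I J (x, y) j * w j) = (\<Sum>j\<in>J. y j * w j)"
  by (intro sum.cong) auto

text \<open>The two linear forms use disjoint sets of coordinates, hence are independent.\<close>

lemma gauss_row_convolution_product:
  assumes AB: "A \<inter> B = {}" "finite A" "finite B" and \<sigma>: "0 < \<sigma>"
  shows "(\<integral>\<^sup>+x. ennreal (normal_density 0 \<sigma> (u - (\<Sum>j\<in>A. x j * w j)) * normal_density 0 \<sigma> (u - (\<Sum>j\<in>B. x j * v j)))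
      \<partial>gauss_row (A \<union> B))
    = ennreal (normal_density 0 (sqrt (\<sigma>\<^sup>2 + (\<Sum>j\<in>A. (w j)\<^sup>2))) u * normal_density 0 (sqrt (\<sigma>\<^sup>2 + (\<Sum>j\<in>B. (v j)\<^sup>2))) u)"
proof -
  have "(\<integral>\<^sup>+x. ennreal (normal_density 0 \<sigma> (u - (\<Sum>j\<in>A. x j * w j)) * normal_density 0 \<sigma> (u - (\<Sum>j\<in>B. x j * v j)))
      \<partial>gauss_row (A \<union> B))
    = (\<integral>\<^sup>+x. \<integral>\<^sup>+y. ennreal (normal_density 0 \<sigma> (u - (\<Sum>j\<in>A. x j * w j))) * ennreal (normal_density 0 \<sigma> (u - (\<Sum>j\<in>B. y j * v j)))
      \<partial>gauss_row B \<partial>gauss_row A)"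
    by (subst nn_integral_gauss_row_merge[OF AB])
       (auto simp: sum_merge_left sum_merge_right[OF AB(1)] ennreal_mult')
  also have "\<dots> = (\<integral>\<^sup>+x. ennreal (normal_density 0 \<sigma> (u - (\<Sum>j\<in>A. x j * w j))) \<partial>gauss_row A) *
      (\<integral>\<^sup>+y. ennreal (normal_density 0 \<sigma> (u - (\<Sum>j\<in>B. y j * v j))) \<partial>gauss_row B)"
    by (subst nn_integral_cmult, measurable, subst nn_integral_multc) auto
  finally show ?thesis
    using assms by (simp add: gauss_row_convolution ennreal_mult')
qed

text \<open>The mixed second moment of two likelihood ratios with respect to the law under which \<open>y\<close> has
  variance \<open>s\<^sup>2\<close> and is independent of the design. Where both vectors are nonzero they agree, so the
  coordinates split into common ones and ones private to \<open>w\<close> or to \<open>v\<close>. Given the common part of the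
  linear forms, the private parts are independent and only raise the variance of the two normal
  factors to \<open>\<tau>\<^sup>2 = s\<^sup>2 - c\<close>; the product of the factors is then a single normal density of variance
  \<open>\<tau>\<^sup>2 / 2\<close>, which the common part turns into one of variance \<open>\<kappa>\<^sup>2 = (s\<^sup>2 + c) / 2 < s\<^sup>2\<close>. The variances
  match because both vectors have squared norm \<open>t\<close>, and this is what leaves an answer depending on
  the inner product \<open>c\<close> only.\<close>

lemma row_affinity:
  fixes w v :: "nat \<Rightarrow> real"
  assumes \<sigma>: "0 < \<sigma>"
    and split: "\<And>j. j < p \<Longrightarrow> w j = v j \<or> w j = 0 \<or> v j = 0"
    and eq: "(\<Sum>j<p. (w j)\<^sup>2) = t" "(\<Sum>j<p. (v j)\<^sup>2) = t"
  defines "c \<equiv> (\<Sum>j<p. w j * v j)" and "s \<equiv> sqrt (\<sigma>\<^sup>2 + t)"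
  shows "(\<integral>\<^sup>+z. ennreal (normal_density 0 \<sigma> (fst z - lin p w (snd z)) * normal_density 0 \<sigma> (fst z - lin p v (snd z))
      / normal_density 0 s (fst z)) \<partial>(lborel \<Otimes>\<^sub>M gauss_row {..<p})) = ennreal (s\<^sup>2 / (s\<^sup>2 - c))"
    and "c \<le> t"
proof -
  define I where "I = {j\<in>{..<p}. w j = v j}"
  define A where "A = {j\<in>{..<p}. w j \<noteq> v j \<and> v j = 0}"
  define B where "B = {j\<in>{..<p}. w j \<noteq> v j \<and> w j = 0}"
  have fin: "finite I" "finite A" "finite B" by (auto simp: I_def A_def B_def)
  have AB: "A \<inter> B = {}" and IAB: "I \<inter> (A \<union> B) = {}" by (auto simp: I_def A_def B_def)
  have U: "{..<p} = I \<union> (A \<union> B)" using split by (auto simp: I_def A_def B_def)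
  have w0: "w j = 0" if "j \<in> B" for j using that by (auto simp: B_def)
  have v0: "v j = 0" if "j \<in> A" for j using that by (auto simp: A_def)
  have vI: "v j = w j" if "j \<in> I" for j using that by (auto simp: I_def)
  have sumU: "(\<Sum>j<p. g j) = (\<Sum>j\<in>I. g j) + ((\<Sum>j\<in>A. g j) + (\<Sum>j\<in>B. g j))" for g :: "nat \<Rightarrow> real"
    unfolding U using fin AB IAB by (subst sum.union_disjoint; simp add: sum.union_disjoint)
  have c: "c = (\<Sum>j\<in>I. (w j)\<^sup>2)"
    unfolding c_def sumU using w0 v0 vI by (simp add: power2_eq_square)
  have wA: "(\<Sum>j\<in>A. (w j)\<^sup>2) = t - c" using eq(1) unfolding sumU c using w0 by simp
  have "(\<Sum>j\<in>I. (v j)\<^sup>2) = c" unfolding c using vI by simp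
  then have vB: "(\<Sum>j\<in>B. (v j)\<^sup>2) = t - c" using eq(2) unfolding sumU using v0 by simp
  have c0: "0 \<le> c" unfolding c by (simp add: sum_nonneg)
  show ct: "c \<le> t" using wA sum_nonneg[of A "\<lambda>j. (w j)\<^sup>2"] by simp
  have s2: "s\<^sup>2 = \<sigma>\<^sup>2 + t" unfolding s_def using ct c0 by simp
  have sp: "0 < s" unfolding s_def using \<sigma> ct c0 by (simp add: add_pos_nonneg)
  have cs: "c < s\<^sup>2" unfolding s2 using ct zero_less_power[OF \<sigma>, of 2] by linarith
  define \<tau> where "\<tau> = sqrt (s\<^sup>2 - c)"
  have \<tau>: "0 < \<tau>" "\<tau>\<^sup>2 = s\<^sup>2 - c" using cs by (auto simp: \<tau>_def)
  define \<kappa> where "\<kappa> = sqrt ((s\<^sup>2 + c) / 2)"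
  have \<kappa>2: "\<kappa>\<^sup>2 = (s\<^sup>2 + c) / 2" using c0 by (simp add: \<kappa>_def)
  have \<kappa>: "0 < \<kappa>" using c0 sp by (simp add: \<kappa>_def add_pos_nonneg)
  have "\<kappa>\<^sup>2 < s\<^sup>2" using \<kappa>2 cs by simp
  then have \<kappa>s: "\<kappa> < s" using sp by (rule power_less_imp_less_base[OF _ less_imp_le])
  interpret G: prob_space "gauss_row {..<p}" by (rule prob_space_gauss_row)
  interpret P: pair_sigma_finite lborel "gauss_row {..<p}" by standard
  define K where "K = 1 / (2 * sqrt pi * \<tau>)"
  have K: "0 \<le> K" using \<tau> by (simp add: K_def)
  have linw: "lin p w x = (\<Sum>j\<in>I. x j * w j) + (\<Sum>j\<in>A. x j * w j)" for x
    unfolding lin_def sumU using w0 by simp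
  have linv: "lin p v x = (\<Sum>j\<in>I. x j * w j) + (\<Sum>j\<in>B. x j * v j)" for x
    unfolding lin_def sumU using v0 vI by simp
  have inner: "(\<integral>\<^sup>+x. ennreal (normal_density 0 \<sigma> (y - lin p w x) * normal_density 0 \<sigma> (y - lin p v x)) \<partial>gauss_row {..<p})
      = ennreal (K * normal_density 0 \<kappa> y)" for y
  proof -
    have "(\<integral>\<^sup>+x. ennreal (normal_density 0 \<sigma> (y - lin p w x) * normal_density 0 \<sigma> (y - lin p v x)) \<partial>gauss_row {..<p})
      = (\<integral>\<^sup>+x. \<integral>\<^sup>+z. ennreal (normal_density 0 \<sigma> ((y - (\<Sum>j\<in>I. x j * w j)) - (\<Sum>j\<in>A. z j * w j))
           * normal_density 0 \<sigma> ((y - (\<Sum>j\<in>I. x j * w j)) - (\<Sum>j\<in>B. z j * v j))) \<partial>gauss_row (A \<union> B) \<partial>gauss_row I)"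
    proof -
      have e: "(\<Sum>j\<in>C. merge I (A \<union> B) (x, z) j * g j) = (\<Sum>j\<in>C. z j * g j)" if "C \<subseteq> A \<union> B" for C x z and g :: "nat \<Rightarrow> real"
        using that IAB by (intro sum.cong) auto
      show ?thesis
        unfolding U linw linv using fin
        by (subst nn_integral_gauss_row_merge[OF IAB])
           (auto simp: sum_merge_left e diff_diff_add[symmetric])
    qed
    also have "\<dots> = (\<integral>\<^sup>+x. ennreal (normal_density 0 \<tau> (y - (\<Sum>j\<in>I. x j * w j)) * normal_density 0 \<tau> (y - (\<Sum>j\<in>I. x j * w j))) \<partial>gauss_row I)"
      unfolding gauss_row_convolution_product[OF AB fin(2,3) \<sigma>] wA vB \<tau>_def s2 by (simp add: algebra_simps)
    also have "\<dots> = (\<integral>\<^sup>+x. ennreal K * ennreal (normal_density 0 (\<tau> / sqrt 2) (y - (\<Sum>j\<in>I. x j * w j))) \<partial>gauss_row I)"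
      unfolding normal_density_mult_self[OF \<tau>(1)] K_def[symmetric] using K by (simp add: ennreal_mult')
    also have "\<dots> = ennreal K * ennreal (normal_density 0 (sqrt ((\<tau> / sqrt 2)\<^sup>2 + c)) y)"
      unfolding c using \<tau> fin by (subst nn_integral_cmult) (auto simp: gauss_row_convolution)
    also have "sqrt ((\<tau> / sqrt 2)\<^sup>2 + c) = \<kappa>"
      unfolding \<kappa>_def by (simp add: power_divide \<tau>(2) field_simps)
    finally show ?thesis using K by (simp add: ennreal_mult')
  qed
  define \<eta> where "\<eta> = \<kappa> * s / sqrt (s\<^sup>2 - \<kappa>\<^sup>2)"
  have \<eta>: "0 < \<eta>" using \<kappa> \<kappa>s sp \<open>\<kappa>\<^sup>2 < s\<^sup>2\<close> by (simp add: \<eta>_def)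
  have "(\<integral>\<^sup>+z. ennreal (normal_density 0 \<sigma> (fst z - lin p w (snd z)) * normal_density 0 \<sigma> (fst z - lin p v (snd z))
      / normal_density 0 s (fst z)) \<partial>(lborel \<Otimes>\<^sub>M gauss_row {..<p}))
    = (\<integral>\<^sup>+y. \<integral>\<^sup>+x. ennreal (1 / normal_density 0 s y) * ennreal (normal_density 0 \<sigma> (y - lin p w x) * normal_density 0 \<sigma> (y - lin p v x))
       \<partial>gauss_row {..<p} \<partial>lborel)"
    by (subst G.nn_integral_fst[symmetric]) (auto simp: ennreal_mult'[symmetric])
  also have "\<dots> = (\<integral>\<^sup>+y. ennreal (1 / normal_density 0 s y) * ennreal (K * normal_density 0 \<kappa> y) \<partial>lborel)"
    by (subst nn_integral_cmult) (auto simp: inner)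
  also have "\<dots> = (\<integral>\<^sup>+y. ennreal (K * (s * \<eta> * sqrt (2 * pi) / \<kappa>)) * ennreal (normal_density 0 \<eta> y) \<partial>lborel)"
  proof (rule nn_integral_cong)
    fix y
    have "1 / normal_density 0 s y * (K * normal_density 0 \<kappa> y) = K * (normal_density 0 \<kappa> y / normal_density 0 s y)"
      by simp
    also have "\<dots> = K * (s * \<eta> * sqrt (2 * pi) / \<kappa>) * normal_density 0 \<eta> y"
      unfolding normal_density_ratio[OF \<kappa> \<kappa>s] \<eta>_def[symmetric] by simp
    finally show "ennreal (1 / normal_density 0 s y) * ennreal (K * normal_density 0 \<kappa> y)
      = ennreal (K * (s * \<eta> * sqrt (2 * pi) / \<kappa>)) * ennreal (normal_density 0 \<eta> y)"
      by (simp only: ennreal_mult''[symmetric] normal_density_nonneg K mult_nonneg_nonneg)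
  qed
  also have "\<dots> = ennreal (K * (s * \<eta> * sqrt (2 * pi) / \<kappa>))"
    using \<eta> by (subst nn_integral_cmult) (auto simp: nn_integral_normal_density)
  also have "K * (s * \<eta> * sqrt (2 * pi) / \<kappa>) = s\<^sup>2 / (s\<^sup>2 - c)"
  proof -
    have "sqrt (s\<^sup>2 - \<kappa>\<^sup>2) = \<tau> / sqrt 2"
      unfolding \<tau>_def \<kappa>2 real_sqrt_divide[symmetric] by (simp add: field_simps)
    then have e: "\<eta> = \<kappa> * s * sqrt 2 / \<tau>" unfolding \<eta>_def by simp
    have "K * (s * \<eta> * sqrt (2 * pi) / \<kappa>) = s\<^sup>2 * (sqrt 2 * sqrt 2) / (2 * \<tau>\<^sup>2)"
      unfolding e K_def using \<kappa> \<tau>(1)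
      by (simp add: real_sqrt_mult field_simps power2_eq_square del: real_sqrt_mult_self)
    then have "K * (s * \<eta> * sqrt (2 * pi) / \<kappa>) = s\<^sup>2 / \<tau>\<^sup>2" by simp
    then show ?thesis unfolding \<tau>(2) .
  qed
  finally show "(\<integral>\<^sup>+z. ennreal (normal_density 0 \<sigma> (fst z - lin p w (snd z)) * normal_density 0 \<sigma> (fst z - lin p v (snd z))
      / normal_density 0 s (fst z)) \<partial>(lborel \<Otimes>\<^sub>M gauss_row {..<p})) = ennreal (s\<^sup>2 / (s\<^sup>2 - c))" .
qed

definition base_law :: "nat \<Rightarrow> nat \<Rightarrow> obs measure" where
  "base_law n p = (\<Pi>\<^sub>M i\<in>{..<n}. lborel \<Otimes>\<^sub>M gauss_row {..<p})"

text \<open>The density of a sample with respect to \<open>base_law\<close>; with \<open>w = 0\<close> it describes responses that are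
  independent of the design.\<close>

definition lik :: "nat \<Rightarrow> nat \<Rightarrow> real \<Rightarrow> (nat \<Rightarrow> real) \<Rightarrow> obs \<Rightarrow> real" where
  "lik n p \<sigma> w z = (\<Prod>i<n. normal_density 0 \<sigma> (fst (z i) - lin p w (snd (z i))))"

lemma sigma_finite_row_base: "sigma_finite_measure (lborel \<Otimes>\<^sub>M gauss_row {..<p})"
proof -
  interpret G: prob_space "gauss_row {..<p}" by (rule prob_space_gauss_row)
  interpret P: pair_sigma_finite lborel "gauss_row {..<p}" by standard
  show ?thesis by (rule P.sigma_finite_measure_axioms)
qed

lemma lik_measurable [measurable]: "lik n p \<sigma> w \<in> borel_measurable (base_law n p)"
  unfolding lik_def base_law_def by measurable

lemma obs_law_eq_density:
  assumes \<beta>: "\<beta> \<in> carrier_vec p" and \<sigma>: "0 < \<sigma>"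
  shows "obs_law n p (\<beta>, 1\<^sub>m p, \<sigma>) = density (base_law n p) (\<lambda>z. ennreal (lik n p \<sigma> (($) \<beta>) z))"
proof -
  have "sigma_finite_measure (row_law p (($) \<beta>) \<sigma>)"
    by (intro prob_space_imp_sigma_finite prob_space_row_law \<sigma>)
  then show ?thesis
    unfolding obs_law_one[OF assms] base_law_def lik_def row_law_def
    by (subst PiM_density[OF _ sigma_finite_row_base])
       (auto simp: case_prod_beta prod_ennreal)
qed

lemma lik_affinity:
  fixes w v :: "nat \<Rightarrow> real"
  assumes \<sigma>: "0 < \<sigma>"
    and split: "\<And>j. j < p \<Longrightarrow> w j = v j \<or> w j = 0 \<or> v j = 0"
    and eq: "(\<Sum>j<p. (w j)\<^sup>2) = t" "(\<Sum>j<p. (v j)\<^sup>2) = t"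
    and small: "2 * t \<le> \<sigma>\<^sup>2"
  shows "(\<integral>\<^sup>+z. ennreal (lik n p \<sigma> w z * lik n p \<sigma> v z / lik n p (sqrt (\<sigma>\<^sup>2 + t)) (\<lambda>_. 0) z) \<partial>base_law n p)
    \<le> ennreal (exp (2 * real n * (\<Sum>j<p. w j * v j) / \<sigma>\<^sup>2))"
proof -
  interpret L: product_sigma_finite "\<lambda>_::nat. lborel \<Otimes>\<^sub>M gauss_row {..<p}"
    using sigma_finite_row_base by (simp add: product_sigma_finite_def)
  define c where "c = (\<Sum>j<p. w j * v j)"
  define s where "s = sqrt (\<sigma>\<^sup>2 + t)"
  note aff = row_affinity[OF \<sigma> split eq, folded c_def s_def]
  have ct: "c \<le> t" using aff(2) by simp
  have t0: "0 \<le> t" using eq(1) by (metis sum_nonneg zero_le_power2)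
  have s2: "s\<^sup>2 = \<sigma>\<^sup>2 + t" unfolding s_def using t0 by simp
  have \<sigma>2: "0 < \<sigma>\<^sup>2" using \<sigma> by simp
  have c0: "0 \<le> c" unfolding c_def
  proof (rule sum_nonneg)
    fix j assume "j \<in> {..<p}" then show "0 \<le> w j * v j" using split[of j] by auto
  qed
  have nn: "0 \<le> s\<^sup>2 / (s\<^sup>2 - c)"
    using ct s2 \<sigma>2 by (intro divide_nonneg_nonneg zero_le_power2) linarith
  have "(\<integral>\<^sup>+z. ennreal (lik n p \<sigma> w z * lik n p \<sigma> v z / lik n p s (\<lambda>_. 0) z) \<partial>base_law n p)
    = (\<integral>\<^sup>+z. (\<Prod>i<n. ennreal (normal_density 0 \<sigma> (fst (z i) - lin p w (snd (z i))) * normal_density 0 \<sigma> (fst (z i) - lin p v (snd (z i)))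
      / normal_density 0 s (fst (z i)))) \<partial>base_law n p)"
    by (subst prod_ennreal) (auto simp: lik_def lin_def prod.distrib[symmetric] prod_dividef[symmetric])
  also have "\<dots> = (\<Prod>i<n. ennreal (s\<^sup>2 / (s\<^sup>2 - c)))"
    unfolding base_law_def by (subst L.product_nn_integral_prod) (auto simp: aff(1))
  also have "(\<Prod>i<n. ennreal (s\<^sup>2 / (s\<^sup>2 - c))) = ennreal ((s\<^sup>2 / (s\<^sup>2 - c)) ^ n)"
    by (simp only: prod_constant card_lessThan ennreal_power[OF nn])
  also have "\<dots> \<le> ennreal (exp (2 * real n * c / \<sigma>\<^sup>2))"
  proof (rule ennreal_leI)
    define x where "x = c / s\<^sup>2"
    have sp: "0 < s\<^sup>2" using s2 t0 \<sigma>2 by linarith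
    have x0: "0 \<le> x" using c0 sp by (simp add: x_def)
    have xh: "x \<le> 1 / 2" using ct small s2 t0 sp \<sigma>2 by (simp add: x_def divide_simps)
    have xs: "x \<le> c / \<sigma>\<^sup>2" unfolding x_def s2 using c0 t0 \<sigma>2
      by (intro divide_left_mono mult_pos_pos add_pos_nonneg) auto
    have "- x - 2 * x\<^sup>2 \<le> ln (1 - x)" using x0 xh by (rule ln_one_minus_pos_lower_bound)
    moreover have "2 * x\<^sup>2 \<le> x" using mult_nonneg_nonneg[of x "1 - 2 * x"] x0 xh
      by (simp add: algebra_simps power2_eq_square)
    ultimately have "- (2 * x) \<le> ln (1 - x)" by linarith
    then have "exp (- (2 * x)) \<le> 1 - x" using xh by (subst (asm) ln_ge_iff) auto
    then have "1 / (1 - x) \<le> exp (2 * x)" using xh by (simp add: exp_minus field_simps)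
    moreover have "s\<^sup>2 / (s\<^sup>2 - c) = 1 / (1 - x)" using sp ct s2 \<sigma>2 by (simp add: x_def field_simps)
    ultimately have "(s\<^sup>2 / (s\<^sup>2 - c)) ^ n \<le> exp (2 * x) ^ n" using xh by (intro power_mono) auto
    also have "\<dots> = exp (real n * (2 * x))" by (rule exp_of_nat_mult[symmetric])
    also have "\<dots> \<le> exp (real n * (2 * (c / \<sigma>\<^sup>2)))" using xs by (intro exp_mono mult_left_mono) auto
    finally show "(s\<^sup>2 / (s\<^sup>2 - c)) ^ n \<le> exp (2 * real n * c / \<sigma>\<^sup>2)" by (simp add: field_simps)
  qed
  finally show ?thesis unfolding c_def s_def .
qed

section \<open>Confidence intervals under close mixtures\<close>

text \<open>The chi-square bound on total variation. In place of the Cauchy-Schwarz inequality, the pointwise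
  estimate \<open>\<bar>h - g\<bar> \<le> \<epsilon>/2 * g + (h - g)\<^sup>2 / (2 * \<epsilon> * g)\<close> for the mixture density \<open>h\<close> is integrated;
  \<open>\<integral> (h - g)\<^sup>2 / g = \<integral> h\<^sup>2 / g - 1\<close> is at most \<open>\<epsilon>\<^sup>2\<close> by the hypothesis on second moments.\<close>

lemma mixture_close:
  fixes f :: "'a \<Rightarrow> 'b \<Rightarrow> real" and \<epsilon> :: real
  assumes F: "finite F" "F \<noteq> {}" and \<epsilon>: "0 < \<epsilon>"
    and g: "integrable M g" "integral\<^sup>L M g = 1" "\<And>x. 0 < g x"
    and f: "\<And>a. a \<in> F \<Longrightarrow> integrable M (f a)" "\<And>a. a \<in> F \<Longrightarrow> integral\<^sup>L M (f a) = 1" "\<And>a x. 0 \<le> f a x"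
    and second: "\<And>a. a \<in> F \<Longrightarrow> (\<Sum>b\<in>F. \<integral>\<^sup>+x. ennreal (f a x * f b x / g x) \<partial>M) \<le> ennreal (card F * (1 + \<epsilon>\<^sup>2))"
    and B: "B \<in> sets M"
  shows "\<bar>(\<Sum>a\<in>F. \<integral>x. f a x * indicator B x \<partial>M) / card F - (\<integral>x. g x * indicator B x \<partial>M)\<bar> \<le> \<epsilon>"
proof -
  define N where "N = real (card F)"
  have N: "0 < N" using F by (simp add: N_def card_gt_0_iff)
  define h where "h x = (\<Sum>a\<in>F. f a x) / N" for x
  have [measurable]: "g \<in> borel_measurable M" "\<And>a. a \<in> F \<Longrightarrow> f a \<in> borel_measurable M"
    using g f by auto
  have hI: "integrable M h" unfolding h_def using f by auto
  have h1: "integral\<^sup>L M h = 1" unfolding h_def using f N by (simp add: N_def)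
  have "(\<integral>\<^sup>+x. ennreal ((h x)\<^sup>2 / g x) \<partial>M) = (\<integral>\<^sup>+x. ennreal (1 / N\<^sup>2) * (\<Sum>a\<in>F. \<Sum>b\<in>F. ennreal (f a x * f b x / g x)) \<partial>M)"
  proof (rule nn_integral_cong)
    fix x
    have "(h x)\<^sup>2 / g x = 1 / N\<^sup>2 * (\<Sum>a\<in>F. \<Sum>b\<in>F. f a x * f b x / g x)"
      by (simp add: h_def power_divide power2_eq_square sum_product sum_divide_distrib field_simps)
    moreover have "0 \<le> f a x * f b x / g x" for a b using f(3) g(3)[of x] by simp
    ultimately show "ennreal ((h x)\<^sup>2 / g x) = ennreal (1 / N\<^sup>2) * (\<Sum>a\<in>F. \<Sum>b\<in>F. ennreal (f a x * f b x / g x))"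
      by (simp add: ennreal_mult'[symmetric] sum_nonneg)
  qed
  also have "\<dots> = ennreal (1 / N\<^sup>2) * (\<Sum>a\<in>F. \<Sum>b\<in>F. \<integral>\<^sup>+x. ennreal (f a x * f b x / g x) \<partial>M)"
    by (subst nn_integral_cmult, measurable) (simp add: nn_integral_sum)
  also have "\<dots> \<le> ennreal (1 / N\<^sup>2) * (\<Sum>a\<in>F. ennreal (N * (1 + \<epsilon>\<^sup>2)))"
    unfolding N_def by (intro mult_left_mono sum_mono second) auto
  also have "\<dots> = ennreal (1 / N\<^sup>2) * ennreal (N * (N * (1 + \<epsilon>\<^sup>2)))"
    using N by (simp add: N_def ennreal_mult' ennreal_of_nat_eq_real_of_nat)
  also have "\<dots> = ennreal (1 + \<epsilon>\<^sup>2)"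
    using N by (simp add: ennreal_mult'[symmetric] power2_eq_square)
  finally have nn: "(\<integral>\<^sup>+x. ennreal ((h x)\<^sup>2 / g x) \<partial>M) \<le> ennreal (1 + \<epsilon>\<^sup>2)" .
  have [measurable]: "h \<in> borel_measurable M" using hI by auto
  have qI: "integrable M (\<lambda>x. (h x)\<^sup>2 / g x)"
  proof (rule integrableI_bounded)
    have "(\<integral>\<^sup>+x. ennreal (norm ((h x)\<^sup>2 / g x)) \<partial>M) = (\<integral>\<^sup>+x. ennreal ((h x)\<^sup>2 / g x) \<partial>M)"
      using g(3) by (intro nn_integral_cong) (simp add: less_imp_le)
    also have "\<dots> < \<infinity>" using nn by (rule le_less_trans) simp
    finally show "(\<integral>\<^sup>+x. ennreal (norm ((h x)\<^sup>2 / g x)) \<partial>M) < \<infinity>" .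
  qed measurable
  have q1: "integral\<^sup>L M (\<lambda>x. (h x)\<^sup>2 / g x) \<le> 1 + \<epsilon>\<^sup>2"
  proof -
    have "ennreal (integral\<^sup>L M (\<lambda>x. (h x)\<^sup>2 / g x)) \<le> ennreal (1 + \<epsilon>\<^sup>2)"
      using nn g(3) by (subst nn_integral_eq_integral[OF qI, symmetric]) (auto simp: less_imp_le)
    then show ?thesis by (simp del: ennreal_plus)
  qed
  \<comment> \<open>the expanded square \<open>(\<epsilon> * g x - \<bar>h x - g x\<bar>)\<^sup>2 \<ge> 0\<close>, divided by \<open>2 * \<epsilon> * g x\<close>\<close>
  have dom: "\<bar>h x * indicator B x - g x * indicator B x\<bar> \<le> \<epsilon> / 2 * g x + ((h x)\<^sup>2 / g x - 2 * h x + g x) / (2 * \<epsilon>)" for x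
  proof -
    let ?d = "\<bar>h x - g x\<bar>"
    have gx: "0 < g x" by (rule g)
    have "0 \<le> (\<epsilon> * g x - ?d)\<^sup>2 / (2 * \<epsilon> * g x)" using \<epsilon> gx by simp
    also have "\<dots> = \<epsilon> / 2 * g x - ?d + ?d\<^sup>2 / (2 * \<epsilon> * g x)"
      using \<epsilon> gx by (simp add: power2_diff field_simps power2_eq_square)
    also have "?d\<^sup>2 = (h x)\<^sup>2 - 2 * h x * g x + (g x)\<^sup>2" by (simp add: power2_diff)
    also have "((h x)\<^sup>2 - 2 * h x * g x + (g x)\<^sup>2) / (2 * \<epsilon> * g x) = ((h x)\<^sup>2 / g x - 2 * h x + g x) / (2 * \<epsilon>)"
      using \<epsilon> gx by (simp add: field_simps power2_eq_square)
    finally have "?d \<le> \<epsilon> / 2 * g x + ((h x)\<^sup>2 / g x - 2 * h x + g x) / (2 * \<epsilon>)" by simp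
    moreover have "\<bar>h x * indicator B x - g x * indicator B x\<bar> \<le> ?d" by (simp add: indicator_def)
    ultimately show ?thesis by simp
  qed
  have hB: "integrable M (\<lambda>x. h x * indicator B x)" and gB: "integrable M (\<lambda>x. g x * indicator B x)"
    using integrable_mult_indicator[OF B hI] integrable_mult_indicator[OF B g(1)] by (simp_all add: mult.commute)
  have "\<bar>(\<integral>x. h x * indicator B x \<partial>M) - (\<integral>x. g x * indicator B x \<partial>M)\<bar>
      = \<bar>\<integral>x. h x * indicator B x - g x * indicator B x \<partial>M\<bar>"
    using hB gB by simp
  also have "\<dots> \<le> (\<integral>x. \<bar>h x * indicator B x - g x * indicator B x\<bar> \<partial>M)"
    by (rule integral_abs_bound)
  also have "\<dots> \<le> (\<integral>x. \<epsilon> / 2 * g x + ((h x)\<^sup>2 / g x - 2 * h x + g x) / (2 * \<epsilon>) \<partial>M)"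
    using hB gB hI g(1) qI by (intro integral_mono dom) auto
  also have "\<dots> = \<epsilon> / 2 + ((\<integral>x. (h x)\<^sup>2 / g x \<partial>M) - 2 + 1) / (2 * \<epsilon>)"
    using hI g(1,2) qI h1 by simp
  also have "\<dots> \<le> \<epsilon> / 2 + \<epsilon>\<^sup>2 / (2 * \<epsilon>)"
    using q1 \<epsilon> by (intro add_left_mono divide_right_mono) auto
  also have "\<dots> = \<epsilon>" using \<epsilon> by (simp add: power2_eq_square)
  finally have main: "\<bar>(\<integral>x. h x * indicator B x \<partial>M) - (\<integral>x. g x * indicator B x \<partial>M)\<bar> \<le> \<epsilon>" .
  have fB: "integrable M (\<lambda>x. f a x * indicator B x)" if "a \<in> F" for a
    using integrable_mult_indicator[OF B f(1)[OF that]] by (simp add: mult.commute)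
  have "(\<integral>x. h x * indicator B x \<partial>M) = (\<integral>x. (\<Sum>a\<in>F. f a x * indicator B x) / N \<partial>M)"
    by (simp add: h_def sum_distrib_right)
  also have "\<dots> = (\<Sum>a\<in>F. \<integral>x. f a x * indicator B x \<partial>M) / N"
    using fB by simp
  finally show ?thesis using main by (simp add: N_def)
qed

text \<open>By closeness the upper end exceeds \<open>\<tau>\<close> almost as often under the mixture of the \<open>Q a\<close> as under that
  of the \<open>P a\<close>. Hence under some \<open>Q a\<close> this happens together with \<open>l \<le> - \<tau>\<close> on an event of probability
  at least \<open>1 - 2 * \<alpha> - \<delta>\<close>, where the interval has length at least \<open>2 * \<tau>\<close>.\<close>

lemma long_interval_of_close_mixtures:
  fixes l u :: "'b \<Rightarrow> real" and P Q :: "'a \<Rightarrow> 'b measure" and \<tau> \<alpha> \<delta> :: real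
  assumes F: "finite F" "F \<noteq> {}" and \<tau>: "0 \<le> \<tau>"
    and P: "\<And>a. a \<in> F \<Longrightarrow> prob_space (P a)" "\<And>a. a \<in> F \<Longrightarrow> sets (P a) = sets M"
    and Q: "\<And>a. a \<in> F \<Longrightarrow> prob_space (Q a)" "\<And>a. a \<in> F \<Longrightarrow> sets (Q a) = sets M"
    and l [measurable]: "l \<in> borel_measurable M" and u [measurable]: "u \<in> borel_measurable M"
    and covP: "\<And>a. a \<in> F \<Longrightarrow> 1 - \<alpha> \<le> measure (P a) {z\<in>space M. \<tau> \<le> u z}"
    and covQ: "\<And>a. a \<in> F \<Longrightarrow> 1 - \<alpha> \<le> measure (Q a) {z\<in>space M. l z \<le> - \<tau>}"
    and close: "\<And>B. B \<in> sets M \<Longrightarrow> (\<Sum>a\<in>F. measure (P a) B) \<le> (\<Sum>a\<in>F. measure (Q a) B) + \<delta> * card F"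
  shows "\<exists>a\<in>F. ennreal (2 * \<tau> * (1 - 2 * \<alpha> - \<delta>)) \<le> (\<integral>\<^sup>+z. ennreal (u z - l z) \<partial>Q a)"
proof -
  let ?U = "{z\<in>space M. \<tau> \<le> u z}" and ?L = "{z\<in>space M. l z \<le> - \<tau>}"
  have U: "?U \<in> sets M" and L: "?L \<in> sets M" by measurable
  have "(\<Sum>a\<in>F. 1 - \<alpha>) \<le> (\<Sum>a\<in>F. measure (P a) ?U)" by (intro sum_mono covP)
  also have "\<dots> \<le> (\<Sum>a\<in>F. measure (Q a) ?U) + \<delta> * card F" by (rule close[OF U])
  finally have "(\<Sum>a\<in>F. 1 - \<alpha> - \<delta>) \<le> (\<Sum>a\<in>F. measure (Q a) ?U)" by (simp add: algebra_simps)
  then obtain a where a: "a \<in> F" "1 - \<alpha> - \<delta> \<le> measure (Q a) ?U"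
    using sum_strict_mono[OF F, of "\<lambda>a. measure (Q a) ?U" "\<lambda>_. 1 - \<alpha> - \<delta>"] by (meson not_le)
  interpret Qa: prob_space "Q a" by (rule Q(1)[OF a(1)])
  have UQ: "?U \<in> sets (Q a)" and LQ: "?L \<in> sets (Q a)" using U L Q(2)[OF a(1)] by auto
  have "Qa.prob (?U \<union> ?L) = Qa.prob ?U + Qa.prob ?L - Qa.prob (?U \<inter> ?L)"
    by (rule measure_Un3) (use UQ LQ in \<open>auto simp: Qa.fmeasurable_eq_sets\<close>)
  then have ge: "1 - 2 * \<alpha> - \<delta> \<le> Qa.prob (?U \<inter> ?L)"
    using a(2) covQ[OF a(1)] Qa.prob_le_1[of "?U \<union> ?L"] by linarith
  have "ennreal (2 * \<tau> * (1 - 2 * \<alpha> - \<delta>)) \<le> ennreal (2 * \<tau> * Qa.prob (?U \<inter> ?L))"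
    using ge \<tau> by (intro ennreal_leI mult_left_mono) auto
  also have "\<dots> = (\<integral>\<^sup>+z. ennreal (2 * \<tau>) * indicator (?U \<inter> ?L) z \<partial>Q a)"
    using UQ LQ \<tau> by (simp add: nn_integral_cmult_indicator Qa.emeasure_eq_measure ennreal_mult')
  also have "\<dots> \<le> (\<integral>\<^sup>+z. ennreal (u z - l z) \<partial>Q a)"
    by (intro nn_integral_mono) (auto simp: indicator_def intro!: ennreal_leI)
  finally show ?thesis using a(1) by blast
qed

text \<open>For a random choice function \<open>g\<close> the agreements with \<open>f\<close> in the \<open>k\<close> arguments are independent, each of
  probability \<open>1 / m\<close>, so the generating function of their number is \<open>(1 + (R - 1) / m) ^ k\<close>.
  This is the reason for drawing one place from each of \<open>k\<close> blocks instead of a uniform subset.\<close>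

lemma sum_power_agreements:
  fixes R :: real and f :: "nat \<Rightarrow> nat"
  assumes f: "f \<in> {..<k} \<rightarrow>\<^sub>E {..<m}" and R: "0 \<le> R"
  shows "(\<Sum>g\<in>{..<k} \<rightarrow>\<^sub>E {..<m}. R ^ card {a. a < k \<and> f a = g a})
    \<le> card ({..<k} \<rightarrow>\<^sub>E {..<m}) * exp (k * R / m)"
proof (cases "k = 0")
  case True
  then show ?thesis by (simp add: lessThan_0)
next
  case False
  then have m: "0 < m" using f by (auto simp: PiE_iff)
  have "(\<Sum>g\<in>{..<k} \<rightarrow>\<^sub>E {..<m}. R ^ card {a. a < k \<and> f a = g a})
      = (\<Sum>g\<in>{..<k} \<rightarrow>\<^sub>E {..<m}. \<Prod>a<k. if f a = g a then R else 1)"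
    by (intro sum.cong refl) (simp add: prod.If_cases Int_def)
  also have "\<dots> = (\<Prod>a<k. \<Sum>b<m. if f a = b then R else 1)"
    by (rule prod_sum_PiE[symmetric]) auto
  also have "\<dots> = (\<Prod>a<k. R + (real m - 1))"
  proof (rule prod.cong[OF refl])
    fix a assume "a \<in> {..<k}"
    then have fa: "f a \<in> {..<m}" using f by (auto simp: PiE_iff)
    have "(\<Sum>b<m. if f a = b then R else 1) = R + (\<Sum>b\<in>{..<m} - {f a}. if f a = b then R else 1)"
      using fa by (subst sum.remove[of _ "f a"]) auto
    also have "(\<Sum>b\<in>{..<m} - {f a}. if f a = b then R else 1) = (\<Sum>b\<in>{..<m} - {f a}. 1)"
      by (intro sum.cong) auto
    also have "\<dots> = real m - 1" using fa m by (simp add: of_nat_diff)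
    finally show "(\<Sum>b<m. if f a = b then R else 1) = R + (real m - 1)" .
  qed
  also have "\<dots> = real m ^ k * (1 + (R - 1) / m) ^ k"
    using m by (simp add: power_mult_distrib[symmetric] field_simps)
  also have "\<dots> \<le> real m ^ k * exp (R / m) ^ k"
  proof (intro mult_left_mono power_mono)
    show "1 + (R - 1) / m \<le> exp (R / m)"
      using exp_ge_add_one_self[of "R / m"] divide_nonneg_nonneg[of 1 "real m"]
      unfolding diff_divide_distrib by linarith
    show "0 \<le> 1 + (R - 1) / m" using m R by (simp add: field_simps)
  qed simp
  also have "\<dots> = card ({..<k} \<rightarrow>\<^sub>E {..<m}) * exp (k * R / m)"
    by (simp add: card_PiE exp_of_nat_mult[symmetric])
  finally show ?thesis .
qed

section \<open>Lower bound for a block prior\<close>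

lemma lik_cong: "(\<And>j. j < p \<Longrightarrow> w j = v j) \<Longrightarrow> lik n p \<sigma> w = lik n p \<sigma> v"
  by (auto simp: lik_def lin_def fun_eq_iff)

lemma lik_nonneg: "0 \<le> lik n p \<sigma> w z"
  by (simp add: lik_def prod_nonneg)

lemma lik_pos: "0 < \<sigma> \<Longrightarrow> 0 < lik n p \<sigma> w z"
  by (auto simp: lik_def intro!: prod_pos normal_density_pos)

lemma has_bochner_integral_lik:
  assumes "0 < \<sigma>" shows "has_bochner_integral (base_law n p) (lik n p \<sigma> w) 1"
proof (rule has_bochner_integral_nn_integral)
  have w: "lik n p \<sigma> (($) (vec p w)) = lik n p \<sigma> w" by (rule lik_cong) simp
  have "prob_space (density (base_law n p) (\<lambda>z. ennreal (lik n p \<sigma> w z)))"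
    using prob_space_obs_law[of "vec p w" p \<sigma> n] obs_law_eq_density[of "vec p w" p \<sigma> n] assms w by simp
  from prob_space.emeasure_space_1[OF this]
  show "(\<integral>\<^sup>+z. ennreal (lik n p \<sigma> w z) \<partial>base_law n p) = ennreal 1"
    by (simp add: emeasure_density)
qed (simp_all add: lik_nonneg)

lemma sets_base_law: "sets (base_law n p) = sets (obs_space n p)"
  unfolding base_law_def obs_space_def by (intro sets_PiM_cong sets_pair_measure_cong sets_gauss_row) simp_all

lemma measure_obs_law_eq_integral:
  assumes "\<beta> \<in> carrier_vec p" "0 < \<sigma>" and B: "B \<in> sets (base_law n p)"
  shows "measure (obs_law n p (\<beta>, 1\<^sub>m p, \<sigma>)) B = (\<integral>z. lik n p \<sigma> (($) \<beta>) z * indicator B z \<partial>base_law n p)"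
proof -
  have I: "integrable (base_law n p) (\<lambda>z. lik n p \<sigma> (($) \<beta>) z * indicator B z)"
    using integrable_mult_indicator[OF B, of "lik n p \<sigma> (($) \<beta>)"]
      has_bochner_integral_lik[OF assms(2), of n p "($) \<beta>"]
    by (simp add: has_bochner_integral_iff mult.commute)
  have "emeasure (obs_law n p (\<beta>, 1\<^sub>m p, \<sigma>)) B = (\<integral>\<^sup>+z. ennreal (lik n p \<sigma> (($) \<beta>) z * indicator B z) \<partial>base_law n p)"
    unfolding obs_law_eq_density[OF assms(1,2)] using B
    by (subst emeasure_density) (auto simp: indicator_def intro!: nn_integral_cong)
  also have "\<dots> = ennreal (\<integral>z. lik n p \<sigma> (($) \<beta>) z * indicator B z \<partial>base_law n p)"
    by (rule nn_integral_eq_integral[OF I]) (simp add: lik_nonneg)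
  finally show ?thesis
    by (simp add: measure_def lik_nonneg integral_nonneg_AE)
qed

lemma conf_interval_coverage:
  assumes CI: "(l, u) \<in> conf_intervals n p \<alpha> \<Theta> T" and \<theta>: "(\<beta>, 1\<^sub>m p, \<sigma>) \<in> \<Theta>"
    and \<beta>: "\<beta> \<in> carrier_vec p" and \<sigma>: "0 < \<sigma>"
  shows "1 - \<alpha> \<le> measure (obs_law n p (\<beta>, 1\<^sub>m p, \<sigma>)) {z \<in> space (obs_space n p). l z \<le> T \<beta> \<and> T \<beta> \<le> u z}"
proof -
  interpret prob_space "obs_law n p (\<beta>, 1\<^sub>m p, \<sigma>)" by (rule prob_space_obs_law[OF \<beta> \<sigma>])
  have "ennreal (1 - \<alpha>) \<le> (INF \<theta>\<in>\<Theta>. emeasure (obs_law n p \<theta>)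
        {z \<in> space (obs_space n p). l z \<le> T (fst \<theta>) \<and> T (fst \<theta>) \<le> u z})"
    using CI by (simp add: conf_intervals_def)
  also have "\<dots> \<le> emeasure (obs_law n p (\<beta>, 1\<^sub>m p, \<sigma>)) {z \<in> space (obs_space n p). l z \<le> T \<beta> \<and> T \<beta> \<le> u z}"
    by (rule INF_lower2[OF \<theta>]) simp
  finally show ?thesis by (simp add: emeasure_eq_measure ennreal_le_iff)
qed

text \<open>The prior: cut \<open>k * m\<close> places of the support of \<open>\<xi>\<close> into \<open>k\<close> blocks of size \<open>m\<close>, let \<open>f\<close> choose one place in
  each block, and put the value \<open>r * \<rho> * sgn (\<xi> $ j)\<close> at the chosen places \<open>S f\<close>, with \<open>r = 1\<close> or
  \<open>r = - 1\<close>. Then \<open>W r f\<close> and \<open>W r g\<close> have inner product \<open>\<rho>\<^sup>2\<close> times the number of agreements of \<open>f\<close> and \<open>g\<close>.\<close>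

lemma minimax_length_lower:
  fixes \<xi> :: "real vec" and \<sigma> \<rho> b \<epsilon> \<alpha> :: real
  assumes \<sigma>: "0 < \<sigma>" and \<xi>: "\<xi> \<in> carrier_vec p" and km: "k * m \<le> card (supp_vec \<xi>)" and m: "0 < m"
    and b: "0 \<le> b" "\<And>j. j \<in> supp_vec \<xi> \<Longrightarrow> b \<le> \<bar>\<xi> $ j\<bar>"
    and \<rho>: "0 \<le> \<rho>" "2 * (k * \<rho>\<^sup>2) \<le> \<sigma>\<^sup>2"
    and \<epsilon>: "0 < \<epsilon>" "exp (k * exp (2 * real n * \<rho>\<^sup>2 / \<sigma>\<^sup>2) / m) \<le> 1 + \<epsilon>\<^sup>2"
  shows "ennreal (2 * (k * \<rho> * b) * (1 - 2 * \<alpha> - 2 * \<epsilon>))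
    \<le> minimax_length n p \<alpha> (param_space p k (1\<^sub>m p) \<sigma>) (\<lambda>\<beta>. \<xi> \<bullet> \<beta>)"
proof -
  define F where "F = ({..<k} \<rightarrow>\<^sub>E {..<m})"
  have F: "finite F" "F \<noteq> {}" using m by (auto simp: F_def PiE_eq_empty_iff intro!: finite_PiE)
  have finS: "finite (supp_vec \<xi>)" by (simp add: supp_vec_def)
  obtain h :: "nat \<Rightarrow> nat" where h: "inj_on h {..<k * m}" "h ` {..<k * m} \<subseteq> supp_vec \<xi>"
    using card_le_inj[of "{..<k * m}" "supp_vec \<xi>"] finS km by auto
  define e where "e f a = h (a * m + f a)" for f :: "nat \<Rightarrow> nat" and a
  have lt: "a * m + f a < k * m" if "f \<in> F" "a < k" for f a
  proof -
    have "f a < m" using that by (auto simp: F_def PiE_iff)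
    then have "a * m + f a < Suc a * m" by simp
    also have "\<dots> \<le> k * m" using that by (intro mult_le_mono1) simp
    finally show ?thesis .
  qed
  have e_eq: "a = a' \<and> f a = g a'" if "f \<in> F" "g \<in> F" "a < k" "a' < k" "e f a = e g a'" for f g a a'
  proof -
    have eq: "a * m + f a = a' * m + g a'"
      using that lt by (auto simp: e_def dest!: inj_onD[OF h(1)])
    have "f a < m" "g a' < m" using that by (auto simp: F_def PiE_iff)
    then show ?thesis using arg_cong[OF eq, of "\<lambda>x. x div m"] arg_cong[OF eq, of "\<lambda>x. x mod m"] by simp
  qed
  define S where "S f = e f ` {..<k}" for f
  have S_supp: "S f \<subseteq> supp_vec \<xi>" if "f \<in> F" for f
    using h(2) lt[OF that] by (auto simp: S_def e_def)
  have S_p: "S f \<subseteq> {..<p}" if "f \<in> F" for f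
    using S_supp[OF that] \<xi> by (auto simp: supp_vec_def)
  have S_fin: "finite (S f)" for f by (simp add: S_def)
  have S_card: "card (S f) = k" if "f \<in> F" for f
    unfolding S_def using e_eq[OF that that] by (subst card_image) (auto simp: inj_on_def)
  have S_int: "card (S f \<inter> S g) = card {a. a < k \<and> f a = g a}" if "f \<in> F" "g \<in> F" for f g
  proof -
    have "S f \<inter> S g = e f ` {a. a < k \<and> f a = g a}"
      using e_eq[OF that] by (auto simp: S_def) (auto simp: e_def)
    moreover have "inj_on (e f) {a. a < k \<and> f a = g a}"
      using e_eq[OF that(1) that(1)] by (auto simp: inj_on_def)
    ultimately show ?thesis by (simp add: card_image)
  qed
  define W where "W r f = vec p (\<lambda>j. if j \<in> S f then r * \<rho> * sgn (\<xi> $ j) else 0)" for r :: real and f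
  have W: "W r f \<in> carrier_vec p" for r f by (simp add: W_def)
  have W_mult: "W r f $ j * W r g $ j = (if j \<in> S f \<inter> S g then r\<^sup>2 * \<rho>\<^sup>2 else 0)"
    if "f \<in> F" "j < p" for r f g j
  proof -
    have "sgn (\<xi> $ j) * sgn (\<xi> $ j) = 1" if "j \<in> S f"
      using S_supp[OF \<open>f \<in> F\<close>] that by (auto simp: supp_vec_def sgn_if)
    then show ?thesis using that by (auto simp: W_def power2_eq_square algebra_simps)
  qed
  have W_inner: "(\<Sum>j<p. W r f $ j * W r g $ j) = card {a. a < k \<and> f a = g a} * (r\<^sup>2 * \<rho>\<^sup>2)"
    if "f \<in> F" "g \<in> F" for r f g
  proof -
    have "(\<Sum>j<p. W r f $ j * W r g $ j) = (\<Sum>j<p. if j \<in> S f \<inter> S g then r\<^sup>2 * \<rho>\<^sup>2 else 0)"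
      using W_mult[OF that(1)] by (intro sum.cong) auto
    also have "\<dots> = (\<Sum>j\<in>{..<p} \<inter> (S f \<inter> S g). r\<^sup>2 * \<rho>\<^sup>2)"
      by (rule sum.inter_restrict[symmetric]) simp
    also have "{..<p} \<inter> (S f \<inter> S g) = S f \<inter> S g"
      using S_p[OF that(1)] by blast
    finally show ?thesis using S_int[OF that] by simp
  qed
  have W_norm: "(\<Sum>j<p. (W r f $ j)\<^sup>2) = k * \<rho>\<^sup>2" if "f \<in> F" "r\<^sup>2 = 1" for r f
    using W_inner[OF that(1,1), of r] that(2) by (simp add: power2_eq_square)
  have W_param: "(W r f, 1\<^sub>m p, \<sigma>) \<in> param_space p k (1\<^sub>m p) \<sigma>" if "f \<in> F" for r f
  proof -
    have "supp_vec (W r f) \<subseteq> S f" by (auto simp: supp_vec_def W_def split: if_splits)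
    then have "l0_norm (W r f) \<le> k"
      unfolding l0_norm_def using card_mono[OF S_fin] S_card[OF that] by metis
    then show ?thesis using W by (auto simp: param_space_def)
  qed
  define \<tau> where "\<tau> = k * \<rho> * b"
  have W_T: "\<xi> \<bullet> W r f = r * (\<Sum>j\<in>S f. \<rho> * \<bar>\<xi> $ j\<bar>)" if "f \<in> F" for r f
  proof -
    have "\<xi> \<bullet> W r f = (\<Sum>j<p. if j \<in> S f then r * (\<rho> * \<bar>\<xi> $ j\<bar>) else 0)"
      by (auto simp: scalar_prod_def W_def atLeast0LessThan abs_real_def sgn_if intro!: sum.cong)
    also have "\<dots> = (\<Sum>j\<in>S f. r * (\<rho> * \<bar>\<xi> $ j\<bar>))"
      using S_p[OF that] by (subst sum.inter_restrict[symmetric]) (simp_all add: Int_absorb1)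
    finally show ?thesis by (simp add: sum_distrib_left)
  qed
  have \<tau>_le: "\<tau> \<le> (\<Sum>j\<in>S f. \<rho> * \<bar>\<xi> $ j\<bar>)" if "f \<in> F" for f
  proof -
    have "\<tau> = (\<Sum>j\<in>S f. \<rho> * b)" using S_card[OF that] by (simp add: \<tau>_def)
    also have "\<dots> \<le> (\<Sum>j\<in>S f. \<rho> * \<bar>\<xi> $ j\<bar>)"
      using b(2) S_supp[OF that] \<rho>(1) by (intro sum_mono mult_left_mono) auto
    finally show ?thesis .
  qed
  define s where "s = sqrt (\<sigma>\<^sup>2 + k * \<rho>\<^sup>2)"
  have s: "0 < s" unfolding s_def using \<sigma> by (simp add: add_pos_nonneg)
  define G where "G = lik n p s (\<lambda>_. 0)"
  define R where "R = exp (2 * real n * \<rho>\<^sup>2 / \<sigma>\<^sup>2)"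
  let ?M = "base_law n p"
  have close: "\<bar>(\<Sum>f\<in>F. measure (obs_law n p (W r f, 1\<^sub>m p, \<sigma>)) B) / card F - (\<integral>z. G z * indicator B z \<partial>?M)\<bar> \<le> \<epsilon>"
    if r: "r\<^sup>2 = 1" and B: "B \<in> sets ?M" for r B
  proof -
    have "\<bar>(\<Sum>f\<in>F. \<integral>z. lik n p \<sigma> (($) (W r f)) z * indicator B z \<partial>?M) / card F - (\<integral>z. G z * indicator B z \<partial>?M)\<bar> \<le> \<epsilon>"
    proof (rule mixture_close[OF F \<epsilon>(1) _ _ _ _ _ _ _ B])
      fix f assume f: "f \<in> F"
      have "(\<Sum>g\<in>F. \<integral>\<^sup>+z. ennreal (lik n p \<sigma> (($) (W r f)) z * lik n p \<sigma> (($) (W r g)) z / G z) \<partial>?M)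
          \<le> (\<Sum>g\<in>F. ennreal (R ^ card {a. a < k \<and> f a = g a}))"
      proof (rule sum_mono)
        fix g assume g: "g \<in> F"
        have "(\<integral>\<^sup>+z. ennreal (lik n p \<sigma> (($) (W r f)) z * lik n p \<sigma> (($) (W r g)) z / G z) \<partial>?M)
          \<le> ennreal (exp (2 * real n * (\<Sum>j<p. W r f $ j * W r g $ j) / \<sigma>\<^sup>2))"
          unfolding G_def s_def
          by (rule lik_affinity[OF \<sigma> _ W_norm[OF f r] W_norm[OF g r] \<rho>(2)]) (auto simp: W_def)
        also have "2 * real n * (\<Sum>j<p. W r f $ j * W r g $ j) / \<sigma>\<^sup>2
            = card {a. a < k \<and> f a = g a} * (2 * real n * \<rho>\<^sup>2 / \<sigma>\<^sup>2)"
          unfolding W_inner[OF f g] r by simp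
        finally show "(\<integral>\<^sup>+z. ennreal (lik n p \<sigma> (($) (W r f)) z * lik n p \<sigma> (($) (W r g)) z / G z) \<partial>?M)
            \<le> ennreal (R ^ card {a. a < k \<and> f a = g a})"
          unfolding exp_of_nat_mult R_def .
      qed
      also have "\<dots> = ennreal (\<Sum>g\<in>F. R ^ card {a. a < k \<and> f a = g a})"
        by (rule sum_ennreal) (simp add: R_def)
      also have "\<dots> \<le> ennreal (card F * (1 + \<epsilon>\<^sup>2))"
      proof (rule ennreal_leI)
        have "(\<Sum>g\<in>F. R ^ card {a. a < k \<and> f a = g a}) \<le> card F * exp (k * R / m)"
          unfolding F_def by (rule sum_power_agreements) (use f in \<open>auto simp: F_def R_def\<close>)
        also have "\<dots> \<le> card F * (1 + \<epsilon>\<^sup>2)" using \<epsilon>(2) by (intro mult_left_mono) (auto simp: R_def)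
        finally show "(\<Sum>g\<in>F. R ^ card {a. a < k \<and> f a = g a}) \<le> card F * (1 + \<epsilon>\<^sup>2)" .
      qed
      finally show "(\<Sum>g\<in>F. \<integral>\<^sup>+z. ennreal (lik n p \<sigma> (($) (W r f)) z * lik n p \<sigma> (($) (W r g)) z / G z) \<partial>?M)
          \<le> ennreal (card F * (1 + \<epsilon>\<^sup>2))" .
    qed (use has_bochner_integral_lik[OF \<sigma>, of n p] has_bochner_integral_lik[OF s, of n p] lik_pos[OF s] lik_nonneg
         in \<open>auto simp: has_bochner_integral_iff G_def\<close>)
    then show ?thesis using measure_obs_law_eq_integral[OF W \<sigma> B] by simp
  qed
  show ?thesis
    unfolding minimax_length_def
  proof (rule INF_greatest)
    fix lu assume lu: "lu \<in> conf_intervals n p \<alpha> (param_space p k (1\<^sub>m p) \<sigma>) (\<lambda>\<beta>. \<xi> \<bullet> \<beta>)"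
    obtain l u where lu_eq: "lu = (l, u)" by (cases lu)
    have [measurable]: "l \<in> borel_measurable (obs_space n p)" "u \<in> borel_measurable (obs_space n p)"
      using lu by (auto simp: lu_eq conf_intervals_def)
    note cov = conf_interval_coverage[OF lu[unfolded lu_eq] W_param W \<sigma>]
    have "\<exists>f\<in>F. ennreal (2 * \<tau> * (1 - 2 * \<alpha> - 2 * \<epsilon>)) \<le> (\<integral>\<^sup>+z. ennreal (u z - l z) \<partial>obs_law n p (W (- 1) f, 1\<^sub>m p, \<sigma>))"
    proof (rule long_interval_of_close_mixtures[where M = "obs_space n p" and P = "\<lambda>f. obs_law n p (W 1 f, 1\<^sub>m p, \<sigma>)", OF F])
      show "0 \<le> \<tau>" using \<rho>(1) b(1) by (simp add: \<tau>_def)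
      fix f assume f: "f \<in> F"
      interpret P: prob_space "obs_law n p (W 1 f, 1\<^sub>m p, \<sigma>)" by (rule prob_space_obs_law[OF W \<sigma>])
      interpret Q: prob_space "obs_law n p (W (- 1) f, 1\<^sub>m p, \<sigma>)" by (rule prob_space_obs_law[OF W \<sigma>])
      show "1 - \<alpha> \<le> P.prob {z \<in> space (obs_space n p). \<tau> \<le> u z}"
        using cov[OF f, of 1] \<tau>_le[OF f] W_T[OF f, of 1]
        by (elim order_trans) (auto intro!: P.finite_measure_mono)
      show "1 - \<alpha> \<le> Q.prob {z \<in> space (obs_space n p). l z \<le> - \<tau>}"
        using cov[OF f, of "- 1"] \<tau>_le[OF f] W_T[OF f, of "- 1"]
        by (elim order_trans) (auto intro!: Q.finite_measure_mono)
    next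
      fix B assume "B \<in> sets (obs_space n p)"
      then have B: "B \<in> sets ?M" by (simp add: sets_base_law)
      have N: "0 < real (card F)" using F by (simp add: card_gt_0_iff)
      have "(\<Sum>f\<in>F. measure (obs_law n p (W 1 f, 1\<^sub>m p, \<sigma>)) B) / card F
          \<le> (\<Sum>f\<in>F. measure (obs_law n p (W (- 1) f, 1\<^sub>m p, \<sigma>)) B) / card F + 2 * \<epsilon>"
        using close[OF _ B, of 1] close[OF _ B, of "- 1"] by simp
      then show "(\<Sum>f\<in>F. measure (obs_law n p (W 1 f, 1\<^sub>m p, \<sigma>)) B)
          \<le> (\<Sum>f\<in>F. measure (obs_law n p (W (- 1) f, 1\<^sub>m p, \<sigma>)) B) + 2 * \<epsilon> * card F"
        using N by (simp add: field_simps)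
    qed (auto intro!: prob_space_obs_law W \<sigma>)
    then obtain f where f: "f \<in> F"
      and len: "ennreal (2 * \<tau> * (1 - 2 * \<alpha> - 2 * \<epsilon>)) \<le> (\<integral>\<^sup>+z. ennreal (u z - l z) \<partial>obs_law n p (W (- 1) f, 1\<^sub>m p, \<sigma>))"
      by blast
    show "ennreal (2 * (k * \<rho> * b) * (1 - 2 * \<alpha> - 2 * \<epsilon>))
      \<le> (case lu of (l, u) \<Rightarrow> SUP \<theta>\<in>param_space p k (1\<^sub>m p) \<sigma>. \<integral>\<^sup>+z. ennreal (u z - l z) \<partial>obs_law n p \<theta>)"
      using len unfolding lu_eq \<tau>_def prod.case by (rule SUP_upper2[OF W_param[OF f]])
  qed
qed

section \<open>The \<open>\<ell>\<^sub>1\<close> error of a sparse fit\<close>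

text \<open>Convexity of the square: \<open>lin p e x\<close> is, up to signs, \<open>\<Sum>j. \<bar>e j\<bar>\<close> times a weighted mean of the entries
  of \<open>x\<close>. So small errors in \<open>\<ell>\<^sub>1\<close> are controlled without a bound on the operator norm of \<open>X\<close>.\<close>

lemma sum_square_lin_le:
  fixes X :: "nat \<Rightarrow> nat \<Rightarrow> real"
  assumes col: "\<And>j. j < p \<Longrightarrow> (\<Sum>i<n. (X i j)\<^sup>2) \<le> K"
  shows "(\<Sum>i<n. (lin p e (X i))\<^sup>2) \<le> K * (\<Sum>j<p. \<bar>e j\<bar>)\<^sup>2"
proof -
  have "(lin p e (X i))\<^sup>2 \<le> (\<Sum>j<p. \<bar>e j\<bar>) * (\<Sum>j<p. \<bar>e j\<bar> * (X i j)\<^sup>2)" for i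
  proof -
    have "\<bar>X i j * e j\<bar> = sqrt \<bar>e j\<bar> * (sqrt \<bar>e j\<bar> * \<bar>X i j\<bar>)" for j
      by (simp only: abs_mult mult.assoc[symmetric] real_sqrt_mult_self abs_abs mult.commute[of "\<bar>X i j\<bar>"])
    then have "\<bar>lin p e (X i)\<bar> \<le> (\<Sum>j<p. sqrt \<bar>e j\<bar> * (sqrt \<bar>e j\<bar> * \<bar>X i j\<bar>))"
      unfolding lin_def using sum_abs[of "\<lambda>j. X i j * e j" "{..<p}"] by simp
    then have "(lin p e (X i))\<^sup>2 \<le> (\<Sum>j<p. sqrt \<bar>e j\<bar> * (sqrt \<bar>e j\<bar> * \<bar>X i j\<bar>))\<^sup>2"
      using power_mono[OF _ abs_ge_zero, of "lin p e (X i)" _ 2] by simp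
    also have "\<dots> \<le> (\<Sum>j<p. (sqrt \<bar>e j\<bar>)\<^sup>2) * (\<Sum>j<p. (sqrt \<bar>e j\<bar> * \<bar>X i j\<bar>)\<^sup>2)"
      by (rule Cauchy_Schwarz_ineq_sum)
    finally show ?thesis by (simp add: power_mult_distrib)
  qed
  then have "(\<Sum>i<n. (lin p e (X i))\<^sup>2) \<le> (\<Sum>i<n. (\<Sum>j<p. \<bar>e j\<bar>) * (\<Sum>j<p. \<bar>e j\<bar> * (X i j)\<^sup>2))"
    by (rule sum_mono)
  also have "\<dots> = (\<Sum>j<p. \<bar>e j\<bar>) * (\<Sum>j<p. \<bar>e j\<bar> * (\<Sum>i<n. (X i j)\<^sup>2))"
    unfolding sum_distrib_left[symmetric] by (subst sum.swap) (simp only: sum_distrib_left[symmetric])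
  also have "\<dots> \<le> (\<Sum>j<p. \<bar>e j\<bar>) * (\<Sum>j<p. \<bar>e j\<bar> * K)"
    using col by (intro mult_left_mono sum_mono) (auto simp: sum_nonneg)
  also have "\<dots> = K * (\<Sum>j<p. \<bar>e j\<bar>)\<^sup>2"
    by (simp add: sum_distrib_right[symmetric] power2_eq_square)
  finally show ?thesis .
qed

lemma square_sum_abs_le:
  fixes v :: "nat \<Rightarrow> real"
  assumes "card {j. j < p \<and> v j \<noteq> 0} \<le> m"
  shows "(\<Sum>j<p. \<bar>v j\<bar>)\<^sup>2 \<le> m * (\<Sum>j<p. (v j)\<^sup>2)"
proof -
  let ?S = "{j. j < p \<and> v j \<noteq> 0}"
  have "(\<Sum>j<p. \<bar>v j\<bar>) = (\<Sum>j\<in>?S. 1 * \<bar>v j\<bar>)" and sq: "(\<Sum>j<p. (v j)\<^sup>2) = (\<Sum>j\<in>?S. (v j)\<^sup>2)"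
    by (auto intro!: sum.mono_neutral_right)
  then have "(\<Sum>j<p. \<bar>v j\<bar>)\<^sup>2 \<le> (\<Sum>j\<in>?S. 1\<^sup>2) * (\<Sum>j\<in>?S. \<bar>v j\<bar>\<^sup>2)"
    using Cauchy_Schwarz_ineq_sum[of "\<lambda>_. 1" "\<lambda>j. \<bar>v j\<bar>" ?S] by (simp only:)
  also have "\<dots> \<le> m * (\<Sum>j\<in>?S. (v j)\<^sup>2)"
    using assms by (auto intro!: mult_right_mono sum_nonneg)
  finally show ?thesis unfolding sq .
qed

text \<open>The zeros from \<open>p\<close> on make the set finite.\<close>

definition sparse_grid :: "nat \<Rightarrow> nat \<Rightarrow> nat \<Rightarrow> (nat \<Rightarrow> int) set" where
  "sparse_grid p m M = {z. (\<forall>j. \<bar>z j\<bar> \<le> int M) \<and> (\<forall>j\<ge>p. z j = 0) \<and> card {j. j < p \<and> z j \<noteq> 0} \<le> m}"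

text \<open>A grid vector is the sum of \<open>m\<close> terms, each given by a place and a value; shorter sums are padded
  with the value \<open>0\<close> at place \<open>0\<close>.\<close>

lemma sparse_grid_finite_card:
  assumes p: "0 < p"
  shows "finite (sparse_grid p m M)" and "card (sparse_grid p m M) \<le> (p * (2 * M + 1)) ^ m"
proof -
  let ?C = "{..<p} \<times> {- int M..int M}"
  let ?P = "{..<m} \<rightarrow>\<^sub>E ?C"
  define \<Phi> where "\<Phi> f j = (\<Sum>a<m. if fst (f a) = j then snd (f a) else 0)" for f :: "nat \<Rightarrow> nat \<times> int" and j
  have sub: "sparse_grid p m M \<subseteq> \<Phi> ` ?P"
  proof
    fix z assume z: "z \<in> sparse_grid p m M"
    let ?S = "{j. j < p \<and> z j \<noteq> 0}"
    define c where "c = card ?S"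
    have cm: "c \<le> m" using z by (simp add: sparse_grid_def c_def)
    obtain h where h: "bij_betw h {..<c} ?S"
      using finite_same_card_bij[of "{..<c}" ?S] by (auto simp: c_def)
    define f where "f = (\<lambda>a\<in>{..<m}. if a < c then (h a, z (h a)) else (0, 0))"
    have hS: "h a \<in> ?S" if "a < c" for a using bij_betwE[OF h] that by blast
    have "f \<in> ?P"
      unfolding f_def
    proof (rule restrict_PiE_iff[THEN iffD2], rule ballI)
      fix a assume "a \<in> {..<m}"
      have "\<bar>z (h a)\<bar> \<le> int M" using z unfolding sparse_grid_def by blast
      then show "(if a < c then (h a, z (h a)) else (0, 0)) \<in> ?C"
        using hS[of a] p by (cases "a < c") (simp_all add: abs_le_iff minus_le_iff)
    qed
    moreover have "\<Phi> f j = z j" for j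
    proof -
      have "\<Phi> f j = (\<Sum>a<m. if a < c \<and> h a = j then z j else 0)"
        unfolding \<Phi>_def by (intro sum.cong refl) (simp add: f_def)
      also have "\<dots> = (\<Sum>a<c. if h a = j then z j else 0)"
        using cm by (intro sum.mono_neutral_cong_right) auto
      also have "\<dots> = (\<Sum>i\<in>?S. if i = j then z j else 0)"
        by (rule sum.reindex_bij_betw[OF h])
      also have "\<dots> = z j"
      proof (cases "j \<in> ?S")
        case False
        then have "z j = 0" using z unfolding sparse_grid_def by (cases "j < p") auto
        then show ?thesis by simp
      qed simp
      finally show ?thesis .
    qed
    ultimately show "z \<in> \<Phi> ` ?P" by (auto intro!: image_eqI[of _ _ f])
  qed
  have fin: "finite ?P" by (intro finite_PiE) auto
  show "finite (sparse_grid p m M)" using sub fin by (meson finite_imageI finite_subset)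
  have "card (sparse_grid p m M) \<le> card (\<Phi> ` ?P)" using sub fin by (intro card_mono) auto
  also have "\<dots> \<le> card ?P" using fin by (rule card_image_le)
  also have "\<dots> = (p * (2 * M + 1)) ^ m"
  proof -
    have "card {- int M..int M} = 2 * M + 1" by simp
    then show ?thesis unfolding card_PiE[OF finite_lessThan] prod_constant card_cartesian_product by simp
  qed
  finally show "card (sparse_grid p m M) \<le> (p * (2 * M + 1)) ^ m" .
qed

text \<open>Scale \<open>\<delta>\<close> to \<open>v\<close> with \<open>\<ell>\<^sub>1\<close> norm \<open>M\<close> and round down to an integer vector \<open>z\<close>. The rounding error \<open>e\<close> has
  \<open>\<ell>\<^sub>1\<close> norm at most \<open>m\<close>, so \<open>\<parallel>Xe\<parallel>\<^sup>2 \<le> 4n m\<^sup>2\<close>, which for \<open>M\<^sup>2 \<ge> 120 m\<^sup>3\<close> is negligible against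
  \<open>\<parallel>Xz\<parallel>\<^sup>2 \<ge> n/3 \<parallel>z\<parallel>\<^sup>2\<close>, because \<open>\<parallel>v\<parallel>\<^sup>2 \<ge> M\<^sup>2 / m\<close> by sparsity. The resulting bound
  \<open>\<parallel>Xv\<parallel>\<^sup>2 \<ge> n M\<^sup>2 / (24 m)\<close> is played off against \<open>\<parallel>X\<delta>\<parallel>\<^sup>2 \<le> 2\<eta> \<parallel>\<delta>\<parallel>\<^sub>1\<close>.\<close>

lemma l1_error_bound:
  fixes X :: "nat \<Rightarrow> nat \<Rightarrow> real" and \<delta> :: "nat \<Rightarrow> real"
  assumes p: "0 < p" and sparse: "card {j. j < p \<and> \<delta> j \<noteq> 0} \<le> m" and m: "1 \<le> m" and M: "120 * real m ^ 3 \<le> (real M)\<^sup>2" and n: "0 < n"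
    and col: "\<And>j. j < p \<Longrightarrow> (\<Sum>i<n. (X i j)\<^sup>2) \<le> 4 * real n"
    and grid: "\<And>z. z \<in> sparse_grid p m M \<Longrightarrow>
      real n / 3 * (\<Sum>j<p. (of_int (z j))\<^sup>2) \<le> (\<Sum>i<n. (lin p (\<lambda>j. of_int (z j)) (X i))\<^sup>2)"
    and corr: "\<And>j. j < p \<Longrightarrow> \<bar>\<Sum>i<n. X i j * lin p \<delta> (X i)\<bar> \<le> 2 * \<eta>"
  shows "(\<Sum>j<p. \<bar>\<delta> j\<bar>) \<le> 48 * m * \<eta> / n"
proof (cases "(\<Sum>j<p. \<bar>\<delta> j\<bar>) = 0")
  case True
  have "0 \<le> \<eta>" using corr[OF p] by linarith
  then show ?thesis unfolding True by simp
next
  case False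
  define D where "D = (\<Sum>j<p. \<bar>\<delta> j\<bar>)"
  have D: "0 < D" unfolding D_def by (rule le_neq_trans[OF sum_nonneg False[symmetric]]) simp
  have mpos: "0 < real m" using m by simp
  have Mpos: "0 < real M"
  proof -
    have "0 < 120 * real m ^ 3" using mpos by simp
    then have "0 < (real M)\<^sup>2" using M by linarith
    then show ?thesis by (cases "M = 0") auto
  qed
  define v where "v j = (if j < p then real M / D * \<delta> j else 0)" for j
  define z where "z j = \<lfloor>v j\<rfloor>" for j
  define e where "e j = of_int (z j) - v j" for j
  have v1: "(\<Sum>j<p. \<bar>v j\<bar>) = real M"
  proof -
    have "(\<Sum>j<p. \<bar>v j\<bar>) = (\<Sum>j<p. real M / D * \<bar>\<delta> j\<bar>)"
      using D by (intro sum.cong) (auto simp: v_def abs_mult)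
    also have "\<dots> = real M / D * D" unfolding D_def by (rule sum_distrib_left[symmetric])
    finally show ?thesis using D by simp
  qed
  have vabs: "\<bar>v j\<bar> \<le> real M" for j
  proof (cases "j < p")
    case True
    have "\<bar>v j\<bar> \<le> (\<Sum>j<p. \<bar>v j\<bar>)" by (rule member_le_sum) (use True in auto)
    then show ?thesis by (simp add: v1)
  qed (simp add: v_def)
  have supp_v: "{j. j < p \<and> v j \<noteq> 0} = {j. j < p \<and> \<delta> j \<noteq> 0}" using D Mpos by (auto simp: v_def)
  have zv: "v j \<noteq> 0" if "z j \<noteq> 0" for j using that by (auto simp: z_def)
  have zgrid: "z \<in> sparse_grid p m M"
  proof -
    have "card {j. j < p \<and> z j \<noteq> 0} \<le> card {j. j < p \<and> v j \<noteq> 0}"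
      using zv by (intro card_mono) auto
    moreover have "\<bar>z j\<bar> \<le> int M" for j
    proof -
      have "- real M \<le> v j" "v j \<le> real M" using vabs[of j] by auto
      then have "- int M \<le> z j" "z j \<le> int M" unfolding z_def by (auto simp: le_floor_iff floor_le_iff)
      then show ?thesis by simp
    qed
    ultimately show ?thesis using sparse supp_v by (auto simp: sparse_grid_def) (simp add: z_def v_def)
  qed
  have e1: "\<bar>e j\<bar> \<le> 1" for j unfolding e_def z_def using of_int_floor_le[of "v j"] floor_correct[of "v j"] by linarith
  have e0: "e j = 0" if "v j = 0" for j using that by (simp add: e_def z_def)
  have esum: "(\<Sum>j<p. \<bar>e j\<bar>) \<le> m" and esq: "(\<Sum>j<p. (e j)\<^sup>2) \<le> m"
  proof -
    let ?S = "{j. j < p \<and> v j \<noteq> 0}"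
    have card: "(\<Sum>j\<in>?S. 1) \<le> real m" using sparse supp_v by simp
    have "(\<Sum>j<p. \<bar>e j\<bar>) = (\<Sum>j\<in>?S. \<bar>e j\<bar>)" using e0 by (intro sum.mono_neutral_right) auto
    also have "\<dots> \<le> (\<Sum>j\<in>?S. 1)" using e1 by (intro sum_mono) auto
    finally show "(\<Sum>j<p. \<bar>e j\<bar>) \<le> m" using card by linarith
    have "(\<Sum>j<p. (e j)\<^sup>2) = (\<Sum>j\<in>?S. (e j)\<^sup>2)" using e0 by (intro sum.mono_neutral_right) auto
    also have "\<dots> \<le> (\<Sum>j\<in>?S. 1)" using e1 by (intro sum_mono) (simp add: abs_square_le_1)
    finally show "(\<Sum>j<p. (e j)\<^sup>2) \<le> m" using card by linarith
  qed
  define XV where "XV = (\<Sum>i<n. (lin p v (X i))\<^sup>2)"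
  define VV where "VV = (\<Sum>j<p. (v j)\<^sup>2)"
  define ZZ where "ZZ = (\<Sum>j<p. (of_int (z j) :: real)\<^sup>2)"
  have par: "a\<^sup>2 \<le> 2 * b\<^sup>2 + 2 * (a - b)\<^sup>2" for a b :: real
    using zero_le_power2[of "a - 2 * b"] by (simp add: power2_eq_square algebra_simps)
  have "VV \<le> (\<Sum>j<p. 2 * (of_int (z j))\<^sup>2 + 2 * (e j)\<^sup>2)"
  proof (unfold VV_def, rule sum_mono)
    fix j show "(v j)\<^sup>2 \<le> 2 * (of_int (z j))\<^sup>2 + 2 * (e j)\<^sup>2"
      using par[of "v j" "of_int (z j)"] by (simp add: e_def power2_commute)
  qed
  also have "\<dots> = 2 * ZZ + 2 * (\<Sum>j<p. (e j)\<^sup>2)" by (simp add: sum.distrib ZZ_def sum_distrib_left)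
  finally have ZZ: "VV \<le> 2 * ZZ + 2 * m" using esq by linarith
  have VV: "(real M)\<^sup>2 \<le> m * VV"
    using square_sum_abs_le[of p v m] sparse unfolding supp_v v1 VV_def by simp
  have "(\<Sum>i<n. (lin p (\<lambda>j. of_int (z j)) (X i))\<^sup>2) \<le> (\<Sum>i<n. 2 * (lin p v (X i))\<^sup>2 + 2 * (lin p e (X i))\<^sup>2)"
  proof (rule sum_mono)
    fix i
    have "lin p e (X i) = lin p (\<lambda>j. of_int (z j)) (X i) - lin p v (X i)"
      by (simp add: lin_def e_def sum_subtractf algebra_simps)
    then show "(lin p (\<lambda>j. of_int (z j)) (X i))\<^sup>2 \<le> 2 * (lin p v (X i))\<^sup>2 + 2 * (lin p e (X i))\<^sup>2"
      using par[of "lin p (\<lambda>j. of_int (z j)) (X i)" "lin p v (X i)"] by simp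
  qed
  also have "\<dots> = 2 * XV + 2 * (\<Sum>i<n. (lin p e (X i))\<^sup>2)" by (simp add: sum.distrib XV_def sum_distrib_left)
  also have "(\<Sum>i<n. (lin p e (X i))\<^sup>2) \<le> 4 * real n * (\<Sum>j<p. \<bar>e j\<bar>)\<^sup>2" by (rule sum_square_lin_le[OF col])
  also have "4 * real n * (\<Sum>j<p. \<bar>e j\<bar>)\<^sup>2 \<le> 4 * real n * (real m)\<^sup>2"
    using esum by (intro mult_left_mono power_mono) (auto simp: sum_nonneg)
  finally have "n / 3 * ZZ \<le> 2 * XV + 2 * (4 * real n * (real m)\<^sup>2)"
    using grid[OF zgrid] unfolding ZZ_def by linarith
  then have XV1: "n / 6 * ZZ - 4 * real n * (real m)\<^sup>2 \<le> XV" by simp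
  have "n / 6 * (VV / 2 - m) \<le> n / 6 * ZZ" using ZZ by (intro mult_left_mono) auto
  then have XV2: "n * (VV / 12 - m / 6 - 4 * (real m)\<^sup>2) \<le> XV" using XV1 by (simp add: algebra_simps)
  have "(real M)\<^sup>2 / m \<le> VV" using VV mpos by (simp add: divide_le_eq mult.commute)
  moreover have "real m / 6 + 4 * (real m)\<^sup>2 \<le> (real M)\<^sup>2 / (24 * m)"
  proof -
    have "real m \<le> (real m)\<^sup>2" using m by (simp add: power2_eq_square)
    then have "real m / 6 + 4 * (real m)\<^sup>2 \<le> 5 * (real m)\<^sup>2" using mpos by linarith
    also have "\<dots> = (120 * real m ^ 3) / (24 * m)" using mpos by (simp add: power2_eq_square power3_eq_cube)
    also have "\<dots> \<le> (real M)\<^sup>2 / (24 * m)" using M mpos by (intro divide_right_mono) auto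
    finally show ?thesis .
  qed
  ultimately have "(real M)\<^sup>2 / (24 * m) \<le> VV / 12 - m / 6 - 4 * (real m)\<^sup>2" by (simp add: field_simps)
  then have "n * ((real M)\<^sup>2 / (24 * m)) \<le> XV"
    by (intro order_trans[OF mult_left_mono XV2]) auto
  moreover have "XV \<le> (real M / D)\<^sup>2 * (D * (2 * \<eta>))"
  proof -
    have "lin p v x = real M / D * lin p \<delta> x" for x
      by (simp add: lin_def v_def sum_distrib_left mult.left_commute)
    then have XV: "XV = (real M / D)\<^sup>2 * (\<Sum>i<n. lin p \<delta> (X i) * lin p \<delta> (X i))"
      unfolding XV_def sum_distrib_left by (intro sum.cong refl) (simp add: power2_eq_square)
    have "(\<Sum>i<n. lin p \<delta> (X i) * lin p \<delta> (X i)) = (\<Sum>j<p. \<delta> j * (\<Sum>i<n. X i j * lin p \<delta> (X i)))"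
    proof -
      have "lin p \<delta> x * L = (\<Sum>j<p. \<delta> j * (x j * L))" for x L
        unfolding lin_def sum_distrib_right by (intro sum.cong refl) simp
      then have "(\<Sum>i<n. lin p \<delta> (X i) * lin p \<delta> (X i)) = (\<Sum>i<n. \<Sum>j<p. \<delta> j * (X i j * lin p \<delta> (X i)))"
        by (simp only:)
      also have "\<dots> = (\<Sum>j<p. \<Sum>i<n. \<delta> j * (X i j * lin p \<delta> (X i)))" by (rule sum.swap)
      finally show ?thesis by (simp add: sum_distrib_left)
    qed
    also have "\<dots> \<le> (\<Sum>j<p. \<bar>\<delta> j\<bar> * (2 * \<eta>))"
    proof (rule sum_mono)
      fix j assume "j \<in> {..<p}"
      then have "\<bar>\<delta> j\<bar> * \<bar>\<Sum>i<n. X i j * lin p \<delta> (X i)\<bar> \<le> \<bar>\<delta> j\<bar> * (2 * \<eta>)"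
        using corr by (intro mult_left_mono) auto
      then show "\<delta> j * (\<Sum>i<n. X i j * lin p \<delta> (X i)) \<le> \<bar>\<delta> j\<bar> * (2 * \<eta>)"
        using abs_ge_self[of "\<delta> j * (\<Sum>i<n. X i j * lin p \<delta> (X i))"] unfolding abs_mult by linarith
    qed
    also have "\<dots> = D * (2 * \<eta>)" by (simp add: D_def sum_distrib_right)
    finally show ?thesis unfolding XV by (rule mult_left_mono) simp
  qed
  ultimately have "n * ((real M)\<^sup>2 / (24 * m)) \<le> (real M / D)\<^sup>2 * (D * (2 * \<eta>))" by linarith
  also have "(real M / D)\<^sup>2 * (D * (2 * \<eta>)) = (real M)\<^sup>2 * (2 * \<eta> / D)"
    using D by (simp add: power2_eq_square)
  finally have "(real M)\<^sup>2 * (n / (24 * m)) \<le> (real M)\<^sup>2 * (2 * \<eta> / D)"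
    by (simp add: mult.commute)
  then have "n / (24 * m) \<le> 2 * \<eta> / D"
    by (rule mult_left_le_imp_le) (use Mpos in simp)
  then have "D \<le> 48 * m * \<eta> / n"
    using D mpos n by (simp add: field_simps)
  then show ?thesis by (simp add: D_def)
qed

section \<open>Tail bounds for the design and the noise\<close>

lemma nn_integral_gauss_row_component:
  assumes f: "f \<in> borel_measurable borel" and j: "j \<in> I"
  shows "(\<integral>\<^sup>+x. f (x j) \<partial>gauss_row I) = (\<integral>\<^sup>+t. f t \<partial>gauss 1)"
proof -
  have "gauss 1 = distr (gauss_row I) (gauss 1) (\<lambda>x. x j)"
    unfolding gauss_row_def by (rule distr_PiM_component[symmetric]) (auto simp: j prob_space_gauss)
  then have "(\<integral>\<^sup>+t. f t \<partial>gauss 1) = (\<integral>\<^sup>+t. f t \<partial>distr (gauss_row I) (gauss 1) (\<lambda>x. x j))" by simp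
  also have "\<dots> = (\<integral>\<^sup>+x. f (x j) \<partial>gauss_row I)"
    using f measurable_component_singleton[OF j, of "\<lambda>_. gauss 1"]
    by (intro nn_integral_distr) (auto simp: gauss_row_def cong: measurable_cong_sets)
  finally show ?thesis by simp
qed

lemma chernoff_obs_law:
  fixes h :: "real \<times> (nat \<Rightarrow> real) \<Rightarrow> real"
  assumes \<beta>: "\<beta> \<in> carrier_vec p" and \<sigma>: "0 < \<sigma>"
    and h [measurable]: "h \<in> borel_measurable (borel \<Otimes>\<^sub>M (\<Pi>\<^sub>M j\<in>{..<p}. borel))"
    and K: "0 \<le> K" "(\<integral>\<^sup>+x. \<integral>\<^sup>+e. ennreal (exp (h (lin p (($) \<beta>) x + e, x))) \<partial>gauss \<sigma> \<partial>gauss_row {..<p}) \<le> ennreal K"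
  shows "measure (obs_law n p (\<beta>, 1\<^sub>m p, \<sigma>)) {z \<in> space (obs_space n p). a \<le> (\<Sum>i<n. h (z i))} \<le> exp (- a) * K ^ n"
proof -
  let ?P = "obs_law n p (\<beta>, 1\<^sub>m p, \<sigma>)" and ?A = "{z \<in> space (obs_space n p). a \<le> (\<Sum>i<n. h (z i))}"
  interpret prob_space ?P by (rule prob_space_obs_law[OF \<beta> \<sigma>])
  have A: "?A \<in> sets ?P" unfolding sets_obs_law unfolding obs_space_def by measurable
  have prod_meas: "(\<lambda>z. \<Prod>i<n. ennreal (exp (h (z i)))) \<in> borel_measurable ?P"
    unfolding measurable_cong_sets[OF sets_obs_law refl] obs_space_def by measurable
  have "emeasure ?P ?A = (\<integral>\<^sup>+z. indicator ?A z \<partial>?P)" using A by simp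
  also have "\<dots> \<le> (\<integral>\<^sup>+z. ennreal (exp (- a)) * (\<Prod>i<n. ennreal (exp (h (z i)))) \<partial>?P)"
  proof (rule nn_integral_mono)
    fix z
    have "indicator ?A z \<le> ennreal (exp (- a) * exp (\<Sum>i<n. h (z i)))"
      by (auto simp: indicator_def exp_add[symmetric])
    then show "indicator ?A z \<le> ennreal (exp (- a)) * (\<Prod>i<n. ennreal (exp (h (z i))))"
      by (simp add: prod_ennreal exp_sum ennreal_mult')
  qed
  also have "\<dots> = ennreal (exp (- a)) *
      (\<integral>\<^sup>+x. \<integral>\<^sup>+e. ennreal (exp (h (lin p (($) \<beta>) x + e, x))) \<partial>gauss \<sigma> \<partial>gauss_row {..<p}) ^ n"
    using prod_meas by (subst nn_integral_cmult) (simp_all add: nn_integral_obs_law_prod[OF \<beta> \<sigma>, of "\<lambda>z. ennreal (exp (h z))"])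
  also have "\<dots> \<le> ennreal (exp (- a)) * ennreal K ^ n"
    using K by (intro mult_left_mono power_mono) auto
  finally show ?thesis using K by (simp add: emeasure_eq_measure ennreal_power ennreal_mult'[symmetric])
qed

text \<open>The inner product of column \<open>j\<close> of the design with the residual of \<open>w\<close>.\<close>

definition col_corr :: "nat \<Rightarrow> nat \<Rightarrow> (nat \<Rightarrow> real) \<Rightarrow> nat \<Rightarrow> obs \<Rightarrow> real" where
  "col_corr n p w j z = (\<Sum>i<n. snd (z i) j * (fst (z i) - lin p w (snd (z i))))"

text \<open>Given the design entry \<open>x\<close>, the exponential moment of \<open>s r x e\<close> in the noise \<open>e\<close> is \<open>exp (a x\<^sup>2 / 2)\<close>
  with \<open>a = s\<^sup>2 \<sigma>\<^sup>2\<close>, and averaging over \<open>x\<close> gives \<open>1 / sqrt (1 - a) \<le> exp a\<close>.\<close>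

lemma noise_tail:
  assumes \<beta>: "\<beta> \<in> carrier_vec p" and \<sigma>: "0 < \<sigma>" and j: "j < p" and r: "\<bar>r\<bar> = 1" and s: "0 < s" "2 * (s\<^sup>2 * \<sigma>\<^sup>2) \<le> 1"
  shows "measure (obs_law n p (\<beta>, 1\<^sub>m p, \<sigma>)) {z \<in> space (obs_space n p). t \<le> r * col_corr n p (($) \<beta>) j z}
    \<le> exp (n * (s\<^sup>2 * \<sigma>\<^sup>2) - s * t)"
proof -
  define a where "a = s\<^sup>2 * \<sigma>\<^sup>2"
  have a0: "0 \<le> a" "a \<le> 1 / 2" using s by (auto simp: a_def)
  define h where "h z = s * r * (snd z j * (fst z - lin p (($) \<beta>) (snd z)))" for z :: "real \<times> (nat \<Rightarrow> real)"
  have r2: "r\<^sup>2 = 1" using r by (metis one_power2 power2_abs)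
  have jp: "j \<in> {..<p}" using j by simp
  have hm [measurable]: "h \<in> borel_measurable (borel \<Otimes>\<^sub>M (\<Pi>\<^sub>M j\<in>{..<p}. borel))"
    unfolding h_def using jp by measurable
  have "(\<integral>\<^sup>+x. \<integral>\<^sup>+e. ennreal (exp (h (lin p (($) \<beta>) x + e, x))) \<partial>gauss \<sigma> \<partial>gauss_row {..<p})
      = (\<integral>\<^sup>+x. \<integral>\<^sup>+e. ennreal (exp ((s * r * x j) * e)) \<partial>gauss \<sigma> \<partial>gauss_row {..<p})"
    by (simp add: h_def mult.assoc)
  also have "\<dots> = (\<integral>\<^sup>+x. ennreal (exp (a * (x j)\<^sup>2 / 2)) \<partial>gauss_row {..<p})"
    unfolding gauss_exp_linear[OF \<sigma>] by (simp add: a_def power_mult_distrib r2 ac_simps)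
  also have "\<dots> = (\<integral>\<^sup>+t. ennreal (exp (a * t\<^sup>2 / 2)) \<partial>gauss 1)"
    by (rule nn_integral_gauss_row_component[OF _ jp]) measurable
  also have "\<dots> = ennreal (1 / sqrt (1 - a))" using a0 by (intro gauss_exp_square) linarith
  also have "\<dots> \<le> ennreal (exp a)"
  proof (rule ennreal_leI)
    have "- a - 2 * a\<^sup>2 \<le> ln (1 - a)" using a0 by (intro ln_one_minus_pos_lower_bound)
    moreover have "2 * a\<^sup>2 \<le> a" using mult_nonneg_nonneg[of a "1 - 2 * a"] a0 by (simp add: algebra_simps power2_eq_square)
    ultimately have "- (2 * a) \<le> ln (1 - a)" by linarith
    then have "exp (- (2 * a)) \<le> 1 - a" using a0 by (subst (asm) ln_ge_iff) auto
    then have "sqrt (exp (- (2 * a))) \<le> sqrt (1 - a)" by simp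
    moreover have "sqrt (exp (- (2 * a))) = exp (- a)"
      by (rule real_sqrt_unique) (simp_all add: power2_eq_square exp_add[symmetric])
    ultimately have "exp (- a) \<le> sqrt (1 - a)" by simp
    moreover have "0 < sqrt (1 - a)" using a0 by simp
    ultimately show "1 / sqrt (1 - a) \<le> exp a" by (simp add: exp_minus field_simps)
  qed
  finally have "measure (obs_law n p (\<beta>, 1\<^sub>m p, \<sigma>)) {z \<in> space (obs_space n p). s * t \<le> (\<Sum>i<n. h (z i))}
      \<le> exp (- (s * t)) * exp a ^ n"
    by (intro chernoff_obs_law[OF \<beta> \<sigma> hm]) auto
  moreover have "(\<Sum>i<n. h (z i)) = s * (r * col_corr n p (($) \<beta>) j z)" for z
    by (simp add: h_def col_corr_def sum_distrib_left mult.assoc)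
  moreover have "s * t \<le> s * b \<longleftrightarrow> t \<le> b" for b using s by simp
  ultimately show ?thesis
    by (simp add: a_def exp_of_nat_mult[symmetric] exp_add[symmetric])
qed

lemma column_tail:
  assumes \<beta>: "\<beta> \<in> carrier_vec p" and \<sigma>: "0 < \<sigma>" and j: "j < p"
  shows "measure (obs_law n p (\<beta>, 1\<^sub>m p, \<sigma>)) {z \<in> space (obs_space n p). 4 * real n \<le> (\<Sum>i<n. (snd (z i) j)\<^sup>2)}
    \<le> exp (- real n / 2)"
proof -
  have jp: "j \<in> {..<p}" using j by simp
  let ?h = "\<lambda>z :: real \<times> (nat \<Rightarrow> real). (1 / 2) * (snd z j)\<^sup>2 / 2"
  have hm: "?h \<in> borel_measurable (borel \<Otimes>\<^sub>M (\<Pi>\<^sub>M j\<in>{..<p}. borel))" using jp by measurable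
  have "(\<integral>\<^sup>+x. \<integral>\<^sup>+e. ennreal (exp (?h (lin p (($) \<beta>) x + e, x))) \<partial>gauss \<sigma> \<partial>gauss_row {..<p})
     = (\<integral>\<^sup>+x. ennreal (exp ((1 / 2) * (x j)\<^sup>2 / 2)) \<partial>gauss_row {..<p})"
    using prob_space.emeasure_space_1[OF prob_space_gauss[OF \<sigma>]] by simp
  also have "\<dots> = (\<integral>\<^sup>+t. ennreal (exp ((1 / 2) * t\<^sup>2 / 2)) \<partial>gauss 1)"
    by (rule nn_integral_gauss_row_component[OF _ jp]) measurable
  also have "\<dots> = ennreal (1 / sqrt (1 - 1 / 2))" by (rule gauss_exp_square) simp
  also have "\<dots> \<le> ennreal (exp (1 / 2))"
  proof (rule ennreal_leI)
    have "sqrt 2 \<le> exp (1 / 2)"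
    proof (rule real_le_lsqrt)
      show "2 \<le> (exp (1 / 2) :: real)\<^sup>2"
        using exp_ge_add_one_self[of 1] by (simp add: power2_eq_square exp_add[symmetric])
    qed simp_all
    then show "1 / sqrt (1 - 1 / 2) \<le> exp (1 / 2 :: real)" by (simp add: real_sqrt_divide)
  qed
  finally have "measure (obs_law n p (\<beta>, 1\<^sub>m p, \<sigma>)) {z \<in> space (obs_space n p). real n \<le> (\<Sum>i<n. ?h (z i))}
      \<le> exp (- real n) * exp (1 / 2) ^ n"
    by (intro chernoff_obs_law[OF \<beta> \<sigma> hm]) auto
  moreover have "real n \<le> (\<Sum>i<n. ?h (z i)) \<longleftrightarrow> 4 * real n \<le> (\<Sum>i<n. (snd (z i) j)\<^sup>2)" for z :: obs
    by (simp add: sum_divide_distrib[symmetric] field_simps)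
  ultimately show ?thesis by (simp add: exp_of_nat_mult[symmetric] exp_add[symmetric])
qed

text \<open>Chernoff's bound with the exponent \<open>- (lin p v x)\<^sup>2 / (2 \<tau>\<^sup>2)\<close>, \<open>\<tau> = \<parallel>v\<parallel>\<close>. Its exponential is a multiple of
  a normal density at \<open>0\<close>, so \<open>gauss_row_convolution\<close> gives the moment \<open>1 / sqrt 2\<close>, and
  \<open>ln 2 / 2 \<ge> 1/3\<close> exceeds the loss \<open>1/6\<close> caused by the threshold.\<close>

lemma direction_tail:
  assumes \<beta>: "\<beta> \<in> carrier_vec p" and \<sigma>: "0 < \<sigma>" and v: "0 < (\<Sum>j<p. (v j)\<^sup>2)"
  shows "measure (obs_law n p (\<beta>, 1\<^sub>m p, \<sigma>))
      {z \<in> space (obs_space n p). (\<Sum>i<n. (lin p v (snd (z i)))\<^sup>2) \<le> real n / 3 * (\<Sum>j<p. (v j)\<^sup>2)}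
    \<le> exp (- real n / 6)"
proof -
  define \<tau> where "\<tau> = sqrt (\<Sum>j<p. (v j)\<^sup>2)"
  have \<tau>: "0 < \<tau>" "\<tau>\<^sup>2 = (\<Sum>j<p. (v j)\<^sup>2)" using v by (auto simp: \<tau>_def)
  define h where "h z = - (lin p v (snd z))\<^sup>2 / (2 * \<tau>\<^sup>2)" for z :: "real \<times> (nat \<Rightarrow> real)"
  have hm [measurable]: "h \<in> borel_measurable (borel \<Otimes>\<^sub>M (\<Pi>\<^sub>M j\<in>{..<p}. borel))"
    unfolding h_def by measurable
  have "(\<integral>\<^sup>+x. \<integral>\<^sup>+e. ennreal (exp (h (lin p (($) \<beta>) x + e, x))) \<partial>gauss \<sigma> \<partial>gauss_row {..<p})
     = (\<integral>\<^sup>+x. ennreal (sqrt (2 * pi) * \<tau>) * ennreal (normal_density 0 \<tau> (0 - (\<Sum>j<p. x j * v j))) \<partial>gauss_row {..<p})"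
    using prob_space.emeasure_space_1[OF prob_space_gauss[OF \<sigma>]] \<tau>(1)
    by (simp add: h_def ennreal_mult'[symmetric] normal_density_def real_sqrt_mult lin_def)
  also have "\<dots> = ennreal (sqrt (2 * pi) * \<tau>) * ennreal (normal_density 0 (sqrt (\<tau>\<^sup>2 + (\<Sum>j<p. (v j)\<^sup>2))) 0)"
    using \<tau>(1) by (subst nn_integral_cmult, measurable) (simp only: gauss_row_convolution finite_lessThan)
  also have "\<dots> = ennreal (1 / sqrt 2)"
    using \<tau>(1) unfolding \<tau>(2)[symmetric]
    by (simp add: ennreal_mult'[symmetric] normal_density_def real_sqrt_mult)
  also have "\<dots> \<le> ennreal (exp (- 1 / 3))"
  proof (rule ennreal_leI)
    have "1 / sqrt 2 = exp (- (ln 2 / 2))"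
      using ln_sqrt[of 2] by (simp add: exp_minus inverse_eq_divide flip: ln_sqrt)
    also have "\<dots> \<le> exp (- 1 / 3)" using ln2_ge_two_thirds by simp
    finally show "1 / sqrt 2 \<le> exp (- 1 / 3 :: real)" .
  qed
  finally have "measure (obs_law n p (\<beta>, 1\<^sub>m p, \<sigma>)) {z \<in> space (obs_space n p). - real n / 6 \<le> (\<Sum>i<n. h (z i))}
      \<le> exp (- (- real n / 6)) * exp (- 1 / 3) ^ n"
    by (intro chernoff_obs_law[OF \<beta> \<sigma> hm]) auto
  moreover have "- real n / 6 \<le> (\<Sum>i<n. h (z i)) \<longleftrightarrow> (\<Sum>i<n. (lin p v (snd (z i)))\<^sup>2) \<le> real n / 3 * (\<Sum>j<p. (v j)\<^sup>2)" for z :: obs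
  proof -
    have "(\<Sum>i<n. h (z i)) = - (\<Sum>i<n. (lin p v (snd (z i)))\<^sup>2) / (2 * \<tau>\<^sup>2)"
      by (simp add: h_def sum_negf sum_divide_distrib)
    then show ?thesis unfolding \<tau>(2)[symmetric] using \<tau>(1) by (simp only:) (simp add: field_simps)
  qed
  ultimately show ?thesis by (simp add: exp_of_nat_mult[symmetric] exp_add[symmetric])
qed

section \<open>A fixed-length interval\<close>

definition fits :: "nat \<Rightarrow> nat \<Rightarrow> real \<Rightarrow> (nat \<Rightarrow> real) \<Rightarrow> obs \<Rightarrow> bool" where
  "fits n p \<eta> b z \<longleftrightarrow> (\<forall>j<p. \<bar>col_corr n p b j z\<bar> < \<eta>)"

definition rat_sparse :: "nat \<Rightarrow> nat \<Rightarrow> (nat \<Rightarrow> real) set" where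
  "rat_sparse p k = {b \<in> {..<p} \<rightarrow>\<^sub>E \<rat>. card {j. j < p \<and> b j \<noteq> 0} \<le> k}"

text \<open>The first admissible vector in an enumeration of the rational \<open>k\<close>-sparse vectors: a countable
  search makes the choice measurable. If there is none, the index is arbitrary.\<close>

definition estimator :: "nat \<Rightarrow> nat \<Rightarrow> nat \<Rightarrow> real \<Rightarrow> obs \<Rightarrow> nat \<Rightarrow> real" where
  "estimator n p k \<eta> z = from_nat_into (rat_sparse p k)
     (LEAST m. fits n p \<eta> (from_nat_into (rat_sparse p k) m) z)"

lemma entry_measurable:
  assumes "i < n" "j < p" shows "(\<lambda>z. snd (z i) j) \<in> borel_measurable (obs_space n p)"
proof -
  have [measurable]: "(\<lambda>x. x j) \<in> borel_measurable (\<Pi>\<^sub>M j\<in>{..<p}. borel :: real measure)"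
    using assms by (intro measurable_component_singleton) auto
  have [measurable]: "i \<in> {..<n}" using assms by simp
  show ?thesis unfolding obs_space_def by measurable
qed

lemma col_corr_measurable [measurable]:
  assumes j: "j < p" shows "col_corr n p b j \<in> borel_measurable (obs_space n p)"
proof -
  have [measurable]: "(\<lambda>x. x j) \<in> borel_measurable (\<Pi>\<^sub>M j\<in>{..<p}. borel :: real measure)"
    using j by (intro measurable_component_singleton) auto
  show ?thesis unfolding col_corr_def obs_space_def by measurable
qed

lemma fits_measurable [measurable]: "Measurable.pred (obs_space n p) (fits n p \<eta> b)"
proof -
  have "Measurable.pred (obs_space n p) (\<lambda>z. \<forall>j\<in>{..<p}. \<bar>col_corr n p b j z\<bar> < \<eta>)"
    by (rule pred_intros_finite) (auto intro: borel_measurable_pred_less)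
  then show ?thesis by (simp add: fits_def[abs_def])
qed

lemma estimator_measurable: "(\<lambda>z. G (estimator n p k \<eta> z)) \<in> borel_measurable (obs_space n p)"
proof -
  have "(\<lambda>z. LEAST m. fits n p \<eta> (from_nat_into (rat_sparse p k) m) z) \<in> measurable (obs_space n p) (count_space UNIV)"
    by measurable
  then show ?thesis
    unfolding estimator_def by (rule measurable_compose) simp
qed

lemma countable_rat_sparse: "countable (rat_sparse p k)"
proof -
  have "countable ({..<p} \<rightarrow>\<^sub>E (\<rat> :: real set))" by (intro countable_PiE countable_rat) auto
  then show ?thesis unfolding rat_sparse_def by (rule countable_subset[rotated]) auto
qed

text \<open>Rounding down to multiples of \<open>1 / Suc N\<close> keeps zeros, hence sparsity, and \<open>fits\<close> is an open
  condition because its inequality is strict.\<close>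

lemma rat_sparse_fits:
  assumes fit: "fits n p \<eta> w z" and sparse: "card {j. j < p \<and> w j \<noteq> 0} \<le> k"
  shows "\<exists>b\<in>rat_sparse p k. fits n p \<eta> b z"
proof -
  define b where "b N = (\<lambda>j\<in>{..<p}. of_int \<lfloor>w j * real (Suc N)\<rfloor> / real (Suc N))" for N
  have lim: "(\<lambda>N. b N j) \<longlonglongrightarrow> w j" if "j < p" for j
  proof (rule LIMSEQ_I)
    fix r :: real assume "0 < r"
    then obtain N0 where N0: "inverse (real (Suc N0)) < r" using reals_Archimedean by blast
    have "norm (b N j - w j) < r" if "N0 \<le> N" for N
    proof -
      have "\<bar>of_int \<lfloor>w j * real (Suc N)\<rfloor> - w j * real (Suc N)\<bar> \<le> 1"
        by linarith
      then have "\<bar>of_int \<lfloor>w j * real (Suc N)\<rfloor> - w j * real (Suc N)\<bar> / real (Suc N) \<le> 1 / real (Suc N)"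
        by (rule divide_right_mono) simp
      moreover have "b N j - w j = (of_int \<lfloor>w j * real (Suc N)\<rfloor> - w j * real (Suc N)) / real (Suc N)"
        using \<open>j < p\<close> by (simp add: b_def diff_divide_distrib del: of_nat_Suc)
      ultimately have "norm (b N j - w j) \<le> 1 / real (Suc N)"
        by (simp add: abs_divide del: of_nat_Suc)
      also have "\<dots> \<le> inverse (real (Suc N0))" using that by (simp add: inverse_eq_divide frac_le)
      finally show ?thesis using N0 by linarith
    qed
    then show "\<exists>N0. \<forall>N\<ge>N0. norm (b N j - w j) < r" by blast
  qed
  have "(\<lambda>N. col_corr n p (b N) j z) \<longlonglongrightarrow> col_corr n p w j z" for j
    unfolding col_corr_def lin_def by (intro tendsto_intros lim) auto
  then have "eventually (\<lambda>N. \<bar>col_corr n p (b N) j z\<bar> < \<eta>) sequentially" if "j < p" for j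
    using fit that by (intro order_tendstoD(2)[OF tendsto_rabs]) (auto simp: fits_def)
  then have "eventually (\<lambda>N. \<forall>j\<in>{..<p}. \<bar>col_corr n p (b N) j z\<bar> < \<eta>) sequentially"
    by (intro eventually_ball_finite) auto
  then obtain N where N: "fits n p \<eta> (b N) z"
    unfolding fits_def by (auto simp: eventually_sequentially)
  have "b N \<in> {..<p} \<rightarrow>\<^sub>E \<rat>" by (auto simp: b_def)
  moreover have "card {j. j < p \<and> b N j \<noteq> 0} \<le> card {j. j < p \<and> w j \<noteq> 0}"
    by (intro card_mono) (auto simp: b_def)
  ultimately show ?thesis using N sparse by (auto simp: rat_sparse_def)
qed

lemma estimator_spec:
  assumes "fits n p \<eta> w z" "card {j. j < p \<and> w j \<noteq> 0} \<le> k"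
  shows "fits n p \<eta> (estimator n p k \<eta> z) z" "card {j. j < p \<and> estimator n p k \<eta> z j \<noteq> 0} \<le> k"
proof -
  let ?B = "rat_sparse p k"
  obtain b where b: "b \<in> ?B" "fits n p \<eta> b z" using rat_sparse_fits[OF assms] by blast
  then have "fits n p \<eta> (from_nat_into ?B (to_nat_on ?B b)) z"
    using countable_rat_sparse by simp
  then show "fits n p \<eta> (estimator n p k \<eta> z) z" unfolding estimator_def by (rule LeastI)
  have "estimator n p k \<eta> z \<in> ?B" unfolding estimator_def using b by (intro from_nat_into) auto
  then show "card {j. j < p \<and> estimator n p k \<eta> z j \<noteq> 0} \<le> k" by (simp add: rat_sparse_def)
qed

lemma abs_index_le_linf_norm: "j < dim_vec \<xi> \<Longrightarrow> \<bar>\<xi> $ j\<bar> \<le> linf_norm \<xi>"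
  unfolding linf_norm_def by (intro Max_ge) auto

lemma linf_norm_nonneg: "0 < dim_vec \<xi> \<Longrightarrow> 0 \<le> linf_norm \<xi>"
  using abs_index_le_linf_norm[of 0 \<xi>] by linarith

definition good_obs :: "nat \<Rightarrow> nat \<Rightarrow> nat \<Rightarrow> real \<Rightarrow> (nat \<Rightarrow> real) \<Rightarrow> obs set" where
  "good_obs n p k \<eta> w = {z \<in> space (obs_space n p). fits n p \<eta> w z
     \<and> (\<forall>j<p. (\<Sum>i<n. (snd (z i) j)\<^sup>2) \<le> 4 * real n)
     \<and> (\<forall>g\<in>sparse_grid p (2 * k) (p\<^sup>2).
         real n / 3 * (\<Sum>j<p. (of_int (g j))\<^sup>2) \<le> (\<Sum>i<n. (lin p (\<lambda>j. of_int (g j)) (snd (z i)))\<^sup>2))}"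

text \<open>Both \<open>w\<close> and the estimate fit, so their difference is \<open>2 * k\<close>-sparse and the columns have inner product
  at most \<open>2 * \<eta>\<close> with its image. The grid size \<open>p\<^sup>2\<close> suffices since \<open>120 (2k)\<^sup>3 = 960 k\<^sup>3 \<le> p\<^sup>4\<close>.\<close>

lemma estimator_error:
  assumes z: "z \<in> good_obs n p k \<eta> w" and sparse: "card {j. j < p \<and> w j \<noteq> 0} \<le> k"
    and k: "1 \<le> k" "k \<le> p" and p: "960 \<le> p" and n: "0 < n"
  shows "(\<Sum>j<p. \<bar>estimator n p k \<eta> z j - w j\<bar>) \<le> 96 * k * \<eta> / n"
proof -
  let ?b = "estimator n p k \<eta> z"
  have fit: "fits n p \<eta> w z" using z by (simp add: good_obs_def)
  note spec = estimator_spec[OF fit sparse]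
  have "(\<Sum>j<p. \<bar>?b j - w j\<bar>) \<le> 48 * real (2 * k) * \<eta> / n"
  proof (rule l1_error_bound[where X = "\<lambda>i. snd (z i)" and M = "p\<^sup>2"])
    have "{j. j < p \<and> ?b j - w j \<noteq> 0} \<subseteq> {j. j < p \<and> ?b j \<noteq> 0} \<union> {j. j < p \<and> w j \<noteq> 0}" by auto
    then have "card {j. j < p \<and> ?b j - w j \<noteq> 0} \<le> card ({j. j < p \<and> ?b j \<noteq> 0} \<union> {j. j < p \<and> w j \<noteq> 0})"
      by (intro card_mono) auto
    also have "\<dots> \<le> card {j. j < p \<and> ?b j \<noteq> 0} + card {j. j < p \<and> w j \<noteq> 0}" by (rule card_Un_le)
    finally show "card {j. j < p \<and> ?b j - w j \<noteq> 0} \<le> 2 * k" using spec(2) sparse by linarith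
    have "120 * real (2 * k) ^ 3 = 960 * real k ^ 3" by (simp add: power_mult_distrib)
    also have "\<dots> \<le> real p * real p ^ 3" using k p by (intro mult_mono power_mono) auto
    also have "\<dots> = (real (p\<^sup>2))\<^sup>2" by (simp add: power2_eq_square power3_eq_cube)
    finally show "120 * real (2 * k) ^ 3 \<le> (real (p\<^sup>2))\<^sup>2" .
    show "\<bar>\<Sum>i<n. snd (z i) j * lin p (\<lambda>j. ?b j - w j) (snd (z i))\<bar> \<le> 2 * \<eta>" if j: "j < p" for j
    proof -
      have "lin p (\<lambda>j. ?b j - w j) x = lin p ?b x - lin p w x" for x
        by (simp add: lin_def right_diff_distrib sum_subtractf)
      then have "(\<Sum>i<n. snd (z i) j * lin p (\<lambda>j. ?b j - w j) (snd (z i))) = col_corr n p w j z - col_corr n p ?b j z"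
        by (simp add: col_corr_def right_diff_distrib sum_subtractf)
      moreover have "\<bar>col_corr n p w j z\<bar> < \<eta>" "\<bar>col_corr n p ?b j z\<bar> < \<eta>"
        using fit spec(1) j by (auto simp: fits_def)
      ultimately show ?thesis by linarith
    qed
  qed (use z k p n in \<open>auto simp: good_obs_def\<close>)
  then show ?thesis by simp
qed

lemma good_obs_measurable: "good_obs n p k \<eta> w \<in> sets (obs_space n p)"
proof (cases "p = 0")
  case True
  then have "good_obs n p k \<eta> w = space (obs_space n p)"
    by (auto simp: good_obs_def fits_def lin_def)
  then show ?thesis by simp
next
  case False
  have fin: "finite (sparse_grid p (2 * k) (p\<^sup>2))" using False by (intro sparse_grid_finite_card) auto
  have 1: "Measurable.pred (obs_space n p) (\<lambda>z. \<forall>j\<in>{..<p}. (\<Sum>i<n. (snd (z i) j)\<^sup>2) \<le> 4 * real n)"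
  proof (rule pred_intros_finite, simp)
    fix j assume "j \<in> {..<p}"
    then have [measurable]: "(\<lambda>z. snd (z i) j) \<in> borel_measurable (obs_space n p)" if "i < n" for i
      using entry_measurable that by simp
    show "Measurable.pred (obs_space n p) (\<lambda>z. (\<Sum>i<n. (snd (z i) j)\<^sup>2) \<le> 4 * real n)" by measurable
  qed
  have 2: "Measurable.pred (obs_space n p) (\<lambda>z. \<forall>g\<in>sparse_grid p (2 * k) (p\<^sup>2).
         real n / 3 * (\<Sum>j<p. (of_int (g j))\<^sup>2) \<le> (\<Sum>i<n. (lin p (\<lambda>j. of_int (g j)) (snd (z i)))\<^sup>2))"
    by (rule pred_intros_finite[OF fin], unfold obs_space_def, measurable)
  have "good_obs n p k \<eta> w = {z \<in> space (obs_space n p). fits n p \<eta> w z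
     \<and> (\<forall>j\<in>{..<p}. (\<Sum>i<n. (snd (z i) j)\<^sup>2) \<le> 4 * real n)
     \<and> (\<forall>g\<in>sparse_grid p (2 * k) (p\<^sup>2).
         real n / 3 * (\<Sum>j<p. (of_int (g j))\<^sup>2) \<le> (\<Sum>i<n. (lin p (\<lambda>j. of_int (g j)) (snd (z i)))\<^sup>2))}"
    by (auto simp: good_obs_def)
  also have "\<dots> \<in> sets (obs_space n p)"
    by (intro predE pred_intros_logic fits_measurable 1 2)
  finally show ?thesis .
qed

text \<open>A union bound. The Chernoff parameter \<open>s\<close> makes \<open>s\<^sup>2 \<sigma>\<^sup>2 = 4 ln p / n\<close> and \<open>s \<eta> = 8 ln p\<close>, so each of the
  \<open>2 p\<close> noise events has probability at most \<open>p\<^sup>-\<^sup>4\<close>.\<close>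

lemma good_obs_probability:
  assumes \<beta>: "\<beta> \<in> carrier_vec p" and \<sigma>: "0 < \<sigma>" and p: "2 \<le> p" and n: "8 * ln p \<le> n"
  defines "\<eta> \<equiv> 4 * \<sigma> * sqrt (n * ln p)"
  shows "1 - (2 / real p ^ 3 + p * exp (- real n / 2) + real (p * (2 * p\<^sup>2 + 1)) ^ (2 * k) * exp (- real n / 6))
    \<le> measure (obs_law n p (\<beta>, 1\<^sub>m p, \<sigma>)) (good_obs n p k \<eta> (($) \<beta>))"
proof -
  let ?P = "obs_law n p (\<beta>, 1\<^sub>m p, \<sigma>)" and ?S = "space (obs_space n p)"
  interpret prob_space ?P by (rule prob_space_obs_law[OF \<beta> \<sigma>])
  define L where "L = ln (real p)"
  have L: "0 < L" using p by (simp add: L_def)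
  have n0: "0 < real n" using n L by (simp add: L_def)
  define s where "s = 2 * sqrt (L / n) / \<sigma>"
  have s: "0 < s" using L n0 \<sigma> by (simp add: s_def)
  have s2: "s\<^sup>2 * \<sigma>\<^sup>2 = 4 * L / n" using L n0 \<sigma> by (simp add: s_def power_mult_distrib power_divide)
  have s\<eta>: "s * \<eta> = 8 * L"
  proof -
    have "sqrt (L / n) * sqrt (n * L) = L"
      using L n0 by (simp add: real_sqrt_mult[symmetric])
    then show ?thesis using \<sigma> by (simp add: s_def \<eta>_def L_def[symmetric])
  qed
  define A where "A r j = {z \<in> ?S. \<eta> \<le> r * col_corr n p (($) \<beta>) j z}" for r j
  define C where "C j = {z \<in> ?S. 4 * real n \<le> (\<Sum>i<n. (snd (z i) j)\<^sup>2)}" for j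
  define V where "V = {g \<in> sparse_grid p (2 * k) (p\<^sup>2). 0 < (\<Sum>j<p. (of_int (g j) :: real)\<^sup>2)}"
  define D where "D g = {z \<in> ?S. (\<Sum>i<n. (lin p (\<lambda>j. of_int (g j)) (snd (z i)))\<^sup>2) \<le> real n / 3 * (\<Sum>j<p. (of_int (g j))\<^sup>2)}"
    for g :: "nat \<Rightarrow> int"
  have Am: "A r j \<in> sets ?P" if "j < p" for r j
    unfolding sets_obs_law A_def using that by measurable
  have Cm: "C j \<in> sets ?P" if "j < p" for j
  proof -
    have [measurable]: "(\<lambda>z. snd (z i) j) \<in> borel_measurable (obs_space n p)" if "i < n" for i
      using entry_measurable \<open>j < p\<close> that by simp
    show ?thesis unfolding sets_obs_law C_def by measurable
  qed
  have Dm: "D g \<in> sets ?P" for g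
    unfolding sets_obs_law D_def unfolding obs_space_def by measurable
  have PA: "prob (A r j) \<le> 1 / real p ^ 4" if "j < p" "\<bar>r\<bar> = 1" for r j
  proof -
    have "prob (A r j) \<le> exp (n * (s\<^sup>2 * \<sigma>\<^sup>2) - s * \<eta>)"
      unfolding A_def by (rule noise_tail[OF \<beta> \<sigma> that s])
        (unfold s2, use n n0 in \<open>simp add: L_def field_simps\<close>)
    also have "n * (s\<^sup>2 * \<sigma>\<^sup>2) - s * \<eta> = - (4 * L)" unfolding s2 s\<eta> using n0 by simp
    also have "exp (- (4 * L)) = 1 / real p ^ 4"
      using p exp_of_nat_mult[of 4 L] by (simp add: L_def exp_minus inverse_eq_divide)
    finally show ?thesis .
  qed
  have PC: "prob (C j) \<le> exp (- real n / 2)" if "j < p" for j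
    unfolding C_def by (rule column_tail[OF \<beta> \<sigma> that])
  have PD: "prob (D g) \<le> exp (- real n / 6)" if "g \<in> V" for g
    unfolding D_def using that by (intro direction_tail[OF \<beta> \<sigma>]) (simp add: V_def)
  have V: "finite V" "card V \<le> (p * (2 * p\<^sup>2 + 1)) ^ (2 * k)"
  proof -
    have fin: "finite (sparse_grid p (2 * k) (p\<^sup>2))" and card: "card (sparse_grid p (2 * k) (p\<^sup>2)) \<le> (p * (2 * p\<^sup>2 + 1)) ^ (2 * k)"
      using p by (auto intro: sparse_grid_finite_card(1) order_trans[OF sparse_grid_finite_card(2)])
    have sub: "V \<subseteq> sparse_grid p (2 * k) (p\<^sup>2)" by (auto simp: V_def)
    show "finite V" by (rule finite_subset[OF sub fin])
    show "card V \<le> (p * (2 * p\<^sup>2 + 1)) ^ (2 * k)" using card_mono[OF fin sub] card by linarith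
  qed
  let ?bad = "(\<Union>j<p. A 1 j) \<union> (\<Union>j<p. A (- 1) j) \<union> (\<Union>j<p. C j) \<union> (\<Union>g\<in>V. D g)"
  have badm: "?bad \<in> sets ?P" using Am Cm Dm V by (intro sets.Un sets.finite_UN) auto
  have "?S - ?bad \<subseteq> good_obs n p k \<eta> (($) \<beta>)"
  proof
    fix z assume z: "z \<in> ?S - ?bad"
    have "\<bar>col_corr n p (($) \<beta>) j z\<bar> < \<eta>" if "j < p" for j
      using z that by (fastforce simp: A_def abs_less_iff not_le)
    moreover have "(\<Sum>i<n. (snd (z i) j)\<^sup>2) \<le> 4 * real n" if "j < p" for j
    proof -
      have "z \<notin> C j" using z that by blast
      then show ?thesis using z unfolding C_def by (simp add: not_le less_imp_le)
    qed
    moreover have "real n / 3 * (\<Sum>j<p. (of_int (g j))\<^sup>2) \<le> (\<Sum>i<n. (lin p (\<lambda>j. of_int (g j)) (snd (z i)))\<^sup>2)"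
      if g: "g \<in> sparse_grid p (2 * k) (p\<^sup>2)" for g
    proof (cases "g \<in> V")
      case True
      then have "z \<notin> D g" using z by blast
      then show ?thesis using z unfolding D_def by auto
    next
      case False
      then have "\<not> 0 < (\<Sum>j<p. (of_int (g j) :: real)\<^sup>2)" using g unfolding V_def by blast
      moreover have "0 \<le> (\<Sum>j<p. (of_int (g j) :: real)\<^sup>2)" by (intro sum_nonneg) simp
      ultimately have "(\<Sum>j<p. (of_int (g j) :: real)\<^sup>2) = 0" by linarith
      then show ?thesis by (simp only: mult_zero_right) (simp add: sum_nonneg)
    qed
    ultimately show "z \<in> good_obs n p k \<eta> (($) \<beta>)" using z by (auto simp: good_obs_def fits_def)
  qed
  then have "prob (?S - ?bad) \<le> prob (good_obs n p k \<eta> (($) \<beta>))"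
    using good_obs_measurable by (intro finite_measure_mono) auto
  moreover have "prob (?S - ?bad) = 1 - prob ?bad" using prob_compl[OF badm] by simp
  moreover have "prob ?bad \<le> 2 / real p ^ 3 + p * exp (- real n / 2) + real (p * (2 * p\<^sup>2 + 1)) ^ (2 * k) * exp (- real n / 6)"
  proof -
    have UA: "prob (\<Union>j<p. A r j) \<le> 1 / real p ^ 3" if "\<bar>r\<bar> = 1" for r
    proof -
      have "prob (\<Union>j<p. A r j) \<le> (\<Sum>j<p. prob (A r j))"
        using Am by (intro finite_measure_subadditive_finite) auto
      also have "\<dots> \<le> (\<Sum>j<p. 1 / real p ^ 4)" using PA that by (intro sum_mono) auto
      also have "\<dots> = 1 / real p ^ 3" using p by (simp add: field_simps power_numeral_reduce)
      finally show ?thesis .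
    qed
    have UC: "prob (\<Union>j<p. C j) \<le> p * exp (- real n / 2)"
    proof -
      have "prob (\<Union>j<p. C j) \<le> (\<Sum>j<p. prob (C j))"
        using Cm by (intro finite_measure_subadditive_finite) auto
      also have "\<dots> \<le> (\<Sum>j<p. exp (- real n / 2))" using PC by (intro sum_mono) auto
      finally show ?thesis by simp
    qed
    have UD: "prob (\<Union>g\<in>V. D g) \<le> real (p * (2 * p\<^sup>2 + 1)) ^ (2 * k) * exp (- real n / 6)"
    proof -
      have "prob (\<Union>g\<in>V. D g) \<le> (\<Sum>g\<in>V. prob (D g))"
        using Dm V by (intro finite_measure_subadditive_finite) auto
      also have "\<dots> \<le> (\<Sum>g\<in>V. exp (- real n / 6))" using PD by (intro sum_mono) auto
      also have "\<dots> \<le> real ((p * (2 * p\<^sup>2 + 1)) ^ (2 * k)) * exp (- real n / 6)"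
        using V(2) by (simp only: sum_constant) (intro mult_right_mono of_nat_mono, auto)
      finally show ?thesis by simp
    qed
    have m: "(\<Union>j<p. A r j) \<in> sets ?P" "(\<Union>j<p. C j) \<in> sets ?P" "(\<Union>g\<in>V. D g) \<in> sets ?P" for r
      using Am Cm Dm V by (auto intro!: sets.finite_UN)
    have "prob ?bad \<le> prob (\<Union>j<p. A 1 j) + prob (\<Union>j<p. A (- 1) j) + prob (\<Union>j<p. C j) + prob (\<Union>g\<in>V. D g)"
      by (intro order_trans[OF measure_Un_le] add_mono order_refl sets.Un m)
    then show ?thesis using UA[of 1] UA[of "- 1"] UC UD by simp
  qed
  ultimately show ?thesis by linarith
qed

lemma minimax_length_upper:
  fixes \<xi> :: "real vec"
  assumes \<xi>: "\<xi> \<in> carrier_vec p" and \<sigma>: "0 < \<sigma>" and k: "1 \<le> k" "k \<le> p" and p: "960 \<le> p" and n: "8 * ln p \<le> n"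
    and tail: "2 / real p ^ 3 + p * exp (- real n / 2) + real (p * (2 * p\<^sup>2 + 1)) ^ (2 * k) * exp (- real n / 6) \<le> \<alpha>"
  shows "minimax_length n p \<alpha> (param_space p k (1\<^sub>m p) \<sigma>) (\<lambda>\<beta>. \<xi> \<bullet> \<beta>)
    \<le> ennreal (768 * \<sigma> * linf_norm \<xi> * k * sqrt (ln p / n))"
proof -
  let ?\<Theta> = "param_space p k (1\<^sub>m p) \<sigma>" and ?T = "\<lambda>\<beta>. \<xi> \<bullet> \<beta>"
  define L where "L = ln (real p)"
  have L: "0 < L" using p by (simp add: L_def)
  have n0: "0 < real n" using n L by (simp add: L_def)
  define \<eta> where "\<eta> = 4 * \<sigma> * sqrt (n * L)"
  define r where "r = linf_norm \<xi> * (96 * real k * \<eta> / n)"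
  have r: "2 * r = 768 * \<sigma> * linf_norm \<xi> * k * sqrt (L / n)"
  proof -
    have "sqrt (n * L) / n = sqrt (L / n)"
      using n0 by (simp add: real_sqrt_mult real_sqrt_divide field_simps)
    moreover have "\<eta> / n = 4 * \<sigma> * (sqrt (n * L) / n)" by (simp add: \<eta>_def)
    ultimately have "\<eta> / n = 4 * \<sigma> * sqrt (L / n)" by (simp only:)
    then have "96 * real k * \<eta> / n = 96 * real k * (4 * \<sigma> * sqrt (L / n))" by (simp only: times_divide_eq_right[symmetric])
    then show ?thesis by (simp add: r_def)
  qed
  have linf: "0 \<le> linf_norm \<xi>" using \<xi> p by (intro linf_norm_nonneg) auto
  have r0: "0 \<le> r" unfolding r_def \<eta>_def using linf \<sigma> L n0 by simp
  define c where "c z = lin p (($) \<xi>) (estimator n p k \<eta> z)" for z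
  have [measurable]: "c \<in> borel_measurable (obs_space n p)"
    unfolding c_def by (rule estimator_measurable)
  have CI: "((\<lambda>z. c z - r), (\<lambda>z. c z + r)) \<in> conf_intervals n p \<alpha> ?\<Theta> ?T"
    unfolding conf_intervals_def
  proof (simp add: r0, rule INF_greatest)
    fix \<theta> assume "\<theta> \<in> ?\<Theta>"
    then obtain \<beta> where \<theta>: "\<theta> = (\<beta>, 1\<^sub>m p, \<sigma>)" and \<beta>: "\<beta> \<in> carrier_vec p" and sparse: "l0_norm \<beta> \<le> k"
      by (auto simp: param_space_def)
    have sparse': "card {j. j < p \<and> \<beta> $ j \<noteq> 0} \<le> k"
      using sparse \<beta> by (simp add: l0_norm_def supp_vec_def)
    interpret prob_space "obs_law n p \<theta>" unfolding \<theta> by (rule prob_space_obs_law[OF \<beta> \<sigma>])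
    let ?cov = "{z \<in> space (obs_space n p). c z - r \<le> \<xi> \<bullet> fst \<theta> \<and> \<xi> \<bullet> fst \<theta> \<le> c z + r}"
    have "good_obs n p k \<eta> (($) \<beta>) \<subseteq> ?cov"
    proof
      fix z assume z: "z \<in> good_obs n p k \<eta> (($) \<beta>)"
      have "\<xi> \<bullet> \<beta> = lin p (($) \<xi>) (($) \<beta>)"
        using \<beta> by (simp add: scalar_prod_def lin_def atLeast0LessThan mult.commute)
      then have "\<bar>c z - \<xi> \<bullet> \<beta>\<bar> = \<bar>\<Sum>j<p. (estimator n p k \<eta> z j - \<beta> $ j) * \<xi> $ j\<bar>"
        by (simp add: c_def lin_def sum_subtractf[symmetric] left_diff_distrib)
      also have "\<dots> \<le> (\<Sum>j<p. \<bar>estimator n p k \<eta> z j - \<beta> $ j\<bar> * linf_norm \<xi>)"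
        using \<xi> by (intro order_trans[OF sum_abs] sum_mono)
          (auto simp: abs_mult intro!: mult_left_mono abs_index_le_linf_norm)
      also have "\<dots> = (\<Sum>j<p. \<bar>estimator n p k \<eta> z j - \<beta> $ j\<bar>) * linf_norm \<xi>"
        by (simp add: sum_distrib_right)
      also have "\<dots> \<le> 96 * real k * \<eta> / n * linf_norm \<xi>"
        using n0 by (intro mult_right_mono[OF estimator_error[OF z sparse' k p] linf]) simp
      finally have "\<bar>c z - \<xi> \<bullet> \<beta>\<bar> \<le> r" by (simp add: r_def mult.commute)
      then show "z \<in> ?cov" using z by (auto simp: good_obs_def \<theta>)
    qed
    moreover have "?cov \<in> sets (obs_law n p \<theta>)" unfolding sets_obs_law by measurable
    ultimately have "prob (good_obs n p k \<eta> (($) \<beta>)) \<le> prob ?cov" by (rule finite_measure_mono)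
    moreover have "1 - \<alpha> \<le> prob (good_obs n p k \<eta> (($) \<beta>))"
      using good_obs_probability[OF \<beta> \<sigma> _ n, of k] tail p unfolding \<theta> \<eta>_def L_def by simp
    ultimately show "ennreal (1 - \<alpha>) \<le> emeasure (obs_law n p \<theta>) ?cov"
      by (simp add: emeasure_eq_measure ennreal_leI)
  qed
  have "minimax_length n p \<alpha> ?\<Theta> ?T \<le> (SUP \<theta>\<in>?\<Theta>. \<integral>\<^sup>+z. ennreal ((c z + r) - (c z - r)) \<partial>obs_law n p \<theta>)"
    unfolding minimax_length_def by (rule INF_lower2[OF CI]) simp
  also have "\<dots> \<le> ennreal (2 * r)"
  proof (rule SUP_least)
    fix \<theta> assume "\<theta> \<in> ?\<Theta>"
    then obtain \<beta> where \<theta>: "\<theta> = (\<beta>, 1\<^sub>m p, \<sigma>)" and \<beta>: "\<beta> \<in> carrier_vec p"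
      by (auto simp: param_space_def)
    show "(\<integral>\<^sup>+z. ennreal ((c z + r) - (c z - r)) \<partial>obs_law n p \<theta>) \<le> ennreal (2 * r)"
      using prob_space.emeasure_space_1[OF prob_space_obs_law[OF \<beta> \<sigma>], of n] by (simp add: \<theta>)
  qed
  finally show ?thesis unfolding r L_def .
qed

section \<open>Rates\<close>

lemma linf_norm_le_loading:
  assumes \<xi>: "\<xi> \<in> loadings p q cbar" and cbar: "1 \<le> cbar" and j: "j \<in> supp_vec \<xi>"
  shows "linf_norm \<xi> \<le> cbar * \<bar>\<xi> $ j\<bar>"
proof -
  let ?abs = "(\<lambda>j. \<bar>\<xi> $ j\<bar>) ` supp_vec \<xi>"
  have fin: "finite ?abs" by (simp add: supp_vec_def)
  have jd: "j < dim_vec \<xi>" using j by (simp add: supp_vec_def)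
  have "linf_norm \<xi> \<le> Max ?abs"
    unfolding linf_norm_def
  proof (rule Max.boundedI)
    fix a assume "a \<in> (\<lambda>j. \<bar>\<xi> $ j\<bar>) ` {..<dim_vec \<xi>}"
    then obtain i where i: "i < dim_vec \<xi>" "a = \<bar>\<xi> $ i\<bar>" by auto
    show "a \<le> Max ?abs"
    proof (cases "i \<in> supp_vec \<xi>")
      case True
      then show ?thesis unfolding i(2) using fin by (intro Max_ge) auto
    next
      case False
      then have "a = 0" using i by (simp add: supp_vec_def)
      also have "0 \<le> \<bar>\<xi> $ j\<bar>" by simp
      also have "\<dots> \<le> Max ?abs" using fin j by (intro Max_ge) auto
      finally show ?thesis .
    qed
  qed (use jd in auto)
  also have "\<dots> \<le> cbar * Min ?abs" using \<xi> by (simp add: loadings_def)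
  also have "\<dots> \<le> cbar * \<bar>\<xi> $ j\<bar>" using fin j cbar by (intro mult_left_mono Min_le) auto
  finally show ?thesis .
qed

text \<open>The grid has at most \<open>p\<^sup>8\<^sup>k = exp (8 k ln p)\<close> points, and \<open>8 k ln p \<le> 8 n / 100\<close> is below \<open>n / 12\<close>.\<close>

lemma tail_bound:
  assumes kn: "100 * (k * ln p) \<le> n" and k: "1 \<le> k" and p: "3 \<le> p"
  shows "2 / real p ^ 3 + p * exp (- real n / 2) + real (p * (2 * p\<^sup>2 + 1)) ^ (2 * k) * exp (- real n / 6)
    \<le> 2 / real p ^ 3 + 2 * exp (- real n / 12)"
proof -
  define L where "L = ln (real p)"
  have L: "0 \<le> L" and pL: "real p = exp L" using p by (auto simp: L_def)
  have "1 * L \<le> k * L" using k L by (intro mult_right_mono) auto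
  then have Ln: "100 * L \<le> n" using kn by (simp add: L_def)
  have "p * exp (- real n / 2) = exp (L + - real n / 2)" unfolding exp_add pL ..
  also have "\<dots> \<le> exp (- real n / 12)" using Ln by simp
  finally have 1: "p * exp (- real n / 2) \<le> exp (- real n / 12)" .
  have "real (p * (2 * p\<^sup>2 + 1)) \<le> real p ^ 4"
  proof -
    have "1 \<le> p\<^sup>2" using p by simp
    then have "2 * p\<^sup>2 + 1 \<le> 3 * p\<^sup>2" by linarith
    also have "\<dots> \<le> p * p\<^sup>2" using p by (intro mult_right_mono) auto
    finally have "p * (2 * p\<^sup>2 + 1) \<le> p * (p * p\<^sup>2)" by (rule mult_left_mono) simp
    also have "\<dots> = p ^ 4" by (simp add: power_numeral_reduce)
    finally show ?thesis by (metis of_nat_mono of_nat_power)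
  qed
  then have "real (p * (2 * p\<^sup>2 + 1)) ^ (2 * k) \<le> (real p ^ 4) ^ (2 * k)" by (intro power_mono) auto
  also have "\<dots> = real p ^ (8 * k)" by (simp add: power_mult[symmetric])
  also have "\<dots> = exp (real (8 * k) * L)" unfolding pL by (rule exp_of_nat_mult[symmetric])
  finally have "real (p * (2 * p\<^sup>2 + 1)) ^ (2 * k) * exp (- real n / 6) \<le> exp (real (8 * k) * L) * exp (- real n / 6)"
    by (rule mult_right_mono) simp
  also have "\<dots> = exp (real (8 * k) * L + - real n / 6)" by (rule exp_add[symmetric])
  also have "\<dots> \<le> exp (- real n / 12)" using kn by (simp add: L_def)
  finally show ?thesis using 1 by linarith
qed

text \<open>With \<open>\<rho>\<^sup>2 = \<sigma>\<^sup>2 d ln p / (2 n)\<close>, a common place of two supports costs the factor \<open>p powr d\<close>. Blocks have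
  size about \<open>q / k\<close>, so the exponent in \<open>minimax_length_lower\<close> is of order \<open>k\<^sup>2 p\<^sup>d / q\<close>, hence of order
  \<open>p powr (2 * \<gamma> + d - \<gamma>\<^sub>q) = p powr - d\<close> for \<open>d = (\<gamma>\<^sub>q - 2 * \<gamma>) / 2\<close>.\<close>

lemma dense_loading_lower:
  fixes \<alpha> \<gamma> \<gamma>\<^sub>q c\<^sub>q \<sigma> cbar \<epsilon> :: real
  assumes \<gamma>: "0 \<le> \<gamma>" and \<gamma>\<^sub>q: "2 * \<gamma> < \<gamma>\<^sub>q" "\<gamma>\<^sub>q \<le> 1" and c\<^sub>q: "0 < c\<^sub>q" and \<sigma>: "0 < \<sigma>" and cbar: "1 \<le> cbar"
    and k: "1 \<le> k" "real k \<le> real p powr \<gamma>" and kn: "k * ln p \<le> n" and p: "2 \<le> p"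
    and q: "\<bar>real q - c\<^sub>q * real p powr \<gamma>\<^sub>q\<bar> < 1" and \<xi>: "\<xi> \<in> loadings p q cbar"
    and \<epsilon>: "0 < \<epsilon>" "\<epsilon> \<le> 1"
    and large: "4 / c\<^sub>q * real p powr - ((\<gamma>\<^sub>q - 2 * \<gamma>) / 2) \<le> ln (1 + \<epsilon>\<^sup>2)"
  shows "ennreal (2 * (1 - 2 * \<alpha> - 2 * \<epsilon>) * \<sigma> * sqrt ((\<gamma>\<^sub>q - 2 * \<gamma>) / 4) / cbar * linf_norm \<xi> * k * sqrt (ln p / n))
    \<le> minimax_length n p \<alpha> (param_space p k (1\<^sub>m p) \<sigma>) (\<lambda>\<beta>. \<xi> \<bullet> \<beta>)"
proof -
  define d where "d = (\<gamma>\<^sub>q - 2 * \<gamma>) / 2"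
  have d: "0 < d" "d \<le> 1 / 2" using \<gamma> \<gamma>\<^sub>q by (auto simp: d_def)
  define L where "L = ln (real p)"
  have L: "0 < L" using p by (simp add: L_def)
  have k0: "0 < real k" using k by simp
  have n0: "0 < real n" using kn mult_pos_pos[OF k0 L] by (simp add: L_def)
  define P where "P = real p powr d"
  have P0: "0 < P" using p by (simp add: P_def)
  have p1: "1 \<le> real p" using p by simp
  have P_inv: "real p powr - d = 1 / P" by (simp add: P_def powr_minus inverse_eq_divide)
  have lnle: "ln (1 + \<epsilon>\<^sup>2) \<le> \<epsilon>\<^sup>2" using ln_add_one_self_le_self[of "\<epsilon>\<^sup>2"] by simp
  have "\<epsilon>\<^sup>2 \<le> 1" using \<epsilon> by (simp add: power_le_one)
  then have "4 / c\<^sub>q * (1 / P) \<le> 1" using large lnle unfolding d_def[symmetric] P_inv by linarith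
  then have cP: "4 \<le> c\<^sub>q * P" using P0 c\<^sub>q by (simp add: divide_le_eq mult.commute)
  define Q where "Q = real p powr \<gamma>\<^sub>q"
  have Qd: "Q = real p powr (2 * \<gamma>) * P * P"
    by (simp add: Q_def P_def powr_add[symmetric] d_def)
  have pg: "real p powr (2 * \<gamma>) = (real p powr \<gamma>)\<^sup>2"
    by (simp add: powr_powr[symmetric] power2_eq_square powr_add[symmetric])
  have pg1: "1 \<le> real p powr \<gamma>" using p1 \<gamma> by (rule ge_one_powr_ge_zero)
  have P1: "1 \<le> P" unfolding P_def using p1 d by (intro ge_one_powr_ge_zero) auto
  have Q_eq: "Q = (real p powr \<gamma>)\<^sup>2 * P * P" using Qd pg by simp
  have "4 * real p powr \<gamma> \<le> 4 * (real p powr \<gamma>)\<^sup>2"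
    using mult_left_mono[OF pg1, of "real p powr \<gamma>"] by (simp add: power2_eq_square)
  moreover have "4 * (real p powr \<gamma>)\<^sup>2 \<le> (c\<^sub>q * P) * (real p powr \<gamma>)\<^sup>2"
    by (rule mult_right_mono[OF cP]) simp
  moreover have "(c\<^sub>q * P) * (real p powr \<gamma>)\<^sup>2 * 1 \<le> (c\<^sub>q * P) * (real p powr \<gamma>)\<^sup>2 * P"
    using c\<^sub>q P0 by (intro mult_left_mono[OF P1]) simp
  moreover have "c\<^sub>q * Q = (c\<^sub>q * P) * (real p powr \<gamma>)\<^sup>2 * P" by (simp add: Q_eq)
  ultimately have "4 * real p powr \<gamma> \<le> c\<^sub>q * Q" by linarith
  then have cQ: "4 * real k \<le> c\<^sub>q * Q" using k by simp
  have qQ: "c\<^sub>q * Q / 2 \<le> real q" using q cQ k unfolding Q_def[symmetric] by linarith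
  then have q2k: "2 * k \<le> q" using cQ by linarith
  define m where "m = q div k"
  have km: "k * m \<le> q" by (simp add: m_def)
  have "q = k * m + q mod k" by (simp add: m_def)
  moreover have "q mod k < k" using k by simp
  ultimately have "q \<le> 2 * (k * m)" using q2k by linarith
  then have km2: "real q \<le> 2 * (real k * real m)" by (metis of_nat_le_iff of_nat_mult of_nat_numeral)
  have m0: "0 < m" using q2k k by (simp add: m_def div_greater_zero_iff)
  define \<rho> where "\<rho> = \<sigma> * sqrt (d / 2) * sqrt (L / n)"
  have \<rho>0: "0 \<le> \<rho>" using \<sigma> d L n0 by (simp add: \<rho>_def)
  have \<rho>2: "\<rho>\<^sup>2 = \<sigma>\<^sup>2 * (d / 2) * (L / n)" using d L n0 by (simp add: \<rho>_def power_mult_distrib)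
  have small: "2 * (k * \<rho>\<^sup>2) \<le> \<sigma>\<^sup>2"
  proof -
    have "2 * (k * \<rho>\<^sup>2) = \<sigma>\<^sup>2 * (d * (k * L / n))" by (simp add: \<rho>2)
    also have "\<dots> \<le> \<sigma>\<^sup>2 * 1"
      using kn n0 d k0 L by (intro mult_left_mono mult_le_one) (auto simp: L_def divide_le_eq)
    finally show ?thesis by simp
  qed
  have eP: "exp (2 * real n * \<rho>\<^sup>2 / \<sigma>\<^sup>2) = P"
    using n0 \<sigma> p by (simp add: \<rho>2 P_def powr_def L_def)
  have sm: "exp (k * exp (2 * real n * \<rho>\<^sup>2 / \<sigma>\<^sup>2) / m) \<le> 1 + \<epsilon>\<^sup>2"
  proof -
    have "k * P / m \<le> 4 / c\<^sub>q * (1 / P)"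
    proof -
      have "(real k)\<^sup>2 \<le> (real p powr \<gamma>)\<^sup>2" using k by (intro power_mono) auto
      then have "(real k)\<^sup>2 * P * P \<le> Q" unfolding Q_eq using P0 by (intro mult_right_mono) auto
      also have "\<dots> = c\<^sub>q * Q / 2 * (2 / c\<^sub>q)" using c\<^sub>q by simp
      also have "\<dots> \<le> 2 * (real k * real m) * (2 / c\<^sub>q)" using qQ km2 c\<^sub>q by (intro mult_right_mono) auto
      finally have "real k * (real k * P * P) \<le> real k * (4 / c\<^sub>q * real m)"
        by (simp add: power2_eq_square ac_simps)
      then have "real k * P * P \<le> 4 / c\<^sub>q * real m" using k0 by (rule mult_left_le_imp_le)
      then show ?thesis using P0 m0 c\<^sub>q by (simp add: field_simps)
    qed
    also have "\<dots> \<le> ln (1 + \<epsilon>\<^sup>2)" using large unfolding d_def[symmetric] P_inv .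
    finally have "exp (k * P / m) \<le> exp (ln (1 + \<epsilon>\<^sup>2))" by simp
    also have "\<dots> = 1 + \<epsilon>\<^sup>2" by (rule exp_ln) (simp add: add_pos_nonneg)
    finally show ?thesis unfolding eP .
  qed
  have \<xi>c: "\<xi> \<in> carrier_vec p" and card: "card (supp_vec \<xi>) = q"
    using \<xi> by (auto simp: loadings_def l0_norm_def)
  have b: "linf_norm \<xi> / cbar \<le> \<bar>\<xi> $ j\<bar>" if "j \<in> supp_vec \<xi>" for j
    using linf_norm_le_loading[OF \<xi> cbar that] cbar by (simp add: divide_le_eq mult.commute)
  have b0: "0 \<le> linf_norm \<xi> / cbar" using linf_norm_nonneg[of \<xi>] \<xi>c p cbar by auto
  have "ennreal (2 * (k * \<rho> * (linf_norm \<xi> / cbar)) * (1 - 2 * \<alpha> - 2 * \<epsilon>))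
    \<le> minimax_length n p \<alpha> (param_space p k (1\<^sub>m p) \<sigma>) (\<lambda>\<beta>. \<xi> \<bullet> \<beta>)"
    by (rule minimax_length_lower[OF \<sigma> \<xi>c _ m0 b0 b \<rho>0 small \<epsilon>(1) sm]) (simp add: card km)
  also have "2 * (k * \<rho> * (linf_norm \<xi> / cbar)) * (1 - 2 * \<alpha> - 2 * \<epsilon>)
    = 2 * (1 - 2 * \<alpha> - 2 * \<epsilon>) * \<sigma> * sqrt ((\<gamma>\<^sub>q - 2 * \<gamma>) / 4) / cbar * linf_norm \<xi> * k * sqrt (L / n)"
    by (simp add: \<rho>_def d_def)
  finally show ?thesis unfolding L_def .
qed

theorem mainTheorem11:
  fixes \<alpha> \<gamma> \<gamma>\<^sub>q c\<^sub>q \<sigma>\<^sub>0 cbar :: real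
  assumes "0 < \<alpha>" "\<alpha> < 1 / 2"
    and "0 \<le> \<gamma>" "\<gamma> < 1 / 2"
    and "2 * \<gamma> < \<gamma>\<^sub>q" "\<gamma>\<^sub>q \<le> 1"
    and "0 < c\<^sub>q" "0 < \<sigma>\<^sub>0" "1 \<le> cbar"
  shows "\<exists>c > 0. \<exists>c\<^sub>1 > 0. \<exists>C\<^sub>1 > 0. \<exists>N :: nat. \<forall>n \<ge> N. \<forall>p \<ge> N. \<forall>k :: nat. \<forall>q :: nat. \<forall>\<xi> :: real vec.
    1 \<le> k \<longrightarrow> real k \<le> c * min (real p powr \<gamma>) (real n / ln (real p)) \<longrightarrow>
    \<bar>real q - c\<^sub>q * real p powr \<gamma>\<^sub>q\<bar> < 1 \<longrightarrow> \<xi> \<in> loadings p q cbar \<longrightarrow>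
      ennreal (c\<^sub>1 * linf_norm \<xi> * real k * sqrt (ln (real p) / real n))
        \<le> minimax_length n p \<alpha> (param_space p k (1\<^sub>m p) \<sigma>\<^sub>0) (\<lambda>\<beta>. \<xi> \<bullet> \<beta>) \<and>
      minimax_length n p \<alpha> (param_space p k (1\<^sub>m p) \<sigma>\<^sub>0) (\<lambda>\<beta>. \<xi> \<bullet> \<beta>)
        \<le> ennreal (C\<^sub>1 * linf_norm \<xi> * real k * sqrt (ln (real p) / real n))"
proof -
  \<comment> \<open>each mixture is within \<open>\<epsilon>\<close> of the reference law, which leaves \<open>1 - 2 * \<alpha> - 2 * \<epsilon> = (1 - 2 * \<alpha>) / 2 > 0\<close>\<close>
  define \<epsilon> where "\<epsilon> = (1 - 2 * \<alpha>) / 4"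
  have \<epsilon>: "0 < \<epsilon>" "\<epsilon> \<le> 1" using assms(1,2) by (auto simp: \<epsilon>_def)
  define d where "d = (\<gamma>\<^sub>q - 2 * \<gamma>) / 2"
  have d: "0 < d" using assms by (simp add: d_def)
  define c\<^sub>1 where "c\<^sub>1 = 2 * (1 - 2 * \<alpha> - 2 * \<epsilon>) * \<sigma>\<^sub>0 * sqrt ((\<gamma>\<^sub>q - 2 * \<gamma>) / 4) / cbar"
  have c1: "0 < c\<^sub>1" unfolding c\<^sub>1_def \<epsilon>_def using assms by simp
  have "(\<lambda>p. 4 / c\<^sub>q * real p powr - d) \<longlonglongrightarrow> 4 / c\<^sub>q * 0"
    by (intro tendsto_intros tendsto_neg_powr d filterlim_real_sequentially) (use d in auto)
  moreover have "4 / c\<^sub>q * 0 < ln (1 + \<epsilon>\<^sup>2)" using ln_gt_zero[of "1 + \<epsilon>\<^sup>2"] \<epsilon> by simp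
  ultimately have "\<forall>\<^sub>F p in sequentially. 4 / c\<^sub>q * real p powr - d < ln (1 + \<epsilon>\<^sup>2)"
    by (rule order_tendstoD(2))
  moreover have "(\<lambda>p. 2 / real p ^ 3) \<longlonglongrightarrow> 0" by real_asymp
  then have "\<forall>\<^sub>F p in sequentially. 2 / real p ^ 3 < \<alpha> / 2"
    by (rule order_tendstoD(2)) (use assms(1) in simp)
  moreover have "(\<lambda>n. 2 * exp (- real n / 12)) \<longlonglongrightarrow> 0" by real_asymp
  then have "\<forall>\<^sub>F n in sequentially. 2 * exp (- real n / 12) < \<alpha> / 2"
    by (rule order_tendstoD(2)) (use assms(1) in simp)
  moreover note eventually_ge_at_top[of 960]
  ultimately have "\<forall>\<^sub>F N in sequentially. 4 / c\<^sub>q * real N powr - d < ln (1 + \<epsilon>\<^sup>2) \<and> 2 / real N ^ 3 < \<alpha> / 2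
      \<and> 2 * exp (- real N / 12) < \<alpha> / 2 \<and> 960 \<le> N"
    by (intro eventually_conj)
  then obtain N where N: "\<And>M. N \<le> M \<Longrightarrow> 4 / c\<^sub>q * real M powr - d < ln (1 + \<epsilon>\<^sup>2) \<and> 2 / real M ^ 3 < \<alpha> / 2
      \<and> 2 * exp (- real M / 12) < \<alpha> / 2 \<and> 960 \<le> M"
    unfolding eventually_sequentially by blast
  show ?thesis
  proof (rule exI[of _ "1 / 100"], intro conjI, simp, rule exI[of _ c\<^sub>1], intro conjI, rule c1,
      rule exI[of _ "768 * \<sigma>\<^sub>0"], intro conjI, use assms in simp, rule exI[of _ N], intro allI impI)
    fix n p k q :: nat and \<xi> :: "real vec"
    assume n: "N \<le> n" and p: "N \<le> p" and k: "1 \<le> k"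
      and kb: "real k \<le> 1 / 100 * min (real p powr \<gamma>) (real n / ln (real p))"
      and q: "\<bar>real q - c\<^sub>q * real p powr \<gamma>\<^sub>q\<bar> < 1" and \<xi>: "\<xi> \<in> loadings p q cbar"
    have p960: "960 \<le> p" using N[OF p] by simp
    have lnp: "0 < ln (real p)" using p960 by simp
    have kp: "real k \<le> real p powr \<gamma>" using kb by simp
    also have "\<dots> \<le> real p powr 1" using p960 assms by (intro powr_mono) auto
    finally have kp1: "k \<le> p" using p960 by simp
    have "100 * real k \<le> real n / ln (real p)" using kb by simp
    then have kn: "100 * (k * ln p) \<le> n" using lnp by (simp add: pos_le_divide_eq mult.assoc)
    have "1 * ln p \<le> k * ln p" using k lnp by (intro mult_right_mono) auto
    then have n8: "8 * ln p \<le> n" using kn lnp by linarith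
    have kn1: "k * ln p \<le> n" using kn lnp k by (smt (verit) mult_nonneg_nonneg of_nat_0_le_iff)
    show "ennreal (c\<^sub>1 * linf_norm \<xi> * real k * sqrt (ln (real p) / real n))
        \<le> minimax_length n p \<alpha> (param_space p k (1\<^sub>m p) \<sigma>\<^sub>0) (\<lambda>\<beta>. \<xi> \<bullet> \<beta>) \<and>
      minimax_length n p \<alpha> (param_space p k (1\<^sub>m p) \<sigma>\<^sub>0) (\<lambda>\<beta>. \<xi> \<bullet> \<beta>)
        \<le> ennreal (768 * \<sigma>\<^sub>0 * linf_norm \<xi> * real k * sqrt (ln (real p) / real n))"
    proof
      show "ennreal (c\<^sub>1 * linf_norm \<xi> * real k * sqrt (ln (real p) / real n))
        \<le> minimax_length n p \<alpha> (param_space p k (1\<^sub>m p) \<sigma>\<^sub>0) (\<lambda>\<beta>. \<xi> \<bullet> \<beta>)"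
        unfolding c\<^sub>1_def
        by (rule dense_loading_lower[OF assms(3,5,6,7,8,9) k kp kn1 _ q \<xi> \<epsilon>])
          (use p960 N[OF p] in \<open>auto simp: d_def\<close>)
      have "\<xi> \<in> carrier_vec p" using \<xi> by (simp add: loadings_def)
      moreover have "2 / real p ^ 3 + p * exp (- real n / 2) + real (p * (2 * p\<^sup>2 + 1)) ^ (2 * k) * exp (- real n / 6) \<le> \<alpha>"
        using tail_bound[OF kn k] p960 N[OF p] N[OF n] by linarith
      ultimately show "minimax_length n p \<alpha> (param_space p k (1\<^sub>m p) \<sigma>\<^sub>0) (\<lambda>\<beta>. \<xi> \<bullet> \<beta>)
        \<le> ennreal (768 * \<sigma>\<^sub>0 * linf_norm \<xi> * real k * sqrt (ln (real p) / real n))"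
        by (intro minimax_length_upper assms(8) k kp1 p960 n8)
    qed
  qed
qed

end
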